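(* Let $n\in\mathbb{N}\cup\{\infty\}$ and $g\in S(\Omega_n)$. Then there exist $z_0\in\mathbb{C}$ and $T\in\mathrm{Aut}_n$ such that, almost everywhere, $$|g\circ T-g|\geq\frac{\sqrt3}{2}\big(|g-z_0|+|g\circ T-z_0|\big),$$ i.e. $\Lambda(g)\geq\frac{\sqrt3}{2}$. Moreover, $\Omega_n$ can be partitioned into disjoint measurable sets as follows: (i) if $n$ is even or $n=\infty$, there is a partition $\{X_1\}\cup\{X_2^{m,i}:m\geq1,\ 1\leq i\leq2\}$ such that $g(X_1)\subset\{z_0\}$, $\mu_n(X_2^{m,1})=\mu_n(X_2^{m,2})$ and the sets $g(X_2^{m,1})$, $g(X_2^{m,2})$ are $(z_0,\frac\pi3)$-conjugate for $m=1,2,\dots$; moreover, writing $X_2=\Omega_n\setminus X_1$, one has $T^k|_{X_k}=\mathrm{Id}_{X_k}$ for $k=1,2$; (ii) if $n$ is odd, there is a partition $X_1,X_2,X_3,X_5$ with $T^k|_{X_k}=\mathrm{Id}_{X_k}$ for $k=1,2,3,5$. If $n<\infty$, then there exist $z_0\in\mathbb{C}$ and $T\in\mathrm{Aut}_n$ with $\Lambda(g,T,z_0)=\Lambda(g)$.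
   Context: For $n\in\mathbb{N}$, $(\Omega_n,\mu_n)$ is $\{1,\dots,n\}$ with normalized counting measure; $(\Omega_\infty,\mu_\infty)$ is $[0,1]$ with Lebesgue measure. $S(\Omega_n)$ is the set of complex-valued measurable functions on $\Omega_n$. $\mathrm{Aut}_n$ is the set of automorphisms of $(\Omega_n,\mu_n)$: measurable bijections $T:N_1\to N_2$ between full-measure subsets with measurable inverse and $\mu_n\circ T^{-1}=\mu_n$. For $g\in S(\Omega_n)$, $T\in\mathrm{Aut}_n$, $z\in\mathbb{C}$: $\Lambda(g,T,z)=\operatorname{ess\,inf}\frac{|g-g\circ T|}{|g-z|+|g\circ T-z|}$ with the convention $\frac00=1$, and $\Lambda(g)=\sup\{\Lambda(g,T,z):T\in\mathrm{Aut}_n,z\in\mathbb{C}\}$. For $z\in\mathbb{C}$ and $0\le\alpha\le\pi$, sets $A,B\subset\mathbb{C}$ are $(z,\alpha)$-conjugate if there are two lines in $\mathbb{C}$ intersecting at $z$ at angle $\alpha$ such that $A$ and $B$ lie in opposite closed angular sectors with vertex $z$ and opening $\alpha$. *)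

theory Defs
  imports "HOL-Analysis.Analysis" "HOL-Library.Extended_Nat"
begin

definition Omega :: "enat \<Rightarrow> real measure" where
  "Omega n = (case n of enat k \<Rightarrow> uniform_count_measure (real ` {1..k})
                      | \<infinity> \<Rightarrow> lebesgue_on {0..1})"

definition is_aut :: "'a measure \<Rightarrow> ('a \<Rightarrow> 'a) \<Rightarrow> 'a set \<Rightarrow> 'a set \<Rightarrow> bool" where
  "is_aut M T N1 N2 \<longleftrightarrow>
     N1 \<in> sets M \<and> N2 \<in> sets M \<and>
     emeasure M (space M - N1) = 0 \<and> emeasure M (space M - N2) = 0 \<and>
     bij_betw T N1 N2 \<and>
     T \<in> measurable (restrict_space M N1) (restrict_space M N2) \<and>
     the_inv_into N1 T \<in> measurable (restrict_space M N2) (restrict_space M N1) \<and>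
     (\<forall>A \<in> sets M. A \<subseteq> N2 \<longrightarrow> emeasure M (T -` A \<inter> N1) = emeasure M A)"

definition lam_ratio :: "('a \<Rightarrow> complex) \<Rightarrow> ('a \<Rightarrow> 'a) \<Rightarrow> complex \<Rightarrow> 'a \<Rightarrow> real" where
  "lam_ratio g T z x =
     (if cmod (g x - z) + cmod (g (T x) - z) = 0 then 1
      else cmod (g x - g (T x)) / (cmod (g x - z) + cmod (g (T x) - z)))"

text \<open>Lambda(g,T,z): essential infimum of the quotient over the domain N1 of T.\<close>
definition Lam3 :: "'a measure \<Rightarrow> ('a \<Rightarrow> complex) \<Rightarrow> ('a \<Rightarrow> 'a) \<Rightarrow> 'a set \<Rightarrow> complex \<Rightarrow> ereal" where
  "Lam3 M g T N1 z = Liminf (ae_filter (restrict_space M N1)) (\<lambda>x. ereal (lam_ratio g T z x))"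

definition Lam :: "'a measure \<Rightarrow> ('a \<Rightarrow> complex) \<Rightarrow> ereal" where
  "Lam M g = Sup {Lam3 M g T N1 z | T N1 N2 z. is_aut M T N1 N2}"

definition conjugate :: "complex \<Rightarrow> real \<Rightarrow> complex set \<Rightarrow> complex set \<Rightarrow> bool" where
  "conjugate z \<alpha> A B \<longleftrightarrow> (\<exists>\<theta>.
     A \<subseteq> {z + complex_of_real r * cis \<phi> | r \<phi>. 0 \<le> r \<and> \<theta> \<le> \<phi> \<and> \<phi> \<le> \<theta> + \<alpha>} \<and>
     B \<subseteq> {z - complex_of_real r * cis \<phi> | r \<phi>. 0 \<le> r \<and> \<theta> \<le> \<phi> \<and> \<phi> \<le> \<theta> + \<alpha>})"

end

theory Submission
  imports Defs "HOL-Probability.Probability_Measure"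
begin

text \<open>
  There are a point \<open>z\<close> and three lines through \<open>z\<close>, pairwise at angle \<open>\<pi>/3\<close>, each of which halves the
  distribution of \<open>g\<close>: medians \<open>p(\<theta>)\<close> satisfy \<open>p(\<theta> + \<pi>) = -p(\<theta>)\<close>, hence
  \<open>p(\<theta>) + p(\<theta> + 2\<pi>/3) + p(\<theta> + 4\<pi>/3)\<close> has a zero, which is the condition for concurrency. To have unique,
  continuous medians, the sign function is replaced by a steep smooth one and a limit is taken.
  Three halving lines make opposite sectors of opening \<open>\<pi>/3\<close> have equal measure, once the mass on the lines
  and at \<open>z\<close> is distributed suitably, and any \<open>T\<close> exchanging opposite sectors works, because two vectors
  at angle at least \<open>2\<pi>/3\<close> satisfy \<open>|v - w| \<ge> (\<surd>3/2) (|v| + |w|)\<close>.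
  If the number of points is odd and \<open>z\<close> is not one of the values, each line contains a point, and
  these allow to split off one cycle of length 3 or 5 so that the remaining points are still balanced.
\<close>

section \<open>Sectors and angles\<close>

text \<open>The three unit directions add up to 0, so three numbers are the projections of one point
  exactly when they add up to 0; this is why a zero of the sum of medians means concurrency. If
  nothing lies on the lines and s1, ..., s6 are the masses of the sectors in cyclic order, then s1 +
  s2 + s3 = s4 + s5 + s6 and s2 + s3 + s4 = s5 + s6 + s1, hence s1 = s4, and similarly for the other
  pairs. The obstacle is mass on the lines and at the centre, where halving gives only inequalities.
  If y0, y1, y2 are the surpluses of the three pairs of opposite sectors after the lines have been
  divided, then the surpluses across the three lines, together with their sum, are up to sign the
  four combinations y0 \<plusminus> y1 \<plusminus> y2. Bounding all four by the central mass bounds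
  |y0| + |y1| + |y2|, which is what is needed to fill the deficits. Hence a fourth bound, for
  alternating triples of sectors, accompanies the three lines. For points the division must respect
  integrality, hence the parity bookkeeping. In the finite case the supremum is attained because
  there are finitely many permutations and a quotient bounded away from 0 confines its centre to a
  bounded set.\<close>

definition wide :: "complex \<Rightarrow> complex \<Rightarrow> bool" where
  "wide w w' \<longleftrightarrow> sqrt 3 / 2 * (cmod w + cmod w') \<le> cmod (w - w')"

text \<open>
  The three directions are \<open>2\<pi>/3\<close> apart, so the projections sum to \<open>0\<close>, and the six closed sectors of
  opening \<open>\<pi>/3\<close> cut out by the three orthogonal lines are the sets where two of the projections are
  \<open>\<le> 0\<close>, respectively \<open>\<ge> 0\<close>.
\<close>

definition proj3 :: "real \<Rightarrow> nat \<Rightarrow> complex \<Rightarrow> real" where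
  "proj3 \<theta> j w = w \<bullet> cis (\<theta> + 2 * pi * real j / 3)"

lemma wide_commute: "wide w w' \<longleftrightarrow> wide w' w"
  by (simp add: wide_def norm_minus_commute add.commute)

text \<open>The hypothesis bounds the cosine of the angle by -1/2. The law of cosines then makes |w
  - w'|^2 at least |w|^2 + |w'|^2 + |w| |w'|, which exceeds 3/4 (|w| + |w'|)^2 by (|w| - |w'|)^2 /
  4. This is the origin of sqrt 3 / 2, reached for equal lengths at angle 2pi/3.\<close>

lemma wideI:
  assumes "2 * (w \<bullet> w') \<le> - (cmod w * cmod w')"
  shows "wide w w'"
proof -
  have "(sqrt 3 / 2 * (cmod w + cmod w'))\<^sup>2 = 3 / 4 * (cmod w + cmod w')\<^sup>2"
    by (simp add: power_mult_distrib power_divide)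
  also have "\<dots> \<le> (cmod w)\<^sup>2 + (cmod w')\<^sup>2 + cmod w * cmod w'"
    using zero_le_power2[of "cmod w - cmod w'"] by (simp add: power2_eq_square algebra_simps)
  also have "\<dots> \<le> (cmod w)\<^sup>2 + (cmod w')\<^sup>2 - 2 * (w \<bullet> w')"
    using assms by simp
  also have "\<dots> = (cmod (w - w'))\<^sup>2"
    by (simp add: power2_norm_eq_inner inner_diff inner_commute)
  finally show ?thesis
    unfolding wide_def by (rule power2_le_imp_le) simp
qed

section \<open>Inner products in terms of the three projections\<close>

lemma proj3_expand:
  "proj3 \<theta> 0 w = w \<bullet> cis \<theta>"
  "proj3 \<theta> 1 w = - (w \<bullet> cis \<theta>) / 2 + sqrt 3 / 2 * (w \<bullet> (\<i> * cis \<theta>))"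
  "proj3 \<theta> 2 w = - (w \<bullet> cis \<theta>) / 2 - sqrt 3 / 2 * (w \<bullet> (\<i> * cis \<theta>))"
proof -
  show "proj3 \<theta> 0 w = w \<bullet> cis \<theta>" by (simp add: proj3_def)
  have 1: "\<theta> + 2 * pi * real 1 / 3 = \<theta> + pi * 2 / 3" by simp
  show "proj3 \<theta> 1 w = - (w \<bullet> cis \<theta>) / 2 + sqrt 3 / 2 * (w \<bullet> (\<i> * cis \<theta>))"
    unfolding proj3_def 1 inner_complex_def
    by (simp only: cis.simps cos_add sin_add cos_120' sin_120') (simp add: field_simps)
  have 2: "\<theta> + 2 * pi * real 2 / 3 = \<theta> + pi * 2 / 3 + pi * 2 / 3" by simp
  have s: "sqrt 3 * (sqrt 3 * x) = 3 * x" for x :: real by (simp flip: mult.assoc)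
  show "proj3 \<theta> 2 w = - (w \<bullet> cis \<theta>) / 2 - sqrt 3 / 2 * (w \<bullet> (\<i> * cis \<theta>))"
    unfolding proj3_def 2 inner_complex_def
    by (simp only: cis.simps cos_add sin_add cos_120' sin_120') (simp add: field_simps s)
qed

lemma proj3_sum: "proj3 \<theta> 0 w + proj3 \<theta> 1 w + proj3 \<theta> 2 w = 0"
  by (simp only: proj3_expand)

text \<open>Three unit vectors at mutual angles 2pi/3 form a tight frame of the plane with frame
  constant 3/2.\<close>

lemma inner_proj3:
  "w \<bullet> w' = 2 / 3 * (proj3 \<theta> 0 w * proj3 \<theta> 0 w' + proj3 \<theta> 1 w * proj3 \<theta> 1 w' + proj3 \<theta> 2 w * proj3 \<theta> 2 w')"
proof -
  have s: "sqrt 3 * (sqrt 3 * x) = 3 * x" for x :: real by (simp flip: mult.assoc)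
  have "w \<bullet> w' = (w \<bullet> cis \<theta>) * (w' \<bullet> cis \<theta>) + (w \<bullet> (\<i> * cis \<theta>)) * (w' \<bullet> (\<i> * cis \<theta>))"
  proof -
    have "(w \<bullet> cis \<theta>) * (w' \<bullet> cis \<theta>) + (w \<bullet> (\<i> * cis \<theta>)) * (w' \<bullet> (\<i> * cis \<theta>))
       = (Re w * Re w' + Im w * Im w') * ((cos \<theta>)\<^sup>2 + (sin \<theta>)\<^sup>2)"
      by (simp add: inner_complex_def power2_eq_square algebra_simps del: sin_cos_squared_add sin_cos_squared_add2 sin_cos_squared_add3)
    then show ?thesis by (simp only: sin_cos_squared_add2 inner_complex_def) simp
  qed
  then show ?thesis by (simp only: proj3_expand) (simp add: field_simps s)
qed

text \<open>By \<open>inner_proj3\<close>, \<open>B\<close> is -3/2 times the inner product and the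
  two factors are 3/2 times the squared norms, so the last hypothesis is the squared form of that of
  \<open>wideI\<close>. Angles are thereby replaced by polynomial inequalities.\<close>

lemma wide_proj3:
  assumes "- (proj3 \<theta> 0 w * proj3 \<theta> 0 w' + proj3 \<theta> 1 w * proj3 \<theta> 1 w' + proj3 \<theta> 2 w * proj3 \<theta> 2 w') = B"
    and "0 \<le> B"
    and "((proj3 \<theta> 0 w)\<^sup>2 + (proj3 \<theta> 1 w)\<^sup>2 + (proj3 \<theta> 2 w)\<^sup>2) *
         ((proj3 \<theta> 0 w')\<^sup>2 + (proj3 \<theta> 1 w')\<^sup>2 + (proj3 \<theta> 2 w')\<^sup>2) \<le> 4 * B\<^sup>2"
  shows "wide w w'"
proof (rule wideI)
  have n: "(cmod v)\<^sup>2 = 2 / 3 * ((proj3 \<theta> 0 v)\<^sup>2 + (proj3 \<theta> 1 v)\<^sup>2 + (proj3 \<theta> 2 v)\<^sup>2)" for v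
    using inner_proj3[of v v \<theta>] by (simp only: power2_norm_eq_inner) (simp only: power2_eq_square)
  have "(cmod w * cmod w')\<^sup>2 \<le> (4 / 3 * B)\<^sup>2"
    using mult_left_mono[OF assms(3), of "4 / 9"] by (simp only: power_mult_distrib n) (simp add: power_divide algebra_simps)
  then have "cmod w * cmod w' \<le> 4 / 3 * B"
    by (rule power2_le_imp_le) (use assms(2) in simp)
  moreover have "2 * (w \<bullet> w') = - (4 / 3 * B)"
    using assms(1) by (simp add: inner_proj3[of w w' \<theta>])
  ultimately show "2 * (w \<bullet> w') \<le> - (cmod w * cmod w')" by simp
qed

text \<open>The third projections are -(x + y) and -(x' + y'). In the nonnegative variables
  \<open>X\<close>, \<open>Y\<close>, \<open>x'\<close>, \<open>y'\<close> the difference of the two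
  sides is a polynomial with nonnegative coefficients.\<close>

lemma opposite_sector_algebra:
  fixes x y x' y' :: real
  assumes "x \<le> 0" "y \<le> 0" "0 \<le> x'" "0 \<le> y'"
  shows "0 \<le> - (x * x' + y * y' + (x + y) * (x' + y'))"
    and "(x\<^sup>2 + y\<^sup>2 + (x + y)\<^sup>2) * (x'\<^sup>2 + y'\<^sup>2 + (x' + y')\<^sup>2)
         \<le> 4 * (- (x * x' + y * y' + (x + y) * (x' + y')))\<^sup>2"
proof -
  define X Y where "X = - x" and "Y = - y"
  have X: "0 \<le> X" "0 \<le> Y" "x = - X" "y = - Y" using assms by (auto simp: X_def Y_def)
  have e: "- (x * x' + y * y' + (x + y) * (x' + y')) = X * x' + Y * y' + (X + Y) * (x' + y')"
    by (simp add: X algebra_simps)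
  show "0 \<le> - (x * x' + y * y' + (x + y) * (x' + y'))"
    unfolding e using X assms by simp
  have "4 * (X * x' + Y * y' + (X + Y) * (x' + y'))\<^sup>2
      - (X\<^sup>2 + Y\<^sup>2 + (X + Y)\<^sup>2) * (x'\<^sup>2 + y'\<^sup>2 + (x' + y')\<^sup>2)
      = (12 :: real) * ((X * x')\<^sup>2 + (Y * y')\<^sup>2) + 12 * (X * X) * (x' * y') + 12 * (X * Y) * (x' * x')
        + 12 * (X * Y) * (y' * y') + 12 * (Y * Y) * (x' * y') + 36 * (X * Y) * (x' * y')"
    by algebra
  also have "\<dots> \<ge> 0" using X assms by simp
  finally show "(x\<^sup>2 + y\<^sup>2 + (x + y)\<^sup>2) * (x'\<^sup>2 + y'\<^sup>2 + (x' + y')\<^sup>2)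
         \<le> 4 * (- (x * x' + y * y' + (x + y) * (x' + y')))\<^sup>2"
    unfolding e by (simp add: X power2_eq_square algebra_simps)
qed

definition perm3 :: "nat \<Rightarrow> nat \<Rightarrow> nat \<Rightarrow> bool" where
  "perm3 i j k \<longleftrightarrow> (i, j, k) \<in> {(0, 1, 2), (0, 2, 1), (1, 0, 2), (1, 2, 0), (2, 0, 1), (2, 1, 0)}"

lemma sum_perm3: "perm3 i j k \<Longrightarrow> f i + f j + f k = f 0 + f 1 + f (2::nat)" for f :: "nat \<Rightarrow> real"
  by (auto simp: perm3_def)

lemma wide_opposite_sectors:
  assumes "perm3 i j k"
    and "proj3 \<theta> i w \<le> 0" "proj3 \<theta> j w \<le> 0" "0 \<le> proj3 \<theta> i w'" "0 \<le> proj3 \<theta> j w'"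
  shows "wide w w'"
proof -
  let ?p = "proj3 \<theta>"
  note p = sum_perm3[OF assms(1)]
  have kk: "?p k v = - (?p i v + ?p j v)" for v
    using p[of "\<lambda>l. ?p l v"] proj3_sum[of \<theta> v] by simp
  note alg = opposite_sector_algebra[OF assms(2-5)]
  show ?thesis
  proof (rule wide_proj3)
    show "- (?p 0 w * ?p 0 w' + ?p 1 w * ?p 1 w' + ?p 2 w * ?p 2 w')
      = - (?p i w * ?p i w' + ?p j w * ?p j w' + (?p i w + ?p j w) * (?p i w' + ?p j w'))"
      using p[of "\<lambda>l. ?p l w * ?p l w'"] unfolding kk by (simp add: algebra_simps)
    show "((?p 0 w)\<^sup>2 + (?p 1 w)\<^sup>2 + (?p 2 w)\<^sup>2) *
         ((?p 0 w')\<^sup>2 + (?p 1 w')\<^sup>2 + (?p 2 w')\<^sup>2)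
       \<le> 4 * (- (?p i w * ?p i w' + ?p j w * ?p j w' + (?p i w + ?p j w) * (?p i w' + ?p j w')))\<^sup>2"
      using alg(2) p[of "\<lambda>l. (?p l w)\<^sup>2"] p[of "\<lambda>l. (?p l w')\<^sup>2"] unfolding kk power2_minus by simp
  qed (fact alg(1))
qed

text \<open>Two of the three lines meet at the angles pi/3 and 2pi/3, and the signs of the third
  projections decide which of them occurs. The norm bound of \<open>wide_proj3\<close> is an
  equality here. Such pairs serve the odd cycles.\<close>

lemma wide_rays:
  assumes "perm3 i j k"
    and "proj3 \<theta> i w = 0" "proj3 \<theta> j w' = 0" "proj3 \<theta> k w * proj3 \<theta> k w' \<le> 0"
  shows "wide w w'"
proof -
  let ?p = "proj3 \<theta>"
  note p = sum_perm3[OF assms(1)]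
  have e: "?p j w = - ?p k w" "?p i w' = - ?p k w'"
    using p[of "\<lambda>l. ?p l w"] p[of "\<lambda>l. ?p l w'"] proj3_sum[of \<theta> w] proj3_sum[of \<theta> w'] assms by simp_all
  show ?thesis
  proof (rule wide_proj3)
    show "- (?p 0 w * ?p 0 w' + ?p 1 w * ?p 1 w' + ?p 2 w * ?p 2 w')
      = - (?p k w * ?p k w')"
      using p[of "\<lambda>l. ?p l w * ?p l w'"] by (simp add: assms e)
    show "((?p 0 w)\<^sup>2 + (?p 1 w)\<^sup>2 + (?p 2 w)\<^sup>2) *
         ((?p 0 w')\<^sup>2 + (?p 1 w')\<^sup>2 + (?p 2 w')\<^sup>2) \<le> 4 * (- (?p k w * ?p k w'))\<^sup>2"
      using p[of "\<lambda>l. (?p l w)\<^sup>2", symmetric] p[of "\<lambda>l. (?p l w')\<^sup>2", symmetric]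
      by (simp only: assms e power_mult_distrib power2_minus) simp
  qed (use assms in simp)
qed

lemma proj3_eq_0_iff:
  "proj3 \<theta> 0 w = 0 \<and> proj3 \<theta> 1 w = 0 \<and> proj3 \<theta> 2 w = 0 \<longleftrightarrow> w = 0"
proof
  assume "proj3 \<theta> 0 w = 0 \<and> proj3 \<theta> 1 w = 0 \<and> proj3 \<theta> 2 w = 0"
  then have "w \<bullet> w = 0" by (simp add: inner_proj3[of w w \<theta>])
  then show "w = 0" by simp
qed (simp add: proj3_def)

section \<open>Signs of projections and angular sectors\<close>

text \<open>The sector is bisected by \<open>cis \<beta>\<close>. With \<open>\<psi>\<close> the
  argument relative to \<open>\<beta>\<close>, the hypotheses say that the cosines of \<psi> - 2pi/3
  and \<psi> + 2pi/3 are not positive; beyond pi/6 on either side one of them is positive, since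
  \<open>\<psi>\<close> lies in (-pi, pi].\<close>

lemma in_sector:
  fixes w :: complex
  assumes "w \<bullet> cis (\<beta> + 2 * pi / 3) \<le> 0" "w \<bullet> cis (\<beta> - 2 * pi / 3) \<le> 0"
  shows "\<exists>r \<phi>. w = complex_of_real r * cis \<phi> \<and> 0 \<le> r \<and> \<beta> - pi / 6 \<le> \<phi> \<and> \<phi> \<le> \<beta> - pi / 6 + pi / 3"
proof (cases "w = 0")
  case True
  then show ?thesis by (intro exI[of _ 0] exI[of _ \<beta>]) simp
next
  case False
  define v where "v = w * cis (- \<beta>)"
  define \<psi> where "\<psi> = Arg v"
  have b: "- pi < \<psi>" "\<psi> \<le> pi" using Arg_bounded[of v] by (auto simp: \<psi>_def)
  have v: "v = complex_of_real (cmod w) * cis \<psi>"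
    using rcis_cmod_Arg[of v] by (simp add: \<psi>_def rcis_def v_def norm_mult)
  have "w = v * cis \<beta>" by (simp add: v_def mult.assoc cis_mult)
  then have w: "w = complex_of_real (cmod w) * cis (\<beta> + \<psi>)"
    by (metis v mult.assoc cis_mult add.commute)
  have pos: "cmod w > 0" using False by simp
  have ip: "w \<bullet> cis t = cmod w * cos (\<beta> + \<psi> - t)" for t
    by (subst w) (simp add: inner_complex_def cos_diff algebra_simps)
  have 1: "cos (\<psi> - 2 * pi / 3) \<le> 0"
    using assms(1) pos unfolding ip by (simp add: mult_le_0_iff)
  have 2: "cos (\<psi> + 2 * pi / 3) \<le> 0"
    using assms(2) pos unfolding ip by (simp add: mult_le_0_iff)
  have "\<psi> \<le> pi / 6"
  proof (rule ccontr)
    assume "\<not> ?thesis"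
    then have "cos (\<psi> - 2 * pi / 3) > 0" using b by (intro cos_gt_zero_pi) linarith+
    then show False using 1 by simp
  qed
  moreover have "- pi / 6 \<le> \<psi>"
  proof (rule ccontr)
    assume "\<not> ?thesis"
    then have "cos (\<psi> + 2 * pi / 3) > 0" using b by (intro cos_gt_zero_pi) linarith+
    then show False using 2 by simp
  qed
  ultimately show ?thesis using w
    by (intro exI[of _ "cmod w"] exI[of _ "\<beta> + \<psi>"]) auto
qed

lemma conjugate_opposite_sectors:
  assumes "perm3 i j k"
    and A: "\<And>w. w \<in> A \<Longrightarrow> proj3 \<theta> i (w - z) \<le> 0 \<and> proj3 \<theta> j (w - z) \<le> 0"
    and B: "\<And>w. w \<in> B \<Longrightarrow> 0 \<le> proj3 \<theta> i (w - z) \<and> 0 \<le> proj3 \<theta> j (w - z)"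
  shows "conjugate z (pi / 3) A B"
proof -
  \<comment> \<open>The other two directions are \<beta> + 2pi/3 and \<beta> - 2pi/3 up to full
    turns, so \<open>cis \<beta>\<close> bisects the sector containing \<open>A\<close>, which
    begins at the angle \<beta> - pi/6.\<close>
  define \<beta> where "\<beta> = \<theta> + 2 * pi * real k / 3"
  have per: "cis (t + 2 * pi) = cis t" "cis (t - 2 * pi) = cis t" for t
    by (simp_all add: complex_eq_iff cos_diff sin_diff)
  have "cis (\<beta> + 2 * pi / 3) = cis (\<theta> + 2 * pi * real i / 3) \<and> cis (\<beta> - 2 * pi / 3) = cis (\<theta> + 2 * pi * real j / 3)
    \<or> cis (\<beta> + 2 * pi / 3) = cis (\<theta> + 2 * pi * real j / 3) \<and> cis (\<beta> - 2 * pi / 3) = cis (\<theta> + 2 * pi * real i / 3)"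
  proof -
    have "k = 0 \<Longrightarrow> cis (\<beta> + 2 * pi / 3) = cis (\<theta> + 2 * pi * real 1 / 3) \<and> cis (\<beta> - 2 * pi / 3) = cis (\<theta> + 2 * pi * real 2 / 3)"
      using per(2)[of "\<theta> + 2 * pi * real 2 / 3"] by (simp add: \<beta>_def algebra_simps)
    moreover have "k = 1 \<Longrightarrow> cis (\<beta> + 2 * pi / 3) = cis (\<theta> + 2 * pi * real 2 / 3) \<and> cis (\<beta> - 2 * pi / 3) = cis (\<theta> + 2 * pi * real 0 / 3)"
      by (simp add: \<beta>_def algebra_simps)
    moreover have "k = 2 \<Longrightarrow> cis (\<beta> + 2 * pi / 3) = cis (\<theta> + 2 * pi * real 0 / 3) \<and> cis (\<beta> - 2 * pi / 3) = cis (\<theta> + 2 * pi * real 1 / 3)"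
      using per(1)[of \<theta>] by (simp add: \<beta>_def algebra_simps)
    ultimately show ?thesis using assms(1) unfolding perm3_def by fastforce
  qed
  note dirs = this
  have sec: "\<exists>r \<phi>. v = complex_of_real r * cis \<phi> \<and> 0 \<le> r \<and> \<beta> - pi / 6 \<le> \<phi> \<and> \<phi> \<le> \<beta> - pi / 6 + pi / 3"
    if "proj3 \<theta> i v \<le> 0" "proj3 \<theta> j v \<le> 0" for v
  proof (rule in_sector)
    show "v \<bullet> cis (\<beta> + 2 * pi / 3) \<le> 0" "v \<bullet> cis (\<beta> - 2 * pi / 3) \<le> 0"
      using dirs that unfolding proj3_def by metis+
  qed
  show ?thesis
    unfolding conjugate_def
  proof (intro exI[of _ "\<beta> - pi / 6"] conjI subsetI)
    fix w assume "w \<in> A"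
    then obtain r \<phi> where "w - z = complex_of_real r * cis \<phi>" "0 \<le> r" "\<beta> - pi / 6 \<le> \<phi>" "\<phi> \<le> \<beta> - pi / 6 + pi / 3"
      using sec A by blast
    then show "w \<in> {z + complex_of_real r * cis \<phi> | r \<phi>. 0 \<le> r \<and> \<beta> - pi / 6 \<le> \<phi> \<and> \<phi> \<le> \<beta> - pi / 6 + pi / 3}"
      by (auto simp: algebra_simps)
  next
    fix w assume "w \<in> B"
    then have "proj3 \<theta> i (- (w - z)) \<le> 0" "proj3 \<theta> j (- (w - z)) \<le> 0"
      using B by (simp_all only: proj3_def inner_minus_left) simp_all
    then obtain r \<phi> where "- (w - z) = complex_of_real r * cis \<phi>" and rp: "0 \<le> r" "\<beta> - pi / 6 \<le> \<phi>" "\<phi> \<le> \<beta> - pi / 6 + pi / 3"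
      using sec by blast
    then have "w = z - complex_of_real r * cis \<phi>" by (simp add: algebra_simps)
    then show "w \<in> {z - complex_of_real r * cis \<phi> | r \<phi>. 0 \<le> r \<and> \<beta> - pi / 6 \<le> \<phi> \<and> \<phi> \<le> \<beta> - pi / 6 + pi / 3}"
      using rp by blast
  qed
qed

section \<open>Three concurrent halving lines\<close>

text \<open>Odd and bounded by 1 like \<open>sgn\<close>. Strict monotonicity makes the zeros of
  \<open>soft\<close> unique, and the simple formula keeps the inequalities elementary.\<close>

definition ssgn :: "real \<Rightarrow> real" where
  "ssgn t = t / (1 + \<bar>t\<bar>)"

lemma ssgn_minus [simp]: "ssgn (- t) = - ssgn t"
  by (simp add: ssgn_def)

lemma abs_ssgn_le: "\<bar>ssgn t\<bar> \<le> 1"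
  by (simp add: ssgn_def abs_divide)

lemma ssgn_nonneg: "0 \<le> t \<Longrightarrow> 0 \<le> ssgn t"
  by (simp add: ssgn_def)

lemma ssgn_less: "s < t \<Longrightarrow> ssgn s < ssgn t"
proof -
  assume st: "s < t"
  have "s * (1 + \<bar>t\<bar>) < t * (1 + \<bar>s\<bar>)"
  proof (cases "0 \<le> s \<or> t \<le> 0")
    case True
    then show ?thesis using st by (auto simp: algebra_simps abs_if)
  next
    case False
    then have "s * (1 + \<bar>t\<bar>) < 0" "0 < t * (1 + \<bar>s\<bar>)"
      by (auto simp: mult_less_0_iff zero_less_mult_iff)
    then show ?thesis by linarith
  qed
  moreover have "0 < 1 + \<bar>s\<bar>" "0 < 1 + \<bar>t\<bar>" by linarith+
  ultimately show ?thesis by (simp only: ssgn_def divide_less_eq pos_less_divide_eq times_divide_eq_left) (simp add: mult.commute)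
qed

lemma ssgn_mono: "s \<le> t \<Longrightarrow> ssgn s \<le> ssgn t"
  using ssgn_less[of s t] by (cases "s = t") auto

lemma continuous_ssgn: "continuous_on UNIV ssgn"
  unfolding ssgn_def by (intro continuous_intros) (auto simp: add_nonneg_eq_0_iff)

lemma tendsto_ssgn: "(f \<longlongrightarrow> l) F \<Longrightarrow> ((\<lambda>x. ssgn (f x)) \<longlongrightarrow> ssgn l) F"
  using continuous_on_tendsto_compose[OF continuous_ssgn] by auto

lemma borel_measurable_ssgn [measurable]: "ssgn \<in> borel_measurable borel"
  using continuous_ssgn by (rule borel_measurable_continuous_onI)

text \<open>
  In the limit of steep slopes this inequality yields the two half-measure bounds of \<open>balanced_point\<close> for
  the alternating triples of sectors; the medians alone do not give them when \<open>z\<close> is an atom.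
\<close>

lemma abs_ssgn_sum3_le:
  assumes "a + b + c = 0"
  shows "\<bar>ssgn a + ssgn b + ssgn c\<bar> \<le> 1"
proof -
  have pos: "\<bar>ssgn x + ssgn y + ssgn (- (x + y))\<bar> \<le> 1" if "0 \<le> x" "0 \<le> y" for x y
    using that ssgn_mono[of x "x + y"] ssgn_mono[of y "x + y"] ssgn_nonneg[of x] ssgn_nonneg[of y]
      abs_ssgn_le[of x] abs_ssgn_le[of "x + y"] by (simp only: ssgn_minus) (simp add: abs_le_iff)
  have neg: "\<bar>ssgn x + ssgn y + ssgn (- (x + y))\<bar> \<le> 1" if "x \<le> 0" "y \<le> 0" for x y
    using pos[of "- x" "- y"] that ssgn_minus[of x] ssgn_minus[of y] ssgn_minus[of "x + y"] by (simp add: add.commute)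
  have both: "\<bar>ssgn x + ssgn y + ssgn z\<bar> \<le> 1" if "0 \<le> x \<and> 0 \<le> y \<or> x \<le> 0 \<and> y \<le> 0" "x + y + z = 0" for x y z
  proof -
    have "z = - (x + y)" using that by simp
    then show ?thesis using pos neg that by blast
  qed
  consider "0 \<le> a \<and> 0 \<le> b \<or> a \<le> 0 \<and> b \<le> 0" | "0 \<le> a \<and> 0 \<le> c \<or> a \<le> 0 \<and> c \<le> 0" | "0 \<le> b \<and> 0 \<le> c \<or> b \<le> 0 \<and> c \<le> 0"
    by linarith
  then show ?thesis
    using both[of a b c] both[of a c b] both[of b c a] assms by cases (simp_all add: ac_simps)
qed

text \<open>For t \<ge> 0 the defect 1 - ssgn t is 1 / (1 + t). The factor \<open>f\<close> varies
  with the index because the lines move while the slope \<open>r\<close> grows.\<close>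

lemma ssgn_tendsto_1:
  fixes f :: "nat \<Rightarrow> real"
  assumes "f \<longlonglongrightarrow> l" "0 < l" "filterlim r at_top sequentially"
  shows "(\<lambda>k. ssgn (r k * f k)) \<longlonglongrightarrow> 1"
proof -
  have F: "filterlim (\<lambda>k. r k * f k) at_top sequentially"
    using filterlim_tendsto_pos_mult_at_top[OF assms] by (simp add: mult.commute)
  have "(\<lambda>k. 1 - inverse (1 + r k * f k)) \<longlonglongrightarrow> 1 - 0"
    by (intro tendsto_diff tendsto_const tendsto_inverse_0_at_top filterlim_tendsto_add_at_top[OF tendsto_const F])
  moreover have "\<forall>\<^sub>F k in sequentially. 1 - inverse (1 + r k * f k) = ssgn (r k * f k)"
  proof -
    have "\<forall>\<^sub>F k in sequentially. 1 \<le> r k * f k" using F by (simp add: filterlim_at_top)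
    then show "\<forall>\<^sub>F k in sequentially. 1 - inverse (1 + r k * f k) = ssgn (r k * f k)"
      by eventually_elim (simp add: ssgn_def divide_simps)
  qed
  ultimately show ?thesis by (simp add: tendsto_cong)
qed

section \<open>Smoothed medians in all directions\<close>

text \<open>A zero in \<open>p\<close> is a smoothed median of the projection of \<open>g\<close> to
  the direction \<open>\<theta>\<close>; for large slope \<open>K\<close> the integrand is close to
  the sign of the distance from the median.\<close>

definition soft :: "'a measure \<Rightarrow> ('a \<Rightarrow> complex) \<Rightarrow> real \<Rightarrow> real \<Rightarrow> real \<Rightarrow> real" where
  "soft M g K \<theta> p = (\<integral>x. ssgn (K * (g x \<bullet> cis \<theta> - p)) \<partial>M)"

context prob_space
begin

lemma integrable_bounded_1:
  fixes f :: "'a \<Rightarrow> real"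
  shows "f \<in> borel_measurable M \<Longrightarrow> (\<And>x. \<bar>f x\<bar> \<le> 1) \<Longrightarrow> integrable M f"
  by (rule integrable_const_bound[where B=1]) auto

context
  fixes g :: "'a \<Rightarrow> complex"
  assumes g [measurable]: "g \<in> borel_measurable M"
begin

lemma integrable_soft: "integrable M (\<lambda>x. ssgn (K * (g x \<bullet> cis \<theta> - p)))"
  by (intro integrable_bounded_1 abs_ssgn_le) measurable

text \<open>Dominated convergence with bound 1. Letting both arguments vary yields continuity in
  \<open>p\<close>, for the intermediate value theorem, and in \<open>\<theta>\<close>, for the
  continuity of the medians.\<close>

lemma soft_tendsto:
  fixes t q :: "nat \<Rightarrow> real"
  assumes "t \<longlonglongrightarrow> \<theta>" "q \<longlonglongrightarrow> p"
  shows "(\<lambda>n. soft M g K (t n) (q n)) \<longlonglongrightarrow> soft M g K \<theta> p"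
  unfolding soft_def
proof (rule integral_dominated_convergence[where w="\<lambda>_. 1"])
  have "(\<lambda>n. cis (t n)) \<longlonglongrightarrow> cis \<theta>"
    using assms(1) by (rule tendsto_cis)
  then show "AE x in M. (\<lambda>n. ssgn (K * (g x \<bullet> cis (t n) - q n))) \<longlonglongrightarrow> ssgn (K * (g x \<bullet> cis \<theta> - p))"
    using assms by (intro AE_I2 tendsto_ssgn tendsto_intros)
qed (auto simp: abs_ssgn_le)

lemma soft_less:
  assumes "0 < K" "p < q"
  shows "soft M g K \<theta> q < soft M g K \<theta> p"
  unfolding soft_def
  by (rule integral_less_AE_space[OF integrable_soft integrable_soft])
    (use assms in \<open>auto intro!: ssgn_less AE_I2 simp: emeasure_space_1\<close>)

lemma soft_minus: "soft M g K (\<theta> + pi) (- p) = - soft M g K \<theta> p"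
proof -
  have "ssgn (K * (g x \<bullet> cis (\<theta> + pi) - - p)) = - ssgn (K * (g x \<bullet> cis \<theta> - p))" for x
  proof -
    have "K * (g x \<bullet> cis (\<theta> + pi) - - p) = - (K * (g x \<bullet> cis \<theta> - p))"
      by (simp add: inner_complex_def algebra_simps)
    then show ?thesis by simp
  qed
  then show ?thesis by (simp add: soft_def)
qed

text \<open>The radius must not depend on slope or direction, since the limit of steep slopes needs
  all centres in one compact set. Where \<open>cmod (g x)\<close> is at most n, the integrand at
  threshold n + 1 is at most ssgn (-1) = -1/2 once \<open>K\<close> is at least 1. If the
  exceptional set has probability P < 1/3, the integral is at most -1/2 + 3/2 P < 0.\<close>

lemma soft_bound:
  obtains R where "0 < R" "\<And>K \<theta>. 1 \<le> K \<Longrightarrow> soft M g K \<theta> R < 0" "\<And>K \<theta>. 1 \<le> K \<Longrightarrow> 0 < soft M g K \<theta> (- R)"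
proof -
  have "(\<lambda>n. prob {x \<in> space M. real n < cmod (g x)}) \<longlonglongrightarrow> prob (\<Inter>n. {x \<in> space M. real n < cmod (g x)})"
    by (intro finite_Lim_measure_decseq) (auto simp: decseq_def)
  moreover have "(\<Inter>n. {x \<in> space M. real n < cmod (g x)}) = {}"
  proof (rule equals0I)
    fix x assume "x \<in> (\<Inter>n. {x \<in> space M. real n < cmod (g x)})"
    then have "real n < cmod (g x)" for n by auto
    then show False using reals_Archimedean2[of "cmod (g x)"] less_asym by blast
  qed
  ultimately have "(\<lambda>n. prob {x \<in> space M. real n < cmod (g x)}) \<longlonglongrightarrow> 0" by simp
  then have "\<forall>\<^sub>F n in sequentially. prob {x \<in> space M. real n < cmod (g x)} < 1 / 3"
    by (rule order_tendstoD) simp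
  then obtain n where n: "prob {x \<in> space M. real n < cmod (g x)} < 1 / 3"
    by (auto simp: eventually_sequentially)
  define E where "E = {x \<in> space M. real n < cmod (g x)}"
  have E [measurable]: "E \<in> sets M" by (simp add: E_def)
  have neg: "soft M g K \<theta> (real n + 1) < 0" if K: "1 \<le> K" for K \<theta>
  proof -
    have "soft M g K \<theta> (real n + 1) \<le> (\<integral>x. - (1 / 2) + 3 / 2 * indicator E x \<partial>M)"
      unfolding soft_def
    proof (rule integral_mono[OF integrable_soft])
      fix x assume x: "x \<in> space M"
      show "ssgn (K * (g x \<bullet> cis \<theta> - (real n + 1))) \<le> - (1 / 2) + 3 / 2 * indicator E x"
      proof (cases "x \<in> E")
        case True
        then show ?thesis using abs_ssgn_le[of "K * (g x \<bullet> cis \<theta> - (real n + 1))"] by simp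
      next
        case False
        have "g x \<bullet> cis \<theta> \<le> cmod (g x) * cmod (cis \<theta>)" by (rule norm_cauchy_schwarz)
        then have "g x \<bullet> cis \<theta> - (real n + 1) \<le> - 1" using False x by (simp add: E_def)
        then have "K * (g x \<bullet> cis \<theta> - (real n + 1)) \<le> K * - 1" using K by (intro mult_left_mono) auto
        then have "ssgn (K * (g x \<bullet> cis \<theta> - (real n + 1))) \<le> ssgn (- 1)" using K by (intro ssgn_mono) simp
        also have "\<dots> = - (1 / 2)" by (simp add: ssgn_def)
        finally show ?thesis using False by simp
      qed
    next
      show "integrable M (\<lambda>x. - (1 / 2) + 3 / 2 * indicator E x :: real)"
        by (intro Bochner_Integration.integrable_add integrable_mult_right integrable_const integrable_bounded_1)
          (auto simp: indicator_def)
    qed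
    also have "\<dots> = - (1 / 2) + 3 / 2 * prob E"
    proof -
      have "integrable M (indicat_real E)" by (intro integrable_bounded_1) (auto simp: indicator_def)
      then show ?thesis
        by (subst Bochner_Integration.integral_add) (simp_all add: prob_space)
    qed
    also have "\<dots> < 0" using n by (simp add: E_def)
    finally show ?thesis .
  qed
  show ?thesis
  proof (rule that[of "real n + 1"])
    fix K \<theta> :: real assume "1 \<le> K"
    have "soft M g K (\<theta> - pi + pi) (- (real n + 1)) = - soft M g K (\<theta> - pi) (real n + 1)"
      by (rule soft_minus)
    then show "0 < soft M g K \<theta> (- (real n + 1))" using neg[OF \<open>1 \<le> K\<close>, of "\<theta> - pi"] by simp
  qed (use neg in auto)
qed


lemma soft_root:
  assumes K: "1 \<le> K" and R: "0 < R" "soft M g K \<theta> R < 0" "0 < soft M g K \<theta> (- R)"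
  shows "\<exists>p. \<bar>p\<bar> \<le> R \<and> soft M g K \<theta> p = 0"
proof -
  have "continuous_on {- R..R} (soft M g K \<theta>)"
    unfolding continuous_on_sequentially comp_def by (auto intro!: soft_tendsto)
  from IVT2'[OF _ _ _ this, of 0] R obtain p where "- R \<le> p" "p \<le> R" "soft M g K \<theta> p = 0"
    by auto
  then show ?thesis by (intro exI[of _ p]) auto
qed

lemma concurrent_soft_medians:
  assumes K: "1 \<le> K" and R: "0 < R" "\<And>\<theta>. soft M g K \<theta> R < 0" "\<And>\<theta>. 0 < soft M g K \<theta> (- R)"
  shows "\<exists>\<theta> z. \<theta> \<in> {0..pi} \<and> cmod z \<le> 3 * R \<and>
    (\<forall>j<3. (\<integral>x. ssgn (K * proj3 \<theta> j (g x - z)) \<partial>M) = 0)"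
proof -
  obtain p where p: "\<And>\<theta>. \<bar>p \<theta>\<bar> \<le> R" "\<And>\<theta>. soft M g K \<theta> (p \<theta>) = 0"
    using soft_root[OF K R] by metis
  have uniq: "q = p \<theta>" if "soft M g K \<theta> q = 0" for q \<theta>
    using soft_less[of K q "p \<theta>" \<theta>] soft_less[of K "p \<theta>" q \<theta>] that p(2)[of \<theta>] K by (cases q "p \<theta>" rule: linorder_cases) auto
  have odd: "p (\<theta> + pi) = - p \<theta>" for \<theta>
    by (rule uniq[symmetric]) (simp only: soft_minus p(2) minus_zero)
  \<comment> \<open>As \<open>soft\<close> strictly decreases in its last argument, q < p \<theta>
    is equivalent to positivity of \<open>soft\<close> at q, and p \<theta> < q to negativity; both
    are open conditions in \<open>\<theta>\<close>.\<close>
  have cont: "continuous_on UNIV p"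
    unfolding continuous_on_sequentially comp_def
  proof (intro ballI allI impI)
    fix \<theta> and t :: "nat \<Rightarrow> real" assume "(\<forall>n. t n \<in> UNIV) \<and> t \<longlonglongrightarrow> \<theta>"
    then have lim: "(\<lambda>n. soft M g K (t n) q) \<longlonglongrightarrow> soft M g K \<theta> q" for q
      by (intro soft_tendsto) auto
    show "(\<lambda>n. p (t n)) \<longlonglongrightarrow> p \<theta>"
    proof (rule order_tendstoI)
      fix q assume "q < p \<theta>"
      then have "0 < soft M g K \<theta> q" using soft_less[of K q "p \<theta>" \<theta>] p(2)[of \<theta>] K by simp
      from order_tendstoD(1)[OF lim this] show "\<forall>\<^sub>F n in sequentially. q < p (t n)"
      proof eventually_elim
        case (elim n)
        then show ?case
          using soft_less[of K "p (t n)" q "t n"] p(2)[of "t n"] K by (cases q "p (t n)" rule: linorder_cases) auto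
      qed
    next
      fix q assume "p \<theta> < q"
      then have "soft M g K \<theta> q < 0" using soft_less[of K "p \<theta>" q \<theta>] p(2)[of \<theta>] K by simp
      from order_tendstoD(2)[OF lim this] show "\<forall>\<^sub>F n in sequentially. p (t n) < q"
      proof eventually_elim
        case (elim n)
        then show ?case
          using soft_less[of K q "p (t n)" "t n"] p(2)[of "t n"] K by (cases q "p (t n)" rule: linorder_cases) auto
      qed
    qed
  qed
  define d where "d \<theta> j = \<theta> + 2 * pi * real j / 3" for \<theta> j
  define h where "h \<theta> = p (d \<theta> 0) + p (d \<theta> 1) + p (d \<theta> 2)" for \<theta>
  have "continuous_on {0..pi} h"
    unfolding h_def d_def
    by (intro continuous_intros continuous_on_compose2[OF cont]) auto
  moreover have "h pi = - h 0"
    using odd[of "d 0 0"] odd[of "d 0 1"] odd[of "d 0 2"] by (simp add: h_def d_def add.commute)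
  ultimately obtain \<theta> where \<theta>: "\<theta> \<in> {0..pi}" "h \<theta> = 0"
    using IVT'[of h 0 0 pi] IVT2'[of h pi 0 0] by (cases "h 0 \<le> 0") auto
  \<comment> \<open>The two coordinates of \<open>z\<close> in the frame
    \<open>cis \<theta>\<close>, \<open>\<i> * cis \<theta>\<close> are chosen to give the right
    projection 0 and the right difference of projections 1 and 2; the sum of these two is then right
    because \<open>h \<theta> = 0\<close>.\<close>
  define z where "z = complex_of_real (p (d \<theta> 0)) * cis \<theta> + complex_of_real ((p (d \<theta> 1) - p (d \<theta> 2)) / sqrt 3) * (\<i> * cis \<theta>)"
  have z1: "z \<bullet> cis \<theta> = p (d \<theta> 0)" and z2: "z \<bullet> (\<i> * cis \<theta>) = (p (d \<theta> 1) - p (d \<theta> 2)) / sqrt 3"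
  proof -
    have gen: "(complex_of_real u * cis \<theta> + complex_of_real v * (\<i> * cis \<theta>)) \<bullet> cis \<theta> = u * ((cos \<theta>)\<^sup>2 + (sin \<theta>)\<^sup>2)"
      "(complex_of_real u * cis \<theta> + complex_of_real v * (\<i> * cis \<theta>)) \<bullet> (\<i> * cis \<theta>) = v * ((cos \<theta>)\<^sup>2 + (sin \<theta>)\<^sup>2)" for u v
      by (simp_all add: inner_complex_def power2_eq_square algebra_simps del: sin_cos_squared_add sin_cos_squared_add2 sin_cos_squared_add3)
    show "z \<bullet> cis \<theta> = p (d \<theta> 0)" "z \<bullet> (\<i> * cis \<theta>) = (p (d \<theta> 1) - p (d \<theta> 2)) / sqrt 3"
      unfolding z_def gen by simp_all
  qed
  have "proj3 \<theta> 0 z = p (d \<theta> 0)" "proj3 \<theta> 1 z = p (d \<theta> 1)" "proj3 \<theta> 2 z = p (d \<theta> 2)"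
  proof -
    have eq: "sqrt 3 / 2 * ((p (d \<theta> 1) - p (d \<theta> 2)) / sqrt 3) = (p (d \<theta> 1) - p (d \<theta> 2)) / 2" by simp
    show "proj3 \<theta> 0 z = p (d \<theta> 0)" "proj3 \<theta> 1 z = p (d \<theta> 1)" "proj3 \<theta> 2 z = p (d \<theta> 2)"
      using \<theta>(2) unfolding proj3_expand z1 z2 h_def eq by argo+
  qed
  then have zj: "proj3 \<theta> j z = p (d \<theta> j)" if "j < 3" for j
    using that by (auto simp: less_Suc_eq numeral_3_eq_3 numeral_2_eq_2)
  have "cmod z \<le> \<bar>p (d \<theta> 0)\<bar> + \<bar>p (d \<theta> 1) - p (d \<theta> 2)\<bar> / sqrt 3"
    unfolding z_def by (rule order_trans[OF norm_triangle_ineq]) (simp only: norm_mult norm_of_real norm_cis norm_ii, simp add: abs_divide)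
  moreover have "\<bar>p (d \<theta> 1) - p (d \<theta> 2)\<bar> / sqrt 3 \<le> \<bar>p (d \<theta> 1) - p (d \<theta> 2)\<bar>"
    using divide_left_mono[of 1 "sqrt 3" "\<bar>p (d \<theta> 1) - p (d \<theta> 2)\<bar>"] by simp
  \<comment> \<open>At most R comes from the first coordinate and 2R from the second; the bound does
    not involve the slope.\<close>
  ultimately have bz: "cmod z \<le> 3 * R"
    using p(1)[of "d \<theta> 0"] p(1)[of "d \<theta> 1"] p(1)[of "d \<theta> 2"]
      abs_triangle_ineq4[of "p (d \<theta> 1)" "p (d \<theta> 2)"] by linarith
  have "(\<integral>x. ssgn (K * proj3 \<theta> j (g x - z)) \<partial>M) = 0" if "j < 3" for j
  proof -
    have "proj3 \<theta> j (g x - z) = g x \<bullet> cis (d \<theta> j) - p (d \<theta> j)" for x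
      unfolding zj[OF that, symmetric] by (simp add: proj3_def d_def inner_diff_left)
    then show ?thesis using p(2)[of "d \<theta> j"] by (simp add: soft_def)
  qed
  then show ?thesis using \<theta> bz by blast
qed

section \<open>The limit of steep slopes\<close>

text \<open>In the limit \<open>A\<close> contributes \<open>prob A\<close> to the mean, while its
  complement contributes at least -(1 - prob A). Since the mean is 0, prob A \<le> 1 - prob
  A.\<close>

lemma prob_le_half_limit:
  fixes F :: "nat \<Rightarrow> 'a \<Rightarrow> real"
  assumes [measurable]: "\<And>k. F k \<in> borel_measurable M" "A \<in> sets M"
    and F: "\<And>k x. \<bar>F k x\<bar> \<le> 1" "\<And>k. (\<integral>x. F k x \<partial>M) = 0"
    and lim: "\<And>x. x \<in> A \<Longrightarrow> (\<lambda>k. F k x) \<longlonglongrightarrow> 1"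
  shows "prob A \<le> 1 / 2"
proof -
  have "(\<lambda>k. \<integral>x. indicator A x * F k x \<partial>M) \<longlonglongrightarrow> (\<integral>x. indicator A x * 1 \<partial>M)"
  proof (rule integral_dominated_convergence[where w="\<lambda>_. 1"])
    show "AE x in M. (\<lambda>k. indicator A x * F k x) \<longlonglongrightarrow> indicator A x * 1"
      using lim by (auto simp: indicator_def)
    show "AE x in M. norm (indicator A x * F k x) \<le> 1" for k
      using F by (auto simp: indicator_def)
  qed auto
  then have "(\<lambda>k. \<integral>x. indicator A x * F k x \<partial>M) \<longlonglongrightarrow> prob A" by simp
  moreover have "(\<integral>x. indicator A x * F k x \<partial>M) \<le> 1 - prob A" for k
  proof -
    have "(\<integral>x. indicator A x * F k x \<partial>M) \<le> (\<integral>x. F k x + indicator (space M - A) x \<partial>M)"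
    proof (rule integral_mono)
      show "integrable M (\<lambda>x. indicator A x * F k x)"
        using F by (intro integrable_bounded_1) (auto simp: indicator_def)
      show "integrable M (\<lambda>x. F k x + indicator (space M - A) x)"
        using F by (intro Bochner_Integration.integrable_add integrable_bounded_1) (auto simp: indicator_def)
      fix x assume "x \<in> space M"
      then show "indicator A x * F k x \<le> F k x + indicator (space M - A) x"
        using F(1)[of k x] by (auto simp: indicator_def)
    qed
    also have "\<dots> = (\<integral>x. F k x \<partial>M) + (\<integral>x. indicator (space M - A) x \<partial>M)"
      using F by (intro Bochner_Integration.integral_add integrable_bounded_1) (auto simp: indicator_def)
    also have "\<dots> = 1 - prob A"
      using F(2) by (simp add: prob_compl)
    finally show ?thesis .
  qed
  ultimately have "prob A \<le> 1 - prob A"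
    by (intro LIMSEQ_le_const2) auto
  then show ?thesis by simp
qed

text \<open>Centres and angles for the slopes \<open>Suc k\<close> stay in a compact set, so a
  subsequence converges. The last two sets are the alternating triples of open sectors; for them
  \<open>prob_le_half_limit\<close> is applied to the sum of the three soft signs and its negative,
  bounded by 1 through \<open>abs_ssgn_sum3_le\<close>.\<close>

lemma balanced_point:
  "\<exists>z \<theta>. (\<forall>j<3. prob {x \<in> space M. 0 < proj3 \<theta> j (g x - z)} \<le> 1 / 2) \<and>
    (\<forall>j<3. prob {x \<in> space M. proj3 \<theta> j (g x - z) < 0} \<le> 1 / 2) \<and>
    prob {x \<in> space M. proj3 \<theta> 0 (g x - z) * proj3 \<theta> 1 (g x - z) * proj3 \<theta> 2 (g x - z) < 0} \<le> 1 / 2 \<and>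
    prob {x \<in> space M. 0 < proj3 \<theta> 0 (g x - z) * proj3 \<theta> 1 (g x - z) * proj3 \<theta> 2 (g x - z)} \<le> 1 / 2"
proof -
  obtain R where R: "0 < R" "\<And>K \<theta>. 1 \<le> K \<Longrightarrow> soft M g K \<theta> R < 0" "\<And>K \<theta>. 1 \<le> K \<Longrightarrow> 0 < soft M g K \<theta> (- R)"
    using soft_bound by blast
  have "\<exists>\<theta> z. \<theta> \<in> {0..pi} \<and> cmod z \<le> 3 * R \<and>
    (\<forall>j<3. (\<integral>x. ssgn (real (Suc k) * proj3 \<theta> j (g x - z)) \<partial>M) = 0)" for k
    using concurrent_soft_medians[of "real (Suc k)" R] R by simp
  then obtain t w where tw: "\<And>k. t k \<in> {0..pi}" "\<And>k. cmod (w k) \<le> 3 * R"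
    "\<And>k j. j < 3 \<Longrightarrow> (\<integral>x. ssgn (real (Suc k) * proj3 (t k) j (g x - w k)) \<partial>M) = 0"
    by metis
  have "compact (cball (0::complex) (3 * R) \<times> {0..pi})"
    by (intro compact_Times) auto
  then obtain l r where "l \<in> cball (0::complex) (3 * R) \<times> {0..pi}" and r: "strict_mono r"
    and "((\<lambda>k. (w k, t k)) \<circ> r) \<longlonglongrightarrow> l"
    unfolding compact_def using tw(1,2) by (metis (no_types, lifting) SigmaI mem_cball_0)
  then obtain z \<theta> where lim: "(\<lambda>k. w (r k)) \<longlonglongrightarrow> z" "(\<lambda>k. t (r k)) \<longlonglongrightarrow> \<theta>"
    using tendsto_fst[of "(\<lambda>k. (w k, t k)) \<circ> r" l] tendsto_snd[of "(\<lambda>k. (w k, t k)) \<circ> r" l]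
    by (auto simp: comp_def)
  define f where "f j k x = ssgn (real (Suc (r k)) * proj3 (t (r k)) j (g x - w (r k)))" for j k x
  have f_meas [measurable]: "f j k \<in> borel_measurable M" for j k
    unfolding f_def proj3_def by measurable
  have proj_meas [measurable]: "(\<lambda>x. proj3 \<theta> j (g x - z)) \<in> borel_measurable M" for j
    unfolding proj3_def by measurable
  have f_bd: "\<bar>f j k x\<bar> \<le> 1" for j k x by (simp add: f_def abs_ssgn_le)
  have f_sum: "\<bar>f 0 k x + f 1 k x + f 2 k x\<bar> \<le> 1" for k x
    unfolding f_def by (rule abs_ssgn_sum3_le) (simp only: proj3_sum mult_zero_right flip: distrib_left)
  have f_int: "(\<integral>x. f j k x \<partial>M) = 0" if "j < 3" for j k
    unfolding f_def by (rule tw(3)[OF that])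
  have f_integrable: "integrable M (f j k)" for j k
    by (intro integrable_bounded_1) (auto simp: f_bd)
  have f_int_sum: "(\<integral>x. f 0 k x + f 1 k x + f 2 k x \<partial>M) = 0" for k
    using f_int[of 0 k] f_int[of 1 k] f_int[of 2 k]
    by (simp add: Bochner_Integration.integral_add f_integrable)
  have rlim: "filterlim (\<lambda>k. real (Suc (r k))) at_top sequentially"
    by (intro filterlim_compose[OF filterlim_real_sequentially] filterlim_compose[OF filterlim_Suc]
        filterlim_subseq r)
  have plim: "(\<lambda>k. proj3 (t (r k)) j (g x - w (r k))) \<longlonglongrightarrow> proj3 \<theta> j (g x - z)" for j x
    unfolding proj3_def by (intro tendsto_intros tendsto_cis lim)
  have pos: "(\<lambda>k. f j k x) \<longlonglongrightarrow> 1" if "0 < proj3 \<theta> j (g x - z)" for j x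
    unfolding f_def by (rule ssgn_tendsto_1[OF plim that rlim])
  have neg: "(\<lambda>k. - f j k x) \<longlonglongrightarrow> 1" if "proj3 \<theta> j (g x - z) < 0" for j x
    using ssgn_tendsto_1[OF tendsto_minus[OF plim, of j x] _ rlim] that by (simp add: f_def)
  have neg': "(\<lambda>k. f j k x) \<longlonglongrightarrow> - 1" if "proj3 \<theta> j (g x - z) < 0" for j x
    using tendsto_minus[OF neg[OF that]] by simp
  let ?\<pi> = "\<lambda>x. proj3 \<theta> 0 (g x - z) * proj3 \<theta> 1 (g x - z) * proj3 \<theta> 2 (g x - z)"
  have signs: "\<exists>a b c. (\<lambda>k. f 0 k x) \<longlonglongrightarrow> a \<and> (\<lambda>k. f 1 k x) \<longlonglongrightarrow> b \<and> (\<lambda>k. f 2 k x) \<longlonglongrightarrow> c \<and>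
      a + b + c = - sgn (?\<pi> x)"
    if nz: "?\<pi> x \<noteq> 0" for x
  proof -
    have lims: "(\<lambda>k. f j k x) \<longlonglongrightarrow> sgn (proj3 \<theta> j (g x - z))" if "proj3 \<theta> j (g x - z) \<noteq> 0" for j
      using pos[of j x] neg'[of j x] that by (cases "0 < proj3 \<theta> j (g x - z)") auto
    \<comment> \<open>Nonzero numbers with sum 0 do not all have the same sign, so the signs add up
      to 1 or -1, and the product has the opposite sign.\<close>
    have "sgn a + sgn b + sgn c = - sgn (a * b * c)" if "a + b + c = 0" "a * b * c \<noteq> 0" for a b c :: real
      using that by (auto simp: sgn_if mult_less_0_iff zero_less_mult_iff)
    from this[OF proj3_sum nz] lims nz show ?thesis by fastforce
  qed
  have sum1: "(\<lambda>k. f 0 k x + f 1 k x + f 2 k x) \<longlonglongrightarrow> 1"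
    if lt: "?\<pi> x < 0" for x
  proof -
    obtain a b c where abc: "(\<lambda>k. f 0 k x) \<longlonglongrightarrow> a" "(\<lambda>k. f 1 k x) \<longlonglongrightarrow> b" "(\<lambda>k. f 2 k x) \<longlonglongrightarrow> c" "a + b + c = 1"
      using signs[OF less_imp_neq[OF lt]] sgn_neg[OF lt] by auto
    show ?thesis using tendsto_add[OF tendsto_add[OF abc(1,2)] abc(3)] abc(4) by simp
  qed
  have sum2: "(\<lambda>k. - (f 0 k x + f 1 k x + f 2 k x)) \<longlonglongrightarrow> 1"
    if lt: "0 < ?\<pi> x" for x
  proof -
    obtain a b c where abc: "(\<lambda>k. f 0 k x) \<longlonglongrightarrow> a" "(\<lambda>k. f 1 k x) \<longlonglongrightarrow> b" "(\<lambda>k. f 2 k x) \<longlonglongrightarrow> c" "a + b + c = - 1"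
      using signs[OF less_imp_neq[OF lt, symmetric]] sgn_pos[OF lt] by auto
    have "- (a + b + c) = 1" using abc(4) by simp
    then show ?thesis using tendsto_minus[OF tendsto_add[OF tendsto_add[OF abc(1,2)] abc(3)]] by metis
  qed
  show ?thesis
  proof (intro exI[of _ z] exI[of _ \<theta>] conjI allI impI)
    fix j :: nat assume j: "j < 3"
    show "prob {x \<in> space M. 0 < proj3 \<theta> j (g x - z)} \<le> 1 / 2"
      by (rule prob_le_half_limit[of "f j"]) (auto simp: f_bd f_int[OF j] pos)
    show "prob {x \<in> space M. proj3 \<theta> j (g x - z) < 0} \<le> 1 / 2"
      by (rule prob_le_half_limit[of "\<lambda>k x. - f j k x"]) (auto simp: f_bd f_int[OF j] neg)
  next
    show "prob {x \<in> space M. proj3 \<theta> 0 (g x - z) * proj3 \<theta> 1 (g x - z) * proj3 \<theta> 2 (g x - z) < 0} \<le> 1 / 2"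
      by (rule prob_le_half_limit[of "\<lambda>k x. f 0 k x + f 1 k x + f 2 k x"]) (use f_sum f_int_sum sum1 in auto)
    show "prob {x \<in> space M. 0 < proj3 \<theta> 0 (g x - z) * proj3 \<theta> 1 (g x - z) * proj3 \<theta> 2 (g x - z)} \<le> 1 / 2"
      by (rule prob_le_half_limit[of "\<lambda>k x. - (f 0 k x + f 1 k x + f 2 k x)"])
        (use f_sum f_int_sum sum2 in \<open>auto simp del: minus_add_distrib simp: abs_minus_cancel\<close>)
  qed
qed

end
end

section \<open>Balancing opposite sectors\<close>

text \<open>
  The set \<open>L\<close> is everything for Lebesgue measure and a parity class of integers for counting measure.
\<close>

lemma choose_balanced_triple:
  fixes L :: "real set" and D l :: "nat \<Rightarrow> real" and c :: real
  assumes L: "c \<in> L" "\<And>x. x \<in> L \<Longrightarrow> - x \<in> L" "\<And>x y z. x \<in> L \<Longrightarrow> y \<in> L \<Longrightarrow> z \<in> L \<Longrightarrow> x + y + z \<in> L"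
    and DL: "\<And>j. j < 3 \<Longrightarrow> D j + l j \<in> L" "\<And>j. j < 3 \<Longrightarrow> D j - l j \<in> L"
    and l: "\<And>j. j < 3 \<Longrightarrow> 0 \<le> l j" and c: "0 \<le> c"
    and D: "\<And>j. j < 3 \<Longrightarrow> \<bar>D j\<bar> \<le> l j + c"
    and S: "\<bar>D 0 + D 1 + D 2\<bar> \<le> l 0 + l 1 + l 2 + c"
  shows "\<exists>x. (\<forall>j<3. x j \<in> L \<and> \<bar>x j - D j\<bar> \<le> l j \<and> \<bar>x j\<bar> \<le> c) \<and> \<bar>x 0 + x 1 + x (2::nat)\<bar> \<le> c"
proof -
  define lo where "lo j = max (- c) (D j - l j)" for j
  define hi where "hi j = min c (D j + l j)" for j
  have L3: "lo j \<in> L" "hi j \<in> L" if "j < 3" for j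
    using that L DL by (auto simp: lo_def hi_def max_def min_def)
  have le: "lo j \<le> hi j" if "j < 3" for j
    using D[OF that] l[OF that] c by (auto simp: lo_def hi_def)
  \<comment> \<open>If all three lower ends are \<open>D j - l j\<close>, this is \<open>S\<close>.
    Otherwise one of them is \<open>- c\<close>, and the other two are at most \<open>c\<close> by
    \<open>D\<close>.\<close>
  have slo: "lo 0 + lo 1 + lo 2 \<le> c"
    using D[of 0] D[of 1] D[of 2] S c l[of 0] l[of 1] l[of 2] by (auto simp: lo_def max_def)
  have shi: "- c \<le> hi 0 + hi 1 + hi 2"
    using D[of 0] D[of 1] D[of 2] S c l[of 0] l[of 1] l[of 2] by (auto simp: hi_def min_def)
  have "\<exists>x. (\<forall>j<3. x j \<in> L \<and> lo j \<le> x j \<and> x j \<le> hi j) \<and> \<bar>x 0 + x 1 + x (2::nat)\<bar> \<le> c"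
  proof -
    have ex: "\<exists>x. (\<forall>j<3. x j \<in> L \<and> lo j \<le> x j \<and> x j \<le> hi j) \<and> \<bar>x 0 + x 1 + x (2::nat)\<bar> \<le> c"
      if "p \<in> L" "q \<in> L" "r \<in> L" "lo 0 \<le> p" "p \<le> hi 0" "lo 1 \<le> q" "q \<le> hi 1" "lo 2 \<le> r" "r \<le> hi 2" "\<bar>p + q + r\<bar> \<le> c" for p q r
    proof (intro exI[of _ "\<lambda>j. if j = 0 then p else if j = 1 then q else r"] conjI allI impI)
      fix j :: nat assume "j < 3"
      then have "j = 0 \<or> j = 1 \<or> j = 2" by linarith
      with that show "(if j = 0 then p else if j = 1 then q else r) \<in> L"
        "lo j \<le> (if j = 0 then p else if j = 1 then q else r)"
        "(if j = 0 then p else if j = 1 then q else r) \<le> hi j" by auto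
    qed (use that in simp)
    note m = L3[of 0] L3[of 1] L3[of 2] le[of 0] le[of 1] le[of 2]
    \<comment> \<open>Start at the lower ends and raise one coordinate after another to its upper
      end until the sum reaches -c. The coordinate at which this happens becomes -c minus the other
      two, so it stays in \<open>L\<close>.\<close>
    consider "- c \<le> lo 0 + lo 1 + lo 2" | "lo 0 + lo 1 + lo 2 < - c" "- c \<le> hi 0 + lo 1 + lo 2"
      | "hi 0 + lo 1 + lo 2 < - c" "- c \<le> hi 0 + hi 1 + lo 2" | "hi 0 + hi 1 + lo 2 < - c" by linarith
    then show ?thesis
    proof cases
      case 1
      show ?thesis by (rule ex[of "lo 0" "lo 1" "lo 2"]) (use 1 m slo in auto)
    next
      case 2
      have "- c + - lo 1 + - lo 2 \<in> L" using m L by (intro L(3)) auto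
      with 2 m c show ?thesis by (intro ex[of "- c + - lo 1 + - lo 2" "lo 1" "lo 2"]) auto
    next
      case 3
      have "- c + - hi 0 + - lo 2 \<in> L" using m L by (intro L(3)) auto
      with 3 m c show ?thesis by (intro ex[of "hi 0" "- c + - hi 0 + - lo 2" "lo 2"]) auto
    next
      case 4
      have "- c + - hi 0 + - hi 1 \<in> L" using m L by (intro L(3)) auto
      with 4 m c shi show ?thesis by (intro ex[of "hi 0" "hi 1" "- c + - hi 0 + - hi 1"]) auto
    qed
  qed
  then obtain x where x: "\<And>j. j < 3 \<Longrightarrow> x j \<in> L \<and> lo j \<le> x j \<and> x j \<le> hi j" and "\<bar>x 0 + x 1 + x (2::nat)\<bar> \<le> c"
    by blast
  moreover have "\<bar>x j - D j\<bar> \<le> l j \<and> \<bar>x j\<bar> \<le> c" if "j < 3" for j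
    using x[OF that] by (auto simp: lo_def hi_def abs_le_iff)
  ultimately show ?thesis by blast
qed

text \<open>When the \<open>a j\<close> sum to 0, \<open>Yp k\<close> lies in the closed sector
  where \<open>a k\<close> is nonnegative, and \<open>Ym k\<close> in the opposite one. The sign
  conditions are weak on purpose: points of a line may join either adjacent sector and central
  points any sector, and this freedom is used to equalise the measures. Not every central point has
  to be in \<open>X\<close>.\<close>

definition sector_partition :: "'a measure \<Rightarrow> (nat \<Rightarrow> 'a \<Rightarrow> real) \<Rightarrow> 'a set \<Rightarrow> (nat \<Rightarrow> 'a set) \<Rightarrow> (nat \<Rightarrow> 'a set) \<Rightarrow> bool" where
  "sector_partition M a X Yp Ym \<longleftrightarrow>
     X \<in> sets M \<and> (\<forall>k<3. Yp k \<in> sets M \<and> Ym k \<in> sets M) \<and>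
     X \<union> (\<Union>k<3. Yp k \<union> Ym k) = space M \<and>
     (\<forall>k<3. X \<inter> (Yp k \<union> Ym k) = {} \<and> Yp k \<inter> Ym k = {}) \<and>
     (\<forall>k<3. \<forall>k'<3. k \<noteq> k' \<longrightarrow> (Yp k \<union> Ym k) \<inter> (Yp k' \<union> Ym k') = {}) \<and>
     (\<forall>k<3. measure M (Yp k) = measure M (Ym k)) \<and>
     (\<forall>j<3. \<forall>x\<in>X. a j x = 0) \<and>
     (\<forall>k<3. \<forall>j<3. j \<noteq> k \<longrightarrow> (\<forall>x\<in>Yp k. a j x \<le> 0) \<and> (\<forall>x\<in>Ym k. 0 \<le> a j x))"

lemma all_less_3: "(\<forall>k<3. P k) \<longleftrightarrow> P 0 \<and> P 1 \<and> P (2::nat)"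
  by (auto simp: less_Suc_eq numeral_3_eq_3 numeral_2_eq_2)

lemma less_3_cases: "k < 3 \<Longrightarrow> k = 0 \<or> k = 1 \<or> k = (2::nat)"
  by linarith

text \<open>
  The points on the three lines are distributed over the adjacent sectors so that the surpluses of the
  three pairs of opposite sectors add up to at most the mass at the centre, which then fills the deficits.
  The group \<open>Q\<close> of admissible measures is \<open>UNIV\<close> for Lebesgue measure and \<open>\<int>\<close> for counting measure.
\<close>

lemma (in finite_measure) sector_partition_exists:
  fixes a :: "nat \<Rightarrow> 'a \<Rightarrow> real" and Q :: "real set"
  assumes a_meas [measurable]: "\<And>j. a j \<in> borel_measurable M"
    and a_sum: "\<And>x. a 0 x + a 1 x + a 2 x = 0"
    and Q0: "0 \<in> Q" and Qd: "\<And>x y. x \<in> Q \<Longrightarrow> y \<in> Q \<Longrightarrow> x - y \<in> Q"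
    and Qm: "\<And>A. A \<in> sets M \<Longrightarrow> measure M A \<in> Q"
    and half: "measure M (space M) / 2 \<in> Q"
    and split: "\<And>A x. A \<in> sets M \<Longrightarrow> x \<in> Q \<Longrightarrow> 0 \<le> x \<Longrightarrow> x \<le> measure M A \<Longrightarrow>
                  \<exists>B\<in>sets M. B \<subseteq> A \<and> measure M B = x"
    and line: "\<And>j. j < 3 \<Longrightarrow> \<bar>measure M {x \<in> space M. 0 < a j x} - measure M {x \<in> space M. a j x < 0}\<bar>
                  \<le> measure M {x \<in> space M. a j x = 0}"
    and alt: "\<bar>(\<Sum>j<3. measure M {x \<in> space M. 0 < a j x} - measure M {x \<in> space M. a j x < 0})\<bar>
                  \<le> (\<Sum>j<3. measure M {x \<in> space M. a j x = 0}) - 2 * measure M {x \<in> space M. \<forall>j<3. a j x = 0}"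
  shows "\<exists>X Yp Ym. sector_partition M a X Yp Ym"
proof -
  let ?m = "measure M"
  have Qa: "x + y \<in> Q" if "x \<in> Q" "y \<in> Q" for x y
    using Qd[OF that(1) Qd[OF Q0 that(2)]] by simp
  have Qabs: "\<bar>x\<bar> \<in> Q" if "x \<in> Q" for x
    using that Qd[OF Q0 that] by (auto simp: abs_if)
  define C where "C = {x \<in> space M. \<forall>j<3. a j x = 0}"
  define P where "P j = {x \<in> space M. 0 < a j x}" for j
  define N where "N j = {x \<in> space M. a j x < 0}" for j
  define Z where "Z j = {x \<in> space M. a j x = 0} - C" for j
  have [measurable]: "C \<in> sets M" "P j \<in> sets M" "N j \<in> sets M" "Z j \<in> sets M" for j
    by (simp_all add: C_def P_def N_def Z_def)
  define D where "D j = ?m (P j) - ?m (N j)" for j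
  define l where "l j = ?m (Z j)" for j
  define c where "c = ?m C"
  have lz: "?m {x \<in> space M. a j x = 0} = l j + c" if "j < 3" for j
  proof -
    have "{x \<in> space M. a j x = 0} = Z j \<union> C" using that by (auto simp: Z_def C_def)
    then show ?thesis by (simp add: l_def c_def) (subst finite_measure_Union, auto simp: Z_def)
  qed
  have sp: "?m (space M) = ?m (P j) + ?m (N j) + l j + c" if "j < 3" for j
  proof -
    have "space M = P j \<union> (N j \<union> {x \<in> space M. a j x = 0})" by (auto simp: P_def N_def)
    then have "?m (space M) = ?m (P j \<union> (N j \<union> {x \<in> space M. a j x = 0}))" by simp
    also have "\<dots> = ?m (P j) + (?m (N j) + (l j + c))"
      unfolding lz[OF that, symmetric]
      by (subst finite_measure_Union; (subst finite_measure_Union)?) (auto simp: P_def N_def)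
    finally show ?thesis by simp
  qed
  \<comment> \<open>If x is the mass on the positive side minus the mass on the negative side, and
    both sides together have the total mass minus \<open>c\<close>, then (x + c) / 2 is half of the
    total minus the negative side. For \<open>Q = \<int>\<close> membership means that x has the
    parity of \<open>c\<close>.\<close>
  define L where "L = {x. (x + c) / 2 \<in> Q}"
  have cQ: "c \<in> Q" "?m A \<in> Q" if "A \<in> sets M" for A
    by (auto simp: c_def intro!: Qm that)
  have dl: "D j + l j \<in> L" "D j - l j \<in> L" if "j < 3" for j
  proof -
    have "(D j + l j + c) / 2 = ?m (space M) / 2 - ?m (N j)"
      unfolding sp[OF that] D_def by (simp add: field_simps)
    moreover have "(D j - l j + c) / 2 = ?m (space M) / 2 - ?m (N j) - ?m (Z j)"
      unfolding sp[OF that] D_def l_def by (simp add: field_simps)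
    ultimately show "D j + l j \<in> L" "D j - l j \<in> L"
      unfolding L_def mem_Collect_eq using half by (simp_all only:) (auto intro!: Qd Qm)
  qed
  have "\<exists>x. (\<forall>j<3. x j \<in> L \<and> \<bar>x j - D j\<bar> \<le> l j \<and> \<bar>x j\<bar> \<le> c) \<and> \<bar>x 0 + x 1 + x (2::nat)\<bar> \<le> c"
  proof (rule choose_balanced_triple)
    show "c \<in> L" using cQ(1)[of "{}"] by (simp add: L_def)
    show "- x \<in> L" if "x \<in> L" for x
    proof -
      have "(- x + c) / 2 = c - (x + c) / 2" by (simp add: field_simps)
      then show ?thesis using that cQ(1)[of "{}"] Qd unfolding L_def mem_Collect_eq by (metis sets.empty_sets)
    qed
    show "x + y + z \<in> L" if "x \<in> L" "y \<in> L" "z \<in> L" for x y z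
    proof -
      have "(x + y + z + c) / 2 = (x + c) / 2 + (y + c) / 2 + (z + c) / 2 - c" by (simp add: field_simps)
      then show ?thesis using that cQ(1)[of "{}"] Qd Qa unfolding L_def mem_Collect_eq by (metis sets.empty_sets)
    qed
    show "\<bar>D j\<bar> \<le> l j + c" if "j < 3" for j
      using line[OF that] unfolding lz[OF that] by (simp add: D_def P_def N_def)
    show "\<bar>D 0 + D 1 + D 2\<bar> \<le> l 0 + l 1 + l 2 + c"
    proof -
      have "(\<Sum>j<3. f j) = f 0 + f 1 + f (2::nat)" for f :: "nat \<Rightarrow> real"
        by (simp add: numeral_3_eq_3 numeral_2_eq_2)
      then show ?thesis
        using alt lz[of 0] lz[of 1] lz[of 2] by (simp add: D_def P_def N_def c_def C_def)
    qed
  qed (use dl in \<open>auto simp: l_def c_def\<close>)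
  then obtain x where x: "\<And>j. j < 3 \<Longrightarrow> x j \<in> L \<and> \<bar>x j - D j\<bar> \<le> l j \<and> \<bar>x j\<bar> \<le> c"
    and xs: "\<bar>x 0 + x 1 + x (2::nat)\<bar> \<le> c" by blast
  \<comment> \<open>The part \<open>B\<close> of the line joins the positive side and the rest the
    negative side. The surplus then becomes D j + measure M B - (l j - measure M B), and equating
    this with \<open>x j\<close> gives the required measure.\<close>
  have "\<exists>B\<in>sets M. B \<subseteq> Z j \<and> ?m B = (l j + x j - D j) / 2" if j: "j < 3" for j
  proof (rule split)
    have "(l j + x j - D j) / 2 = (x j + c) / 2 - (D j - l j + c) / 2" by (simp add: field_simps)
    then show "(l j + x j - D j) / 2 \<in> Q" using x[OF j] dl[OF j] Qd unfolding L_def mem_Collect_eq by metis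
    show "0 \<le> (l j + x j - D j) / 2" "(l j + x j - D j) / 2 \<le> ?m (Z j)"
      using x[OF j] by (auto simp: l_def abs_le_iff)
  qed simp
  then obtain B where B: "\<And>j. j < 3 \<Longrightarrow> B j \<in> sets M \<and> B j \<subseteq> Z j \<and> ?m (B j) = (l j + x j - D j) / 2"
    by metis
  define U where "U j = P j \<union> B j" for j
  define V where "V j = N j \<union> (Z j - B j)" for j
  have UVm: "U j \<in> sets M" "V j \<in> sets M" if "j < 3" for j
    using B[OF that] by (auto simp: U_def V_def)
  have UV: "?m (U j) - ?m (V j) = x j" if "j < 3" for j
  proof -
    have "?m (U j) = ?m (P j) + ?m (B j)"
      unfolding U_def using B[OF that] by (intro finite_measure_Union) (auto simp: Z_def P_def)
    moreover have "?m (V j) = ?m (N j) + (l j - ?m (B j))"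
      unfolding V_def l_def using B[OF that]
      by (subst finite_measure_Union) (auto simp: Z_def N_def finite_measure_Diff)
    ultimately show ?thesis using B[OF that] by (simp add: D_def field_simps)
  qed
  have signs: "(y \<in> U j \<longrightarrow> 0 \<le> a j y) \<and> (y \<in> V j \<longrightarrow> a j y \<le> 0) \<and> \<not> (y \<in> U j \<and> y \<in> V j) \<and>
      (y \<in> U j \<or> y \<in> V j \<longleftrightarrow> y \<in> space M - C)" if "j < 3" for j y
    using B[OF that] that by (force simp: U_def V_def P_def N_def Z_def C_def)
  have Cspace: "C \<subseteq> space M" by (auto simp: C_def)
  \<comment> \<open>Three numbers of one weak sign with sum 0 vanish, and central points lie in no
    \<open>U j\<close> or \<open>V j\<close>. So six of the eight patterns of sides remain, namely
    the sectors.\<close>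
  have not_all: "\<not> (y \<in> U 0 \<and> y \<in> U 1 \<and> y \<in> U 2)" "\<not> (y \<in> V 0 \<and> y \<in> V 1 \<and> y \<in> V 2)" for y
  proof -
    have "y \<in> C" if "y \<in> space M" "a 0 y = 0" "a 1 y = 0" using that a_sum[of y] by (simp add: C_def all_less_3)
    then show "\<not> (y \<in> U 0 \<and> y \<in> U 1 \<and> y \<in> U 2)" "\<not> (y \<in> V 0 \<and> y \<in> V 1 \<and> y \<in> V 2)"
      using signs[of 0 y] signs[of 1 y] signs[of 2 y] a_sum[of y] by force+
  qed
  define Wp where "Wp k = U k \<inter> (\<Inter>j\<in>{..<3} - {k}. V j)" for k
  define Wm where "Wm k = V k \<inter> (\<Inter>j\<in>{..<3} - {k}. U j)" for k
  have s3: "{..<3::nat} = {0, 1, 2}" by auto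
  have Ws: "Wp 0 = U 0 \<inter> V 1 \<inter> V 2" "Wp 1 = V 0 \<inter> U 1 \<inter> V 2" "Wp 2 = V 0 \<inter> V 1 \<inter> U 2"
    "Wm 0 = V 0 \<inter> U 1 \<inter> U 2" "Wm 1 = U 0 \<inter> V 1 \<inter> U 2" "Wm 2 = U 0 \<inter> U 1 \<inter> V 2"
    by (auto simp: Wp_def Wm_def s3)
  note Ws' = Ws Ws[unfolded One_nat_def]
  have Wmeas: "Wp k \<in> sets M" "Wm k \<in> sets M" if "k < 3" for k
    using less_3_cases[OF that] UVm[of 0] UVm[of 1] UVm[of 2] by (auto simp: Ws')
  define y where "y k = ?m (Wp k) - ?m (Wm k)" for k
  have yQ: "y k \<in> Q" if "k < 3" for k using Wmeas[OF that] by (auto simp: y_def intro!: Qd Qm)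
  have three: "?m (A1 \<union> A2 \<union> A3) = ?m A1 + ?m A2 + ?m A3"
    if "A1 \<in> sets M" "A2 \<in> sets M" "A3 \<in> sets M" "A1 \<inter> A2 = {}" "A1 \<inter> A3 = {}" "A2 \<inter> A3 = {}" for A1 A2 A3
    using that by (subst finite_measure_Union; (subst finite_measure_Union)?) auto
  have sub: "v \<in> U 0 \<or> v \<in> V 0 \<longleftrightarrow> v \<in> space M - C" "\<not> (v \<in> U 0 \<and> v \<in> V 0)"
    "v \<in> U 1 \<or> v \<in> V 1 \<longleftrightarrow> v \<in> space M - C" "\<not> (v \<in> U 1 \<and> v \<in> V 1)"
    "v \<in> U 2 \<or> v \<in> V 2 \<longleftrightarrow> v \<in> space M - C" "\<not> (v \<in> U 2 \<and> v \<in> V 2)" for v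
    using signs[of 0 v] signs[of 1 v] signs[of 2 v] by auto
  have m0: "?m (U 0) = ?m (Wp 0) + ?m (Wm 1) + ?m (Wm 2)" "?m (V 0) = ?m (Wm 0) + ?m (Wp 1) + ?m (Wp 2)"
    and m1: "?m (U 1) = ?m (Wp 1) + ?m (Wm 0) + ?m (Wm 2)" "?m (V 1) = ?m (Wm 1) + ?m (Wp 0) + ?m (Wp 2)"
    and m2: "?m (U 2) = ?m (Wp 2) + ?m (Wm 0) + ?m (Wm 1)" "?m (V 2) = ?m (Wm 2) + ?m (Wp 0) + ?m (Wp 1)"
  proof -
    have e0a: "U 0 = Wp 0 \<union> Wm 1 \<union> Wm 2"
    proof (rule set_eqI)
      fix v show "v \<in> U 0 \<longleftrightarrow> v \<in> Wp 0 \<union> Wm 1 \<union> Wm 2"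
        using sub[of v] not_all[of v] by (simp only: Ws Un_iff Int_iff) argo
    qed
    have e0b: "V 0 = Wm 0 \<union> Wp 1 \<union> Wp 2"
    proof (rule set_eqI)
      fix v show "v \<in> V 0 \<longleftrightarrow> v \<in> Wm 0 \<union> Wp 1 \<union> Wp 2"
        using sub[of v] not_all[of v] by (simp only: Ws Un_iff Int_iff) argo
    qed
    have e1a: "U 1 = Wp 1 \<union> Wm 0 \<union> Wm 2"
    proof (rule set_eqI)
      fix v show "v \<in> U 1 \<longleftrightarrow> v \<in> Wp 1 \<union> Wm 0 \<union> Wm 2"
        using sub[of v] not_all[of v] by (simp only: Ws Un_iff Int_iff) argo
    qed
    have e1b: "V 1 = Wm 1 \<union> Wp 0 \<union> Wp 2"
    proof (rule set_eqI)
      fix v show "v \<in> V 1 \<longleftrightarrow> v \<in> Wm 1 \<union> Wp 0 \<union> Wp 2"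
        using sub[of v] not_all[of v] by (simp only: Ws Un_iff Int_iff) argo
    qed
    have e2a: "U 2 = Wp 2 \<union> Wm 0 \<union> Wm 1"
    proof (rule set_eqI)
      fix v show "v \<in> U 2 \<longleftrightarrow> v \<in> Wp 2 \<union> Wm 0 \<union> Wm 1"
        using sub[of v] not_all[of v] by (simp only: Ws Un_iff Int_iff) argo
    qed
    have e2b: "V 2 = Wm 2 \<union> Wp 0 \<union> Wp 1"
    proof (rule set_eqI)
      fix v show "v \<in> V 2 \<longleftrightarrow> v \<in> Wm 2 \<union> Wp 0 \<union> Wp 1"
        using sub[of v] not_all[of v] by (simp only: Ws Un_iff Int_iff) argo
    qed
    have dis: "U j \<inter> V j = {}" if "j < 3" for j using signs[OF that] by blast
    note d3 = dis[of 0, simplified] dis[of 1, simplified] dis[of 2, simplified]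
    show "?m (U 0) = ?m (Wp 0) + ?m (Wm 1) + ?m (Wm 2)"
      by (subst e0a, rule three) (auto simp: Wmeas, use d3 in \<open>auto simp: Ws'\<close>)
    show "?m (V 0) = ?m (Wm 0) + ?m (Wp 1) + ?m (Wp 2)"
      by (subst e0b, rule three) (auto simp: Wmeas, use d3 in \<open>auto simp: Ws'\<close>)
    show "?m (U 1) = ?m (Wp 1) + ?m (Wm 0) + ?m (Wm 2)"
      by (subst e1a, rule three) (auto simp: Wmeas, use d3 in \<open>auto simp: Ws'\<close>)
    show "?m (V 1) = ?m (Wm 1) + ?m (Wp 0) + ?m (Wp 2)"
      by (subst e1b, rule three) (auto simp: Wmeas, use d3 in \<open>auto simp: Ws'\<close>)
    show "?m (U 2) = ?m (Wp 2) + ?m (Wm 0) + ?m (Wm 1)"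
      by (subst e2a, rule three) (auto simp: Wmeas, use d3 in \<open>auto simp: Ws'\<close>)
    show "?m (V 2) = ?m (Wm 2) + ?m (Wp 0) + ?m (Wp 1)"
      by (subst e2b, rule three) (auto simp: Wmeas, use d3 in \<open>auto simp: Ws'\<close>)
  qed
  \<comment> \<open>The three x j are the combinations of y 0, y 1, y 2 with one plus and two minus
    signs, and their sum is -(y 0 + y 1 + y 2). Up to a global sign these are all sign patterns, so
    the four bounds together control the sum of the absolute values.\<close>
  have ysum: "\<bar>y 0\<bar> + \<bar>y 1\<bar> + \<bar>y 2\<bar> \<le> c"
  proof -
    have "x 0 = y 0 - y 1 - y 2" "x 1 = y 1 - y 0 - y 2" "x 2 = y 2 - y 0 - y 1"
      using UV[of 0] UV[of 1] UV[of 2] m0 m1 m2 by (simp_all add: y_def)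
    then show ?thesis using x[of 0] x[of 1] x[of 2] xs by (simp add: abs_le_iff) linarith
  qed
  obtain F0 where F0: "F0 \<in> sets M" "F0 \<subseteq> C" "?m F0 = \<bar>y 0\<bar>"
  proof -
    have "\<bar>y 0\<bar> \<le> ?m C" using ysum by (simp add: c_def)
    then show thesis using that split[of C "\<bar>y 0\<bar>"] yQ[of 0] Qabs by auto
  qed
  obtain F1 where F1: "F1 \<in> sets M" "F1 \<subseteq> C - F0" "?m F1 = \<bar>y 1\<bar>"
  proof -
    have "?m (C - F0) = c - \<bar>y 0\<bar>" using F0 by (simp add: finite_measure_Diff c_def)
    then have "\<bar>y 1\<bar> \<le> ?m (C - F0)" using ysum by linarith
    then show thesis using that split[of "C - F0" "\<bar>y 1\<bar>"] yQ[of 1] Qabs F0 by auto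
  qed
  obtain F2 where F2: "F2 \<in> sets M" "F2 \<subseteq> C - F0 - F1" "?m F2 = \<bar>y 2\<bar>"
  proof -
    have "?m (C - F0 - F1) = c - \<bar>y 0\<bar> - \<bar>y 1\<bar>" using F0 F1 by (simp add: finite_measure_Diff c_def)
    then have "\<bar>y 2\<bar> \<le> ?m (C - F0 - F1)" using ysum by linarith
    then show thesis using that split[of "C - F0 - F1" "\<bar>y 2\<bar>"] yQ[of 2] Qabs F0 F1 by auto
  qed
  define F where "F k = (if k = 0 then F0 else if k = 1 then F1 else F2)" for k :: nat
  have F: "F k \<in> sets M" "F k \<subseteq> C" "?m (F k) = \<bar>y k\<bar>" if "k < 3" for k
    using less_3_cases[OF that] F0 F1 F2 by (auto simp: F_def)
  have Fd: "F k \<inter> F k' = {}" if "k < 3" "k' < 3" "k \<noteq> k'" for k k'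
    using less_3_cases[OF that(1)] less_3_cases[OF that(2)] that F0 F1 F2 by (auto simp: F_def)
  \<comment> \<open>Central points satisfy every sign condition, so \<open>F k\<close>, of measure
    |y k|, may be given to the smaller of the two opposite sectors.\<close>
  define Yp where "Yp k = Wp k \<union> (if y k < 0 then F k else {})" for k
  define Ym where "Ym k = Wm k \<union> (if y k < 0 then {} else F k)" for k
  have WC: "Wp k \<inter> C = {}" "Wm k \<inter> C = {}" "Wp k \<inter> Wm k = {}" if "k < 3" for k
    using signs[OF that] by (auto simp: Wp_def Wm_def)
  have Wd: "(Wp k \<union> Wm k) \<inter> (Wp k' \<union> Wm k') = {}" if "k < 3" "k' < 3" "k \<noteq> k'" for k k'
    using less_3_cases[OF that(1)] less_3_cases[OF that(2)] that(3) sub[unfolded One_nat_def] by (auto simp: Ws')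
  have cover: "space M - C = (\<Union>k<3. Wp k \<union> Wm k)"
  proof (intro set_eqI)
    fix v
    have "v \<in> (\<Union>k<3. Wp k \<union> Wm k) \<longleftrightarrow> v \<in> Wp 0 \<or> v \<in> Wm 0 \<or> v \<in> Wp 1 \<or> v \<in> Wm 1 \<or> v \<in> Wp 2 \<or> v \<in> Wm 2"
      unfolding s3 by blast
    then show "v \<in> space M - C \<longleftrightarrow> v \<in> (\<Union>k<3. Wp k \<union> Wm k)"
      using sub[of v] not_all[of v] by (simp only: Ws Int_iff) argo
  qed
  show ?thesis
    unfolding sector_partition_def
  proof (rule exI[of _ "C - (\<Union>k<3. F k)"], rule exI[of _ Yp], rule exI[of _ Ym], intro conjI allI impI)
    show "C - (\<Union>k<3. F k) \<in> sets M" using F by auto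
    fix k :: nat assume k: "k < 3"
    show "Yp k \<in> sets M" "Ym k \<in> sets M" using F[OF k] Wmeas[OF k] by (auto simp: Yp_def Ym_def)
    show "(C - (\<Union>k<3. F k)) \<inter> (Yp k \<union> Ym k) = {}" using WC[OF k] k by (auto simp: Yp_def Ym_def)
    show "Yp k \<inter> Ym k = {}" using WC[OF k] F[OF k] by (auto simp: Yp_def Ym_def)
    show "?m (Yp k) = ?m (Ym k)"
    proof (cases "y k < 0")
      case True
      have "?m (Wp k \<union> F k) = ?m (Wp k) + ?m (F k)"
        using F[OF k] WC[OF k] Wmeas[OF k] by (intro finite_measure_Union) auto
      then show ?thesis using True F[OF k] by (simp add: Yp_def Ym_def y_def)
    next
      case False
      have "?m (Wm k \<union> F k) = ?m (Wm k) + ?m (F k)"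
        using F[OF k] WC[OF k] Wmeas[OF k] by (intro finite_measure_Union) auto
      then show ?thesis using False F[OF k] by (simp add: Yp_def Ym_def y_def)
    qed
  next
    show "(C - (\<Union>k<3. F k)) \<union> (\<Union>k<3. Yp k \<union> Ym k) = space M"
    proof -
      have "Yp i \<union> Ym i = (Wp i \<union> Wm i) \<union> F i" for i by (auto simp: Yp_def Ym_def)
      then have "(\<Union>k<3. Yp k \<union> Ym k) = (\<Union>k<3. Wp k \<union> Wm k) \<union> (\<Union>k<3. F k)"
        by (simp only: UN_Un_distrib)
      moreover have "(\<Union>k<3. F k) \<subseteq> C" using F by auto
      ultimately show ?thesis using cover Cspace by auto
    qed
  next
    fix k k' :: nat assume k: "k < 3" "k' < 3" "k \<noteq> k'"
    show "(Yp k \<union> Ym k) \<inter> (Yp k' \<union> Ym k') = {}"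
    proof -
      have "Yp i \<union> Ym i = (Wp i \<union> Wm i) \<union> F i" for i by (auto simp: Yp_def Ym_def)
      then show ?thesis using Wd[OF k] Fd[OF k] F(2)[OF k(1)] F(2)[OF k(2)] WC[OF k(1)] WC[OF k(2)] by auto
    qed
  next
    fix j :: nat assume "j < 3"
    then show "\<forall>x\<in>C - (\<Union>k<3. F k). a j x = 0" by (auto simp: C_def)
  next
    fix k j :: nat assume kj: "k < 3" "j < 3" "j \<noteq> k"
    have "a j v = 0" if "v \<in> F k" for v using F(2)[OF kj(1)] that kj by (auto simp: C_def)
    moreover have "a j v \<le> 0" if "v \<in> Wp k" for v using that signs[OF kj(2), of v] kj by (auto simp: Wp_def)
    moreover have "0 \<le> a j v" if "v \<in> Wm k" for v using that signs[OF kj(2), of v] kj by (auto simp: Wm_def)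
    ultimately show "\<forall>x\<in>Yp k. a j x \<le> 0" "\<forall>x\<in>Ym k. 0 \<le> a j x"
      by (auto simp: Yp_def Ym_def)
  qed
qed

section \<open>Swapping sets of equal measure\<close>

text \<open>Domain and range coincide, so that maps on disjoint sets can be glued, and
  \<open>N\<close> need not have full measure. Measurability of images is measurability of the
  inverse.\<close>

definition paut :: "'a measure \<Rightarrow> 'a set \<Rightarrow> ('a \<Rightarrow> 'a) \<Rightarrow> bool" where
  "paut M N T \<longleftrightarrow> N \<in> sets M \<and> bij_betw T N N \<and>
     (\<forall>S\<in>sets M. S \<subseteq> N \<longrightarrow> T ` S \<in> sets M \<and> T -` S \<inter> N \<in> sets M \<and> emeasure M (T -` S \<inter> N) = emeasure M S)"

lemma paut_involution:
  assumes "N \<in> sets M" "\<And>x. x \<in> N \<Longrightarrow> T x \<in> N" "\<And>x. x \<in> N \<Longrightarrow> T (T x) = x"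
    and "\<And>S. S \<in> sets M \<Longrightarrow> S \<subseteq> N \<Longrightarrow> T ` S \<in> sets M \<and> emeasure M (T ` S) = emeasure M S"
  shows "paut M N T"
proof -
  have "T -` S \<inter> N = T ` S" if "S \<subseteq> N" for S
    using that assms(2,3) by (force simp: image_iff)
  moreover have "bij_betw T N N"
    by (rule bij_betw_byWitness[where f'=T]) (use assms in auto)
  ultimately show ?thesis using assms unfolding paut_def by auto
qed

lemma paut_is_aut:
  assumes "paut M N T" "emeasure M (space M - N) = 0"
  shows "is_aut M T N N"
proof -
  have N: "N \<in> sets M" "bij_betw T N N" and
    S: "\<And>S. S \<in> sets M \<Longrightarrow> S \<subseteq> N \<Longrightarrow> T ` S \<in> sets M \<and> T -` S \<inter> N \<in> sets M \<and> emeasure M (T -` S \<inter> N) = emeasure M S"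
    using assms(1) by (auto simp: paut_def)
  have inj: "inj_on T N" "T ` N = N" using N(2) by (auto simp: bij_betw_def)
  have sp: "space (restrict_space M N) = N" using sets.sets_into_space[OF N(1)] by (auto simp: space_restrict_space)
  have se: "A \<in> sets (restrict_space M N) \<longleftrightarrow> A \<in> sets M \<and> A \<subseteq> N" for A
    using N(1) sets.sets_into_space[OF N(1)] by (subst sets_restrict_space_iff) (auto simp: Int_absorb1)
  have "T \<in> measurable (restrict_space M N) (restrict_space M N)"
    using S inj by (intro measurableI) (auto simp: sp se)
  moreover have "the_inv_into N T \<in> measurable (restrict_space M N) (restrict_space M N)"
  proof (rule measurableI)
    fix x assume "x \<in> space (restrict_space M N)"
    then show "the_inv_into N T x \<in> space (restrict_space M N)"
      using inj by (auto simp: sp intro: the_inv_into_into)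
  next
    fix A assume "A \<in> sets (restrict_space M N)"
    then have A: "A \<in> sets M" "A \<subseteq> N" by (auto simp: se)
    have "the_inv_into N T -` A \<inter> N = T ` A"
    proof (intro equalityI subsetI)
      fix x assume "x \<in> the_inv_into N T -` A \<inter> N"
      then have "the_inv_into N T x \<in> A" "T (the_inv_into N T x) = x"
        using inj by (auto intro: f_the_inv_into_f)
      then show "x \<in> T ` A" by force
    next
      fix x assume "x \<in> T ` A"
      then show "x \<in> the_inv_into N T -` A \<inter> N"
        using inj A by (auto simp: the_inv_into_f_f subset_iff)
    qed
    moreover have "T ` A \<subseteq> N" using A inj by auto
    ultimately show "the_inv_into N T -` A \<inter> space (restrict_space M N) \<in> sets (restrict_space M N)"
      using S[OF A] by (simp add: sp se)
  qed
  ultimately show ?thesis using N S assms(2) by (auto simp: is_aut_def)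
qed

text \<open>Countable additivity transfers the preservation of measure to the union. Infinitely many
  pieces are needed for the exhaustion in \<open>swap_borel\<close>.\<close>

lemma paut_UN:
  fixes N :: "nat \<Rightarrow> 'a set"
  assumes p: "\<And>k. paut M (N k) (T k)" and d: "disjoint_family N"
    and U: "\<And>k x. x \<in> N k \<Longrightarrow> U x = T k x"
  shows "paut M (\<Union>k. N k) U"
proof -
  have Nm: "N k \<in> sets M" and im: "T k ` N k = N k" and inj: "inj_on (T k) (N k)" for k
    using p[of k] by (auto simp: paut_def bij_betw_def)
  have S: "T k ` S \<in> sets M \<and> T k -` S \<inter> N k \<in> sets M \<and> emeasure M (T k -` S \<inter> N k) = emeasure M S"
    if "S \<in> sets M" "S \<subseteq> N k" for S k
    using p[of k] that by (auto simp: paut_def)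
  have UN: "U ` (S \<inter> N k) = T k ` (S \<inter> N k)" for S k
    using U by (auto simp: image_iff) force+
  have Uin: "U x \<in> N k" if "x \<in> N k" for x k
    using im[of k] U[OF that] that by auto
  have uniq: "k = l" if "x \<in> N k" "x \<in> N l" for x k l
    using d that by (auto simp: disjoint_family_on_def)
  have "bij_betw U (\<Union>k. N k) (\<Union>k. N k)"
  proof (rule bij_betw_imageI)
    show "inj_on U (\<Union>k. N k)"
    proof (rule inj_onI)
      fix x y assume "x \<in> (\<Union>k. N k)" "y \<in> (\<Union>k. N k)" and eq: "U x = U y"
      then obtain k l where kl: "x \<in> N k" "y \<in> N l" by auto
      then have "k = l" using uniq[of "U x" k l] Uin eq by metis
      then show "x = y" using kl eq U inj[of k] by (metis inj_onD)
    qed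
    show "U ` (\<Union>k. N k) = (\<Union>k. N k)"
      using UN[of UNIV] im by (simp add: image_UN)
  qed
  moreover have "U ` A \<in> sets M \<and> U -` A \<inter> (\<Union>k. N k) \<in> sets M \<and> emeasure M (U -` A \<inter> (\<Union>k. N k)) = emeasure M A"
    if A: "A \<in> sets M" "A \<subseteq> (\<Union>k. N k)" for A
  proof -
    have AN: "A = (\<Union>k. A \<inter> N k)" using A by auto
    have m: "A \<inter> N k \<in> sets M" for k using A Nm by auto
    have "U ` A = (\<Union>k. U ` (A \<inter> N k))" using A by blast
    also have "\<dots> = (\<Union>k. T k ` (A \<inter> N k))" by (simp only: UN)
    also have "\<dots> \<in> sets M" using S m by (intro sets.countable_UN) auto
    finally have 1: "U ` A \<in> sets M" .
    have e: "U -` A \<inter> (\<Union>k. N k) = (\<Union>k. T k -` (A \<inter> N k) \<inter> N k)"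
      using U Uin by auto
    have m2: "T k -` (A \<inter> N k) \<inter> N k \<in> sets M" for k using S[OF m] by auto
    have "emeasure M (\<Union>k. T k -` (A \<inter> N k) \<inter> N k) = (\<Sum>k. emeasure M (T k -` (A \<inter> N k) \<inter> N k))"
      using m2 d by (intro suminf_emeasure[symmetric]) (auto simp: disjoint_family_on_def)
    also have "\<dots> = (\<Sum>k. emeasure M (A \<inter> N k))" using S[OF m] by simp
    also have "\<dots> = emeasure M (\<Union>k. A \<inter> N k)"
      using m d by (intro suminf_emeasure) (auto simp: disjoint_family_on_def)
    finally have "emeasure M (U -` A \<inter> (\<Union>k. N k)) = emeasure M A" unfolding e using AN by simp
    moreover have "U -` A \<inter> (\<Union>k. N k) \<in> sets M" unfolding e using m2 by (intro sets.countable_UN) auto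
    ultimately show ?thesis using 1 by simp
  qed
  ultimately show ?thesis using Nm by (auto simp: paut_def)
qed

section \<open>Exchanging sets of equal Lebesgue measure by translations\<close>

lemma emeasure_lebesgue_translation:
  fixes S :: "real set"
  shows "emeasure lebesgue ((\<lambda>x. x + a) ` S) = emeasure lebesgue S"
  using emeasure_lebesgue_affine[of 1 a S] by (simp add: add.commute cong: image_cong_simp)

lemma lebesgue_translation:
  fixes S :: "real set"
  assumes "S \<in> sets lebesgue"
  shows "(\<lambda>x. x + a) ` S \<in> sets lebesgue"
  using lebesgue_sets_translation[OF assms, of a] by (simp add: add.commute cong: image_cong_simp)

abbreviation unit_lebesgue :: "real measure" where
  "unit_lebesgue \<equiv> lebesgue_on {0..1}"

lemma sets_unit_lebesgue: "S \<in> sets unit_lebesgue \<longleftrightarrow> S \<in> sets lebesgue \<and> S \<subseteq> {0..1}"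
  by (subst sets_restrict_space_iff) auto

lemma emeasure_unit_lebesgue: "S \<subseteq> {0..1} \<Longrightarrow> emeasure unit_lebesgue S = emeasure lebesgue S"
  by (subst emeasure_restrict_space) auto

lemma paut_translation_swap:
  fixes t :: real
  assumes C: "C \<in> sets lebesgue" "C \<subseteq> {0..1}" and D: "D = (\<lambda>x. x + t) ` C" "D \<subseteq> {0..1}" "C \<inter> D = {}"
  shows "paut unit_lebesgue (C \<union> D) (\<lambda>x. if x \<in> C then x + t else x - t)" (is "paut _ _ ?T")
proof (rule paut_involution)
  have Dm: "D \<in> sets lebesgue" using C D lebesgue_translation by auto
  then show "C \<union> D \<in> sets unit_lebesgue" using C D by (auto simp: sets_unit_lebesgue)
  show T: "?T x \<in> C \<union> D" if "x \<in> C \<union> D" for x using that D by auto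
  show "?T (?T x) = x" if "x \<in> C \<union> D" for x
  proof (cases "x \<in> C")
    case True
    then have "x + t \<in> D" using D by auto
    then have "x + t \<notin> C" using D by auto
    with True show ?thesis by simp
  next
    case False
    then have "x - t \<in> C" using that D by auto
    with False show ?thesis by simp
  qed
  fix S assume S: "S \<in> sets unit_lebesgue" "S \<subseteq> C \<union> D"
  have Sm: "S \<in> sets lebesgue" using S by (simp add: sets_unit_lebesgue)
  have e: "?T ` S = (\<lambda>x. x + t) ` (S \<inter> C) \<union> (\<lambda>x. x + - t) ` (S \<inter> D)"
    using S D by (auto simp: image_iff)
  have m: "S \<inter> C \<in> sets lebesgue" "S \<inter> D \<in> sets lebesgue" using Sm C Dm by auto
  note m' = lebesgue_translation[OF m(1), of t] lebesgue_translation[OF m(2), of "- t"]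
  have sub: "?T ` S \<subseteq> {0..1}"
  proof (rule image_subsetI)
    fix x assume "x \<in> S"
    then have "?T x \<in> C \<union> D" using T[of x] S(2) by (simp only: subset_iff)
    then show "?T x \<in> {0..1}" using C(2) D(2) by (simp only: subset_iff Un_iff) (elim disjE; simp only:)
  qed
  have "(\<lambda>x. x + t) ` (S \<inter> C) \<subseteq> D" "(\<lambda>x. x + - t) ` (S \<inter> D) \<subseteq> C" using D by auto
  then have "(\<lambda>x. x + t) ` (S \<inter> C) \<inter> (\<lambda>x. x + - t) ` (S \<inter> D) = {}" using D(3) by blast
  then have "emeasure lebesgue (?T ` S) = emeasure lebesgue ((\<lambda>x. x + t) ` (S \<inter> C)) + emeasure lebesgue ((\<lambda>x. x + - t) ` (S \<inter> D))"
    unfolding e by (rule plus_emeasure[OF m', symmetric])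
  also have "\<dots> = emeasure lebesgue (S \<inter> C) + emeasure lebesgue (S \<inter> D)"
    by (simp only: emeasure_lebesgue_translation)
  also have "\<dots> = emeasure lebesgue ((S \<inter> C) \<union> (S \<inter> D))"
    using m D by (intro plus_emeasure) auto
  also have "(S \<inter> C) \<union> (S \<inter> D) = S" using S by auto
  finally have "emeasure lebesgue (?T ` S) = emeasure lebesgue S" .
  moreover have "?T ` S \<in> sets lebesgue" unfolding e using m' by (rule sets.Un)
  moreover have "S \<subseteq> {0..1}" using S by (simp add: sets_unit_lebesgue)
  ultimately show "?T ` S \<in> sets unit_lebesgue \<and> emeasure unit_lebesgue (?T ` S) = emeasure unit_lebesgue S"
    using sub by (simp only: emeasure_unit_lebesgue sets_unit_lebesgue)
qed

text \<open>
  The average over \<open>t \<in> [-1, 1]\<close> of the measure of \<open>A \<inter> (B - t)\<close> is half the product of the measures.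
\<close>

lemma large_translated_intersection:
  fixes A B :: "real set"
  assumes [measurable]: "A \<in> sets borel" "B \<in> sets borel" and sub: "A \<subseteq> {0..1}" "B \<subseteq> {0..1}"
  shows "\<exists>t. measure lborel A * measure lborel B / 4 \<le> measure lborel {x \<in> A. x + t \<in> B}"
proof (rule ccontr)
  define q where "q = measure lborel A * measure lborel B / 4"
  assume "\<not> ?thesis"
  then have lt: "measure lborel {x \<in> A. x + t \<in> B} < q" for t by (auto simp: q_def not_le)
  have fin: "emeasure lborel S < \<infinity>" if "S \<subseteq> {0..1}" for S :: "real set"
    using emeasure_mono[OF that, of lborel] by (auto simp: order_le_less_trans)
  have ez: "emeasure lborel S = ennreal (measure lborel S)" if "S \<subseteq> {0..1}" for S :: "real set"
    using fin[OF that] by (intro emeasure_eq_ennreal_measure) auto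
  have q: "0 < q" using lt[of 0] measure_nonneg[of lborel "{x \<in> A. x + 0 \<in> B}"] by linarith
  have "(\<integral>\<^sup>+t. \<integral>\<^sup>+x. indicator A x * indicator B (x + t) \<partial>lborel \<partial>lborel) =
        (\<integral>\<^sup>+x. \<integral>\<^sup>+t. indicator A x * indicator B (x + t) \<partial>lborel \<partial>lborel :: ennreal)"
    by (rule lborel_pair.Fubini') measurable
  also have "\<dots> = (\<integral>\<^sup>+x. indicator A x * emeasure lborel B \<partial>lborel)"
  proof (rule nn_integral_cong)
    fix x :: real
    have "(\<integral>\<^sup>+t. indicator B (x + t) \<partial>lborel) = (\<integral>\<^sup>+t. indicator B t \<partial>lborel :: ennreal)"
      using nn_integral_real_affine[of "indicator B" 1 x] by simp
    then show "(\<integral>\<^sup>+t. indicator A x * indicator B (x + t) \<partial>lborel) = (indicator A x * emeasure lborel B :: ennreal)"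
      by (subst nn_integral_cmult) auto
  qed
  also have "\<dots> = emeasure lborel A * emeasure lborel B"
    by (subst nn_integral_multc) auto
  also have "\<dots> = ennreal (4 * q)"
    using sub by (simp add: ez q_def ennreal_mult')
  finally have "ennreal (4 * q) = (\<integral>\<^sup>+t. \<integral>\<^sup>+x. indicator A x * indicator B (x + t) \<partial>lborel \<partial>lborel)" ..
  \<comment> \<open>The intersections are empty unless |t| \<le> 1, so the assumed bound
    \<open>q\<close> on each of them allows at most 2q, against the exact value 4q from Fubini's
    theorem.\<close>
  also have "\<dots> \<le> (\<integral>\<^sup>+t. ennreal q * indicator {-1..1::real} t \<partial>lborel)"
  proof (rule nn_integral_mono)
    fix t :: real
    have "(\<integral>\<^sup>+x. indicator A x * indicator B (x + t) \<partial>lborel) = (\<integral>\<^sup>+x. indicator {x \<in> A. x + t \<in> B} x \<partial>lborel :: ennreal)"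
      by (intro nn_integral_cong) (auto simp: indicator_def)
    also have "\<dots> = emeasure lborel {x \<in> A. x + t \<in> B}"
    proof (rule nn_integral_indicator)
      have "{x \<in> A. x + t \<in> B} = {x \<in> space borel. x \<in> A \<and> x + t \<in> B}" by auto
      also have "\<dots> \<in> sets borel" by measurable
      finally show "{x \<in> A. x + t \<in> B} \<in> sets lborel" by simp
    qed
    also have "\<dots> \<le> ennreal q * indicator {-1..1::real} t"
    proof (cases "t \<in> {-1..1}")
      case True
      then show ?thesis using lt[of t] sub by (subst ez) (auto intro!: ennreal_leI)
    next
      case False
      then have "{x \<in> A. x + t \<in> B} = {}" using sub by force
      then show ?thesis by (simp only: emeasure_empty zero_le)
    qed
    finally show "(\<integral>\<^sup>+x. indicator A x * indicator B (x + t) \<partial>lborel) \<le> ennreal q * indicator {-1..1::real} t" .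
  qed
  also have "\<dots> = ennreal (2 * q)"
    using q by (subst nn_integral_cmult) (auto simp: ennreal_mult' mult.commute)
  finally show False using q by simp
qed

lemma borel_translation:
  fixes S :: "real set"
  assumes "S \<in> sets borel"
  shows "(\<lambda>x. x + a) ` S \<in> sets borel"
proof -
  have "(\<lambda>x. x + a) ` S = (\<lambda>x. x - a) -` S \<inter> space borel" by (auto simp: image_iff) (metis diff_add_cancel)
  also have "\<dots> \<in> sets borel" using assms by (intro measurable_sets[of _ borel borel]) auto
  finally show ?thesis .
qed

text \<open>
  Greedy exhaustion: each step removes from \<open>A\<close> and \<open>B\<close> a piece and its translate of measure at least
  \<open>m\<^sup>2/4\<close>, where \<open>m\<close> is the measure still left, so in the end nothing remains.
\<close>

lemma swap_borel:
  fixes A B :: "real set"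
  assumes A: "A \<in> sets borel" "A \<subseteq> {0..1}" and B: "B \<in> sets borel" "B \<subseteq> {0..1}"
    and dis: "A \<inter> B = {}" and eq: "measure lborel A = measure lborel B"
  shows "\<exists>N T. paut unit_lebesgue N T \<and> N \<subseteq> A \<union> B \<and> emeasure lebesgue (A \<union> B - N) = 0 \<and>
    (\<forall>x\<in>N. T (T x) = x \<and> (x \<in> A \<longrightarrow> T x \<in> B) \<and> (x \<in> B \<longrightarrow> T x \<in> A))"
proof -
  let ?m = "measure lborel"
  define pick where "pick A B = (SOME t. ?m A * ?m B / 4 \<le> ?m {x \<in> A. x + t \<in> B})" for A B :: "real set"
  define step where "step = (\<lambda>(A, B). (A - {x \<in> A. x + pick A B \<in> B}, B - (\<lambda>x. x + pick A B) ` {x \<in> A. x + pick A B \<in> B}))"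
  define a where "a k = fst ((step ^^ k) (A, B))" for k
  define b where "b k = snd ((step ^^ k) (A, B))" for k
  define t where "t k = pick (a k) (b k)" for k
  define C where "C k = {x \<in> a k. x + t k \<in> b k}" for k
  define D where "D k = (\<lambda>x. x + t k) ` C k" for k
  have ab0: "a 0 = A" "b 0 = B" by (simp_all add: a_def b_def)
  have abS: "a (Suc k) = a k - C k" "b (Suc k) = b k - D k" for k
    by (simp_all add: a_def b_def C_def D_def t_def step_def split_beta)
  have Cb: "C k \<in> sets borel" if "a k \<in> sets borel" "b k \<in> sets borel" for k
  proof -
    have "C k = {x \<in> space borel. x \<in> a k \<and> x + t k \<in> b k}" by (auto simp: C_def)
    also have "\<dots> \<in> sets borel" using that by measurable
    finally show ?thesis .
  qed
  have Db: "D k \<in> sets borel" if "C k \<in> sets borel" for k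
    unfolding D_def using that by (rule borel_translation)
  have mD: "?m (D k) = ?m (C k)" if "C k \<in> sets borel" for k
  proof -
    have "measure lebesgue (D k) = measure lebesgue (C k)"
      unfolding D_def measure_def by (simp only: emeasure_lebesgue_translation)
    then show ?thesis using that Db[OF that] by (simp add: measure_completion)
  qed
  have fin: "emeasure lborel S \<noteq> \<infinity>" if "S \<subseteq> {0..1}" for S :: "real set"
    using emeasure_mono[OF that, of lborel] by (auto simp: top_unique)
  have sub: "C k \<subseteq> a k" "D k \<subseteq> b k" for k by (auto simp: C_def D_def)
  have mdiff: "?m (X - Y) = ?m X - ?m Y" if "X \<in> sets borel" "Y \<in> sets borel" "X \<subseteq> {0..1}" "Y \<subseteq> X" for X Y :: "real set"
    using that fin by (intro measure_Diff) auto
  have inv: "a k \<in> sets borel \<and> b k \<in> sets borel \<and> a k \<subseteq> A \<and> b k \<subseteq> B \<and> ?m (a k) = ?m (b k)" for k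
  proof (induction k)
    case 0
    then show ?case using A B eq by (simp add: ab0)
  next
    case (Suc k)
    then have c: "C k \<in> sets borel" using Cb by blast
    note d = Db[OF c] mD[OF c]
    have "?m (a k - C k) = ?m (a k) - ?m (C k)" "?m (b k - D k) = ?m (b k) - ?m (D k)"
      using Suc c d sub[of k] A B by (intro mdiff; blast)+
    with Suc c d show ?case by (auto simp: abS)
  qed
  then have Cm: "C k \<in> sets borel" for k using Cb by blast
  note Dm = Db[OF Cm] and mDC = mD[OF Cm]
  have big: "?m (a k) * ?m (a k) / 4 \<le> ?m (C k)" for k
  proof -
    have "\<exists>t. ?m (a k) * ?m (b k) / 4 \<le> ?m {x \<in> a k. x + t \<in> b k}"
      using inv[of k] A B by (intro large_translated_intersection) auto
    from someI_ex[OF this] show ?thesis using inv[of k] by (simp add: C_def t_def pick_def)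
  qed
  have aS: "?m (a (Suc k)) = ?m (a k) - ?m (C k)" for k
    unfolding abS using inv[of k] Cm[of k] sub[of k] A by (intro mdiff; blast)
  have "decseq (\<lambda>k. ?m (a k))" by (intro decseq_SucI) (simp add: aS)
  then obtain L where L: "(\<lambda>k. ?m (a k)) \<longlonglongrightarrow> L"
    using decseq_convergent[of "\<lambda>k. ?m (a k)" 0] by auto
  \<comment> \<open>The removed measures are differences of consecutive terms of a convergent
    sequence and so tend to 0, yet by \<open>big\<close> their limit is at least L^2 / 4.\<close>
  have "L = 0"
  proof -
    have "(\<lambda>k. ?m (a k) - ?m (a (Suc k))) \<longlonglongrightarrow> L - L"
      using L by (intro tendsto_diff LIMSEQ_Suc)
    then have "(\<lambda>k. ?m (C k)) \<longlonglongrightarrow> 0" by (simp add: aS)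
    moreover have "(\<lambda>k. ?m (a k) * ?m (a k) / 4) \<longlonglongrightarrow> L * L / 4" using L by (intro tendsto_intros) auto
    ultimately have "L * L / 4 \<le> 0" using big by (intro LIMSEQ_le) auto
    then show ?thesis using zero_le_square[of L] by (simp add: order_antisym)
  qed
  have null: "emeasure lborel (\<Inter>k. X k) = 0" if "(\<lambda>k. ?m (X k)) \<longlonglongrightarrow> 0" "\<And>k. X k \<in> sets borel" "\<And>k. X k \<subseteq> {0..1}" for X :: "nat \<Rightarrow> real set"
  proof -
    have "?m (\<Inter>k. X k) \<le> ?m (X k)" for k
      using that fin by (intro measure_mono_fmeasurable) (auto simp: fmeasurable_def less_top)
    then have "?m (\<Inter>k. X k) \<le> 0" using that(1) by (intro LIMSEQ_le_const) auto
    then have z: "?m (\<Inter>k. X k) = 0" using measure_nonneg[of lborel "\<Inter>k. X k"] by linarith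
    have "(\<Inter>k. X k) \<subseteq> {0..1}" using that(3) by auto
    from fin[OF this] z show ?thesis by (simp add: emeasure_eq_ennreal_measure)
  qed
  have step_in: "x \<in> a k \<or> (\<exists>j. x \<in> C j)" if "x \<in> A" for x k
    using that by (induction k) (auto simp: ab0 abS)
  have step_in': "x \<in> b k \<or> (\<exists>j. x \<in> D j)" if "x \<in> B" for x k
    using that by (induction k) (auto simp: ab0 abS)
  define N where "N k = C k \<union> D k" for k
  have restA: "A - (\<Union>k. C k) \<subseteq> (\<Inter>k. a k)" using step_in by auto
  have restB: "B - (\<Union>k. D k) \<subseteq> (\<Inter>k. b k)" using step_in' by auto
  have za: "emeasure lborel (\<Inter>k. a k) = 0" using L \<open>L = 0\<close> inv A by (intro null) auto
  have zb: "emeasure lborel (\<Inter>k. b k) = 0" using L \<open>L = 0\<close> inv B by (intro null) auto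
  have zero: "emeasure lebesgue (A \<union> B - (\<Union>k. N k)) = 0"
  proof -
    have "A \<union> B - (\<Union>k. N k) \<subseteq> (\<Inter>k. a k) \<union> (\<Inter>k. b k)" using restA restB by (auto simp: N_def)
    moreover have "(\<Inter>k. a k) \<union> (\<Inter>k. b k) \<in> null_sets lebesgue"
    proof -
      have "(\<Inter>k. a k) \<in> sets borel" "(\<Inter>k. b k) \<in> sets borel" using inv by (auto intro!: sets.countable_INT)
      then show ?thesis using za zb by (intro null_sets.Un) (auto simp: null_sets_def)
    qed
    moreover have "A \<union> B - (\<Union>k. N k) \<in> sets lebesgue"
    proof -
      have "A \<union> B - (\<Union>k. N k) \<in> sets borel" using A B Cm Dm by (auto simp: N_def)
      then show ?thesis by simp
    qed
    ultimately show ?thesis by (metis null_sets_subset null_setsD1)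
  qed
  have mono: "a l \<subseteq> a k" "b l \<subseteq> b k" if "k \<le> l" for k l
    using that by (induction rule: dec_induct) (auto simp: abS)
  have Cd: "C k \<inter> C l = {}" "D k \<inter> D l = {}" if "k < l" for k l
    using mono[of "Suc k" l] that sub[of l] by (auto simp: abS)
  have CD: "C k \<inter> D l = {}" for k l using sub[of k] sub[of l] inv[of k] inv[of l] dis by blast
  have disN: "disjoint_family N"
    unfolding disjoint_family_on_def
  proof (intro ballI impI)
    fix m n :: nat assume "m \<noteq> n"
    then consider "m < n" | "n < m" by linarith
    then show "N m \<inter> N n = {}"
      using Cd[of m n] Cd[of n m] CD[of m n] CD[of n m] by cases (auto simp: N_def)
  qed
  define T where "T k x = (if x \<in> C k then x + t k else x - t k)" for k x
  have pT: "paut unit_lebesgue (N k) (T k)" for k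
    unfolding T_def N_def
  proof (rule paut_translation_swap)
    show "C k \<in> sets lebesgue" using Cm[of k] by simp
    show "C k \<subseteq> {0..1}" "D k \<subseteq> {0..1}" using sub[of k] inv[of k] A B by blast+
  qed (use CD in \<open>auto simp: D_def\<close>)
  define U where "U x = T (THE k. x \<in> N k) x" for x
  have U: "U x = T k x" if "x \<in> N k" for k x
  proof -
    have "(THE k. x \<in> N k) = k" using that disN by (intro the_equality) (auto simp: disjoint_family_on_def)
    then show ?thesis by (simp add: U_def)
  qed
  have "paut unit_lebesgue (\<Union>k. N k) U" by (rule paut_UN[OF pT disN U])
  moreover have "(\<Union>k. N k) \<subseteq> A \<union> B" using sub inv by (force simp: N_def)
  moreover have "U (U x) = x \<and> (x \<in> A \<longrightarrow> U x \<in> B) \<and> (x \<in> B \<longrightarrow> U x \<in> A)" if mem: "x \<in> (\<Union>k. N k)" for x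
  proof -
    obtain k where k: "x \<in> N k" using mem by blast
    have CA: "C k \<subseteq> A" and DB: "D k \<subseteq> B" using sub[of k] inv[of k] by blast+
    show ?thesis
    proof (cases "x \<in> C k")
      case True
      then have D: "x + t k \<in> D k" by (simp add: D_def)
      then have nC: "x + t k \<notin> C k" and N: "x + t k \<in> N k" using CD[of k k] by (auto simp: N_def)
      have "U x = x + t k" "U (x + t k) = x" using U[OF k] U[OF N] True nC by (simp_all add: T_def)
      then show ?thesis using True D CA DB dis by auto
    next
      case False
      then have D: "x \<in> D k" using k by (simp add: N_def)
      then have C: "x - t k \<in> C k" by (auto simp: D_def)
      then have N: "x - t k \<in> N k" by (simp add: N_def)
      have "U x = x - t k" "U (x - t k) = x" using U[OF k] U[OF N] False C by (simp_all add: T_def)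
      then show ?thesis using C D CA DB dis by auto
    qed
  qed
  ultimately show ?thesis using zero by blast
qed

text \<open>The exhaustion runs on Borel sets, where Fubini's theorem for \<open>lborel\<close>
  applies. The null remainder can be discarded because the exchange may omit a null set.\<close>

lemma borel_kernel:
  fixes S :: "real set"
  assumes "S \<in> sets lebesgue"
  obtains S' where "S' \<in> sets borel" "S' \<subseteq> S" "S - S' \<in> null_sets lebesgue"
proof -
  obtain C T where CT: "fsigma C" "T \<in> null_sets lebesgue" "C \<union> T = S" "disjnt C T"
    using lebesgue_set_almost_fsigma[OF assms] .
  have "C \<in> sets borel" using CT(1)
  proof (cases rule: fsigma.cases)
    case (1 F)
    then show ?thesis by auto
  qed
  moreover have "S - C = T" using CT by (auto simp: disjnt_def)
  ultimately show thesis using that[of C] CT by auto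
qed

lemma swap_lebesgue:
  assumes A: "A \<in> sets unit_lebesgue" and B: "B \<in> sets unit_lebesgue"
    and dis: "A \<inter> B = {}" and eq: "measure unit_lebesgue A = measure unit_lebesgue B"
  shows "\<exists>N T. paut unit_lebesgue N T \<and> N \<subseteq> A \<union> B \<and> emeasure unit_lebesgue (A \<union> B - N) = 0 \<and>
    (\<forall>x\<in>N. T (T x) = x \<and> (x \<in> A \<longrightarrow> T x \<in> B) \<and> (x \<in> B \<longrightarrow> T x \<in> A))"
proof -
  have AB: "A \<in> sets lebesgue" "A \<subseteq> {0..1}" "B \<in> sets lebesgue" "B \<subseteq> {0..1}"
    using A B by (auto simp: sets_unit_lebesgue)
  obtain A' where A': "A' \<in> sets borel" "A' \<subseteq> A" "A - A' \<in> null_sets lebesgue" using borel_kernel[OF AB(1)] .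
  obtain B' where B': "B' \<in> sets borel" "B' \<subseteq> B" "B - B' \<in> null_sets lebesgue" using borel_kernel[OF AB(3)] .
  have mm: "measure lborel S' = measure unit_lebesgue S"
    if "S' \<in> sets borel" "S' \<subseteq> S" "S - S' \<in> null_sets lebesgue" "S \<subseteq> {0..1}" for S S' :: "real set"
  proof -
    have "emeasure lebesgue S = emeasure lebesgue (S' \<union> (S - S'))" using that by (simp add: Un_absorb1)
    also have "\<dots> = emeasure lebesgue S'" using that by (intro emeasure_Un_null_set) auto
    also have "\<dots> = emeasure lborel S'" using that by simp
    finally show ?thesis using emeasure_unit_lebesgue[OF that(4)] by (simp add: measure_def)
  qed
  have "measure lborel A' = measure lborel B'" using mm[OF A'] mm[OF B'] AB eq by simp
  then obtain N T where NT: "paut unit_lebesgue N T" "N \<subseteq> A' \<union> B'" "emeasure lebesgue (A' \<union> B' - N) = 0"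
    "\<And>x. x \<in> N \<Longrightarrow> T (T x) = x \<and> (x \<in> A' \<longrightarrow> T x \<in> B') \<and> (x \<in> B' \<longrightarrow> T x \<in> A')"
    using swap_borel[of A' B'] A' B' AB dis by blast
  have N: "N \<in> sets lebesgue" using NT(1) by (simp add: paut_def sets_unit_lebesgue)
  have "A \<union> B - N \<subseteq> (A' \<union> B' - N) \<union> ((A - A') \<union> (B - B'))" by auto
  moreover have "A' \<union> B' - N \<in> null_sets lebesgue"
    using NT(3) A' B' N by (auto simp: null_sets_def)
  then have "(A' \<union> B' - N) \<union> ((A - A') \<union> (B - B')) \<in> null_sets lebesgue"
    using A' B' by (intro null_sets.Un)
  moreover have "A \<union> B - N \<in> sets lebesgue" using AB N by auto
  ultimately have "emeasure lebesgue (A \<union> B - N) = 0"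
    by (metis null_sets_subset null_setsD1)
  then have "emeasure unit_lebesgue (A \<union> B - N) = 0"
    using AB by (subst emeasure_unit_lebesgue) auto
  moreover have "(x \<in> A \<longrightarrow> T x \<in> B) \<and> (x \<in> B \<longrightarrow> T x \<in> A)" if "x \<in> N" for x
    using NT(2) NT(4)[OF that] that A' B' dis by blast
  ultimately show ?thesis using NT A' B' by blast
qed

section \<open>Odd cycles of points on the lines\<close>

text \<open>
  The first six alternatives say that \<open>x\<close> and \<open>y\<close> lie in opposite closed sectors, the last six that they
  lie on two rays at angle \<open>2\<pi>/3\<close>.
\<close>

definition adj3 :: "('a \<Rightarrow> real) \<Rightarrow> ('a \<Rightarrow> real) \<Rightarrow> ('a \<Rightarrow> real) \<Rightarrow> 'a \<Rightarrow> 'a \<Rightarrow> bool" where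
  "adj3 a b c x y \<longleftrightarrow>
     a x \<le> 0 \<and> b x \<le> 0 \<and> 0 \<le> a y \<and> 0 \<le> b y \<or> 0 \<le> a x \<and> 0 \<le> b x \<and> a y \<le> 0 \<and> b y \<le> 0 \<or>
     b x \<le> 0 \<and> c x \<le> 0 \<and> 0 \<le> b y \<and> 0 \<le> c y \<or> 0 \<le> b x \<and> 0 \<le> c x \<and> b y \<le> 0 \<and> c y \<le> 0 \<or>
     c x \<le> 0 \<and> a x \<le> 0 \<and> 0 \<le> c y \<and> 0 \<le> a y \<or> 0 \<le> c x \<and> 0 \<le> a x \<and> c y \<le> 0 \<and> a y \<le> 0 \<or>
     a x = 0 \<and> b y = 0 \<and> c x * c y \<le> 0 \<or> b x = 0 \<and> a y = 0 \<and> c x * c y \<le> 0 \<or>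
     b x = 0 \<and> c y = 0 \<and> a x * a y \<le> 0 \<or> c x = 0 \<and> b y = 0 \<and> a x * a y \<le> 0 \<or>
     c x = 0 \<and> a y = 0 \<and> b x * b y \<le> 0 \<or> a x = 0 \<and> c y = 0 \<and> b x * b y \<le> 0"

lemma adj3I:
  "a x \<le> 0 \<Longrightarrow> b x \<le> 0 \<Longrightarrow> 0 \<le> a y \<Longrightarrow> 0 \<le> b y \<Longrightarrow> adj3 a b c x y"
  "0 \<le> a x \<Longrightarrow> 0 \<le> b x \<Longrightarrow> a y \<le> 0 \<Longrightarrow> b y \<le> 0 \<Longrightarrow> adj3 a b c x y"
  "b x \<le> 0 \<Longrightarrow> c x \<le> 0 \<Longrightarrow> 0 \<le> b y \<Longrightarrow> 0 \<le> c y \<Longrightarrow> adj3 a b c x y"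
  "0 \<le> b x \<Longrightarrow> 0 \<le> c x \<Longrightarrow> b y \<le> 0 \<Longrightarrow> c y \<le> 0 \<Longrightarrow> adj3 a b c x y"
  "c x \<le> 0 \<Longrightarrow> a x \<le> 0 \<Longrightarrow> 0 \<le> c y \<Longrightarrow> 0 \<le> a y \<Longrightarrow> adj3 a b c x y"
  "0 \<le> c x \<Longrightarrow> 0 \<le> a x \<Longrightarrow> c y \<le> 0 \<Longrightarrow> a y \<le> 0 \<Longrightarrow> adj3 a b c x y"
  "a x = 0 \<Longrightarrow> b y = 0 \<Longrightarrow> c x * c y \<le> 0 \<Longrightarrow> adj3 a b c x y"
  "b x = 0 \<Longrightarrow> a y = 0 \<Longrightarrow> c x * c y \<le> 0 \<Longrightarrow> adj3 a b c x y"
  "b x = 0 \<Longrightarrow> c y = 0 \<Longrightarrow> a x * a y \<le> 0 \<Longrightarrow> adj3 a b c x y"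
  "c x = 0 \<Longrightarrow> b y = 0 \<Longrightarrow> a x * a y \<le> 0 \<Longrightarrow> adj3 a b c x y"
  "c x = 0 \<Longrightarrow> a y = 0 \<Longrightarrow> b x * b y \<le> 0 \<Longrightarrow> adj3 a b c x y"
  "a x = 0 \<Longrightarrow> c y = 0 \<Longrightarrow> b x * b y \<le> 0 \<Longrightarrow> adj3 a b c x y"
  unfolding adj3_def by simp_all

text \<open>The triple -b, -c, -a belongs to the directions turned by -pi/3. Iterating this
  generates a symmetry of order six, up to which the odd cycles are classified.\<close>

lemma adj3_rotate: "adj3 (\<lambda>x. - b x) (\<lambda>x. - c x) (\<lambda>x. - a x) x y \<Longrightarrow> adj3 a b c x y"
  unfolding adj3_def by auto

lemma adj3_wide:
  assumes "adj3 (proj3 \<theta> 0) (proj3 \<theta> 1) (proj3 \<theta> 2) w w'"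
  shows "wide w w'"
proof -
  have p: "perm3 0 1 2" "perm3 1 2 0" "perm3 2 0 1" "perm3 1 0 2" "perm3 2 1 0" "perm3 0 2 1"
    by (simp_all add: perm3_def)
  note o = wide_opposite_sectors[OF p(1), of \<theta>] wide_opposite_sectors[OF p(2), of \<theta>] wide_opposite_sectors[OF p(3), of \<theta>]
  note r = wide_rays[OF p(1), of \<theta>] wide_rays[OF p(2), of \<theta>] wide_rays[OF p(3), of \<theta>]
    wide_rays[OF p(4), of \<theta>] wide_rays[OF p(5), of \<theta>] wide_rays[OF p(6), of \<theta>]
  show ?thesis
    using assms unfolding adj3_def
    by (elim disjE conjE) (blast intro: o r o[of w' w, THEN wide_commute[THEN iffD1]])+
qed

section \<open>Cycles whose removal keeps the lines balanced\<close>

text \<open>The last condition says that each line still halves the points left after removing the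
  cycle, which is what \<open>finite_balanced_partition\<close> needs to pair them. The lengths are
  odd, so an odd set leaves an even remainder.\<close>

definition odd_cycle :: "('a \<Rightarrow> real) \<Rightarrow> ('a \<Rightarrow> real) \<Rightarrow> ('a \<Rightarrow> real) \<Rightarrow> 'a set \<Rightarrow> bool" where
  "odd_cycle a b c V \<longleftrightarrow> (\<exists>xs. distinct xs \<and> set xs \<subseteq> V \<and> length xs \<in> {3, 5} \<and>
     (\<forall>i<length xs. adj3 a b c (xs ! i) (xs ! (Suc i mod length xs))) \<and>
     (\<forall>f\<in>{a, b, c}. \<bar>\<Sum>x\<in>V - set xs. sgn (f x)\<bar> \<le> (\<Sum>x\<in>V - set xs. of_bool (f x = 0))))"

lemma odd_cycle_rotate:
  assumes "odd_cycle (\<lambda>x. - b x) (\<lambda>x. - c x) (\<lambda>x. - a x) V"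
  shows "odd_cycle a b c V"
proof -
  obtain xs where xs: "distinct xs" "set xs \<subseteq> V" "length xs \<in> {3, 5}"
    "\<And>i. i < length xs \<Longrightarrow> adj3 (\<lambda>x. - b x) (\<lambda>x. - c x) (\<lambda>x. - a x) (xs ! i) (xs ! (Suc i mod length xs))"
    "\<forall>f\<in>{\<lambda>x. - b x, \<lambda>x. - c x, \<lambda>x. - a x}. \<bar>\<Sum>x\<in>V - set xs. sgn (f x)\<bar> \<le> (\<Sum>x\<in>V - set xs. of_bool (f x = 0))"
    using assms unfolding odd_cycle_def by blast
  have "\<forall>f\<in>{a, b, c}. \<bar>\<Sum>x\<in>V - set xs. sgn (f x)\<bar> \<le> (\<Sum>x\<in>V - set xs. of_bool (f x = 0))"
    using xs(5) by (simp add: sgn_minus sum_negf)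
  then show ?thesis unfolding odd_cycle_def
    by (intro exI[of _ xs] conjI allI impI adj3_rotate[OF xs(4)] xs(1-3))
qed

text \<open>The points lie on alternate rays, pairwise at angle 2pi/3. Each line contains one of
  them and separates the other two, so the removal keeps the signed sum and takes one point off the
  line, using up the -1 in \<open>line\<close>.\<close>

lemma odd_cycle_3:
  assumes V: "finite V" and line: "\<forall>f\<in>{a, b, c}. \<bar>\<Sum>x\<in>V. sgn (f x)\<bar> \<le> (\<Sum>x\<in>V. of_bool (f x = 0)) - 1"
    and p: "p \<in> V" "a p = 0" "0 < b p" "c p < 0" and q: "q \<in> V" "0 < a q" "b q < 0" "c q = 0"
    and r: "r \<in> V" "a r < 0" "b r = 0" "0 < c r"
  shows "odd_cycle a b c V"
proof -
  have d: "p \<noteq> q" "p \<noteq> r" "q \<noteq> r" using p q r by auto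
  have s: "(\<Sum>x\<in>V - {p, q, r}. f x) = (\<Sum>x\<in>V. f x) - f p - f q - f r" for f :: "'a \<Rightarrow> real"
    using p q r d V by (subst sum_diff) auto
  show ?thesis
    unfolding odd_cycle_def
  proof (intro exI[of _ "[p, q, r]"] conjI)
    show "\<forall>i<length [p, q, r]. adj3 a b c ([p, q, r] ! i) ([p, q, r] ! (Suc i mod length [p, q, r]))"
    proof -
      have "adj3 a b c p q" by (rule adj3I(12)) (use p q in \<open>simp_all add: mult_le_0_iff\<close>)
      moreover have "adj3 a b c q r" by (rule adj3I(10)) (use q r in \<open>simp_all add: mult_le_0_iff\<close>)
      moreover have "adj3 a b c r p" by (rule adj3I(8)) (use p r in \<open>simp_all add: mult_le_0_iff\<close>)
      ultimately show ?thesis by (simp add: All_less_Suc)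
    qed
    show "\<forall>f\<in>{a, b, c}. \<bar>\<Sum>x\<in>V - set [p, q, r]. sgn (f x)\<bar> \<le> (\<Sum>x\<in>V - set [p, q, r]. of_bool (f x = 0))"
      using line p q r by (simp add: s)
  qed (use p q r d in auto)
qed

lemma odd_cycle_5:
  assumes V: "finite V" and d: "distinct [p1, p2, p3, p4, p5]" "set [p1, p2, p3, p4, p5] \<subseteq> V"
    and adj: "adj3 a b c p1 p2" "adj3 a b c p2 p3" "adj3 a b c p3 p4" "adj3 a b c p4 p5" "adj3 a b c p5 p1"
    and bal: "\<forall>f\<in>{a, b, c}. \<bar>(\<Sum>x\<in>V. sgn (f x)) - (sgn (f p1) + sgn (f p2) + sgn (f p3) + sgn (f p4) + sgn (f p5))\<bar> \<le>
      (\<Sum>x\<in>V. of_bool (f x = 0)) - (of_bool (f p1 = 0) + of_bool (f p2 = 0) + of_bool (f p3 = 0) + of_bool (f p4 = 0) + of_bool (f p5 = 0))"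
  shows "odd_cycle a b c V"
proof -
  have s: "(\<Sum>x\<in>V - set [p1, p2, p3, p4, p5]. f x) = (\<Sum>x\<in>V. f x) - (f p1 + f p2 + f p3 + f p4 + f p5)" for f :: "'a \<Rightarrow> real"
    using d V by (subst sum_diff) (auto simp: algebra_simps)
  show ?thesis
    unfolding odd_cycle_def
  proof (rule exI[of _ "[p1, p2, p3, p4, p5]"], intro conjI)
    show "\<forall>i<length [p1, p2, p3, p4, p5]. adj3 a b c ([p1, p2, p3, p4, p5] ! i) ([p1, p2, p3, p4, p5] ! (Suc i mod length [p1, p2, p3, p4, p5]))"
      using adj by (simp add: All_less_Suc)
    show "\<forall>f\<in>{a, b, c}. \<bar>\<Sum>x\<in>V - set [p1, p2, p3, p4, p5]. sgn (f x)\<bar> \<le> (\<Sum>x\<in>V - set [p1, p2, p3, p4, p5]. of_bool (f x = 0))"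
      using bal unfolding s .
  qed (use d in simp_all)
qed

text \<open>
  The names \<open>r0\<close>, ..., \<open>r3\<close> and \<open>s1\<close>, ..., \<open>s6\<close> count the points on the rays and in the open sectors in
  cyclic order, \<open>s1\<close> lying between \<open>r0\<close> and \<open>r1\<close>; the assumptions say that the last two rays are empty.
  The 5-cycles run through the positions \<open>r0, r2, s5, r1, s4\<close> and \<open>r2, r0, r3, r1, s5\<close>.
\<close>

lemma odd_cycle_consecutive_rays:
  assumes V: "finite V" and line: "\<forall>f\<in>{a, b, c}. \<bar>\<Sum>x\<in>V. sgn (f x)\<bar> \<le> (\<Sum>x\<in>V. of_bool (f x = 0)) - 1"
    and sum0: "\<And>x. a x + b x + c x = 0" and nz: "\<And>x. x \<in> V \<Longrightarrow> a x \<noteq> 0 \<or> b x \<noteq> 0"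
    and p: "p \<in> V" "a p = 0" "0 < b p" "c p < 0" and q: "q \<in> V" "0 < a q" "b q = 0" "c q < 0"
    and r: "r \<in> V" "0 < a r" "b r < 0" "c r = 0"
    and no4: "\<not> (\<exists>x\<in>V. a x < 0 \<and> b x = 0 \<and> 0 < c x)" and no5: "\<not> (\<exists>x\<in>V. a x < 0 \<and> 0 < b x \<and> c x = 0)"
  shows "odd_cycle a b c V"
proof -
  define n where "n Q = (\<Sum>x\<in>V. of_bool (Q x) :: real)" for Q
  define r0 where "r0 = n (\<lambda>x. a x = 0 \<and> 0 < b x \<and> c x < 0)"
  define r1 where "r1 = n (\<lambda>x. 0 < a x \<and> b x = 0 \<and> c x < 0)"
  define r2 where "r2 = n (\<lambda>x. 0 < a x \<and> b x < 0 \<and> c x = 0)"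
  define r3 where "r3 = n (\<lambda>x. a x = 0 \<and> b x < 0 \<and> 0 < c x)"
  define s1 where "s1 = n (\<lambda>x. 0 < a x \<and> 0 < b x \<and> c x < 0)"
  define s2 where "s2 = n (\<lambda>x. 0 < a x \<and> b x < 0 \<and> c x < 0)"
  define s3 where "s3 = n (\<lambda>x. 0 < a x \<and> b x < 0 \<and> 0 < c x)"
  define s4 where "s4 = n (\<lambda>x. a x < 0 \<and> b x < 0 \<and> 0 < c x)"
  define s5 where "s5 = n (\<lambda>x. a x < 0 \<and> 0 < b x \<and> 0 < c x)"
  define s6 where "s6 = n (\<lambda>x. a x < 0 \<and> 0 < b x \<and> c x < 0)"
  note defs = r0_def r1_def r2_def r3_def s1_def s2_def s3_def s4_def s5_def s6_def
  have nn: "0 \<le> n Q" for Q by (simp add: n_def sum_nonneg)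
  have pos: "1 \<le> n Q" if "v \<in> V" "Q v" for Q v
    using member_le_sum[OF that(1), of "\<lambda>x. of_bool (Q x) :: real"] V that by (simp add: n_def)
  have ex: "\<exists>x\<in>V. Q x" if "0 < n Q" for Q
  proof (rule ccontr)
    assume "\<not> ?thesis"
    then have "n Q = 0" by (simp add: n_def)
    then show False using that by simp
  qed
  have ge: "0 \<le> s1" "0 \<le> s2" "0 \<le> s3" "0 \<le> s4" "0 \<le> s5" "0 \<le> s6" "0 \<le> r3" by (simp_all add: defs nn)
  have r012: "1 \<le> r0" "1 \<le> r1" "1 \<le> r2"
    unfolding defs using pos[of p] pos[of q] pos[of r] p q r by simp_all
  have no45: "\<not> (a x < 0 \<and> b x = 0 \<and> 0 < c x)" "\<not> (a x < 0 \<and> 0 < b x \<and> c x = 0)" if "x \<in> V" for x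
    using no4 no5 that by auto
  have types: "a x = 0 \<and> 0 < b x \<and> c x < 0 \<or> 0 < a x \<and> b x = 0 \<and> c x < 0 \<or> 0 < a x \<and> b x < 0 \<and> c x = 0 \<or>
      a x = 0 \<and> b x < 0 \<and> 0 < c x \<or> 0 < a x \<and> 0 < b x \<and> c x < 0 \<or> 0 < a x \<and> b x < 0 \<and> c x < 0 \<or>
      0 < a x \<and> b x < 0 \<and> 0 < c x \<or> a x < 0 \<and> b x < 0 \<and> 0 < c x \<or> a x < 0 \<and> 0 < b x \<and> 0 < c x \<or>
      a x < 0 \<and> 0 < b x \<and> c x < 0" if "x \<in> V" for x
    using sum0[of x] nz[OF that] no45[OF that]
    by (cases "a x" "0::real" rule: linorder_cases; cases "b x" "0::real" rule: linorder_cases;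
        cases "c x" "0::real" rule: linorder_cases) simp_all
  have Da: "(\<Sum>x\<in>V. sgn (a x)) = s1 + s2 + s3 + r1 + r2 - s4 - s5 - s6"
    unfolding defs n_def sum.distrib[symmetric] sum_subtractf[symmetric]
    by (rule sum.cong[OF refl]) (drule types, elim disjE conjE, simp_all)
  have Db: "(\<Sum>x\<in>V. sgn (b x)) = s1 + s5 + s6 + r0 - s2 - s3 - s4 - r2 - r3"
    unfolding defs n_def sum.distrib[symmetric] sum_subtractf[symmetric]
    by (rule sum.cong[OF refl]) (drule types, elim disjE conjE, simp_all)
  have Dc: "(\<Sum>x\<in>V. sgn (c x)) = s3 + s4 + s5 + r3 - s1 - s2 - s6 - r0 - r1"
    unfolding defs n_def sum.distrib[symmetric] sum_subtractf[symmetric]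
    by (rule sum.cong[OF refl]) (drule types, elim disjE conjE, simp_all)
  have la: "(\<Sum>x\<in>V. of_bool (a x = 0)) = r0 + r3"
    unfolding defs n_def sum.distrib[symmetric]
    by (rule sum.cong[OF refl]) (drule types, elim disjE conjE, simp_all)
  have lb: "(\<Sum>x\<in>V. of_bool (b x = 0)) = r1"
    unfolding defs n_def
    by (rule sum.cong[OF refl]) (drule types, elim disjE conjE, simp_all)
  have lc: "(\<Sum>x\<in>V. of_bool (c x = 0)) = r2"
    unfolding defs n_def
    by (rule sum.cong[OF refl]) (drule types, elim disjE conjE, simp_all)
  have A: "\<bar>s1 + s2 + s3 + r1 + r2 - s4 - s5 - s6\<bar> \<le> r0 + r3 - 1"
    and B: "\<bar>s1 + s5 + s6 + r0 - s2 - s3 - s4 - r2 - r3\<bar> \<le> r1 - 1"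
    and C: "\<bar>s3 + s4 + s5 + r3 - s1 - s2 - s6 - r0 - r1\<bar> \<le> r2 - 1"
    using line by (simp_all add: Da Db Dc la lb lc)
  \<comment> \<open>The lower bounds in \<open>B\<close> and \<open>C\<close> add up to s5 \<ge> s2
    + 1.\<close>
  have "0 < s5" using B C ge r012 by linarith
  then obtain y5 where y5: "y5 \<in> V" "a y5 < 0" "0 < b y5" "0 < c y5" using ex unfolding s5_def by blast
  show ?thesis
  proof (cases "0 < s4")
    case True
    then obtain y4 where y4: "y4 \<in> V" "a y4 < 0" "b y4 < 0" "0 < c y4" using ex unfolding s4_def by blast
    show ?thesis
    \<comment> \<open>Each line contains one of the five points and has two of the others on either
      side, so its signed sum is unchanged.\<close>
    proof (rule odd_cycle_5[OF V, of p r y5 q y4])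
      show "distinct [p, r, y5, q, y4]" "set [p, r, y5, q, y4] \<subseteq> V" using p q r y4 y5 by auto
      show "adj3 a b c p r" by (rule adj3I(12)) (use p r in \<open>simp_all add: mult_le_0_iff\<close>)
      show "adj3 a b c r y5" by (rule adj3I(3)) (use r y5 in simp_all)
      show "adj3 a b c y5 q" by (rule adj3I(4)) (use q y5 in simp_all)
      show "adj3 a b c q y4" by (rule adj3I(2)) (use q y4 in simp_all)
      show "adj3 a b c y4 p" by (rule adj3I(1)) (use p y4 in simp_all)
      show "\<forall>f\<in>{a, b, c}. \<bar>(\<Sum>x\<in>V. sgn (f x)) - (sgn (f p) + sgn (f r) + sgn (f y5) + sgn (f q) + sgn (f y4))\<bar> \<le>
        (\<Sum>x\<in>V. of_bool (f x = 0)) - (of_bool (f p = 0) + of_bool (f r = 0) + of_bool (f y5 = 0) + of_bool (f q = 0) + of_bool (f y4 = 0))"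
        using line p q r y4 y5 by simp
    qed
  next
    case False
    then have "s4 = 0" using ge by simp
    \<comment> \<open>With s4 = 0 the upper bounds in \<open>A\<close> and \<open>B\<close> add up
      to r3 \<ge> s1 + 1. The cycle below takes two points off the line a = 0 and one more from its
      positive than from its negative side, so the balance there needs the lower bound with 3; it
      follows from the upper bound in \<open>B\<close> and r0 \<ge> 1.\<close>
    then have "0 < r3" "- (r0 + r3) + 3 \<le> s1 + s2 + s3 + r1 + r2 - s4 - s5 - s6"
      using A B C ge r012 by linarith+
    then obtain y3 where y3: "y3 \<in> V" "a y3 = 0" "b y3 < 0" "0 < c y3" using ex unfolding r3_def by blast
    show ?thesis
    proof (rule odd_cycle_5[OF V, of r p y3 q y5])
      show "distinct [r, p, y3, q, y5]" "set [r, p, y3, q, y5] \<subseteq> V" using p q r y3 y5 by auto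
      show "adj3 a b c r p" by (rule adj3I(11)) (use p r in \<open>simp_all add: mult_le_0_iff\<close>)
      show "adj3 a b c p y3" by (rule adj3I(5)) (use p y3 in simp_all)
      show "adj3 a b c y3 q" by (rule adj3I(7)) (use q y3 in \<open>simp_all add: mult_le_0_iff\<close>)
      show "adj3 a b c q y5" by (rule adj3I(3)) (use q y5 in simp_all)
      show "adj3 a b c y5 r" by (rule adj3I(4)) (use r y5 in simp_all)
      have "\<bar>(\<Sum>x\<in>V. sgn (a x)) - 1\<bar> \<le> (\<Sum>x\<in>V. of_bool (a x = 0)) - 2"
        unfolding Da la using A \<open>- (r0 + r3) + 3 \<le> _\<close> by linarith
      then show "\<forall>f\<in>{a, b, c}. \<bar>(\<Sum>x\<in>V. sgn (f x)) - (sgn (f r) + sgn (f p) + sgn (f y3) + sgn (f q) + sgn (f y5))\<bar> \<le>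
        (\<Sum>x\<in>V. of_bool (f x = 0)) - (of_bool (f r = 0) + of_bool (f p = 0) + of_bool (f y3 = 0) + of_bool (f q = 0) + of_bool (f y5 = 0))"
        using line p q r y3 y5 by simp
    qed
  qed
qed

text \<open>Occupation of one of the two open rays of the line a = 0; the other five rays arise by
  applying the rotation of \<open>adj3_rotate\<close> to the triple.\<close>

definition ray :: "('a \<Rightarrow> real) \<Rightarrow> ('a \<Rightarrow> real) \<Rightarrow> ('a \<Rightarrow> real) \<Rightarrow> 'a set \<Rightarrow> bool" where
  "ray a b c V \<longleftrightarrow> (\<exists>x\<in>V. a x = 0 \<and> 0 < b x \<and> c x < 0)"

text \<open>By \<open>line\<close> every line carries a point, so of two opposite rays at least one
  is occupied. If no alternating triple of rays is fully occupied, each of the two triples has an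
  empty ray. These two are not opposite, hence adjacent; the two rays opposite to them are occupied,
  and one ray of the remaining opposite pair extends these to three consecutive ones. Up to rotation
  this is \<open>odd_cycle_consecutive_rays\<close>.\<close>

lemma odd_cycle_exists:
  assumes V: "finite V" and line: "\<forall>f\<in>{a, b, c}. \<bar>\<Sum>x\<in>V. sgn (f x)\<bar> \<le> (\<Sum>x\<in>V. of_bool (f x = 0)) - 1"
    and sum0: "\<And>x. a x + b x + c x = 0" and nz: "\<And>x. x \<in> V \<Longrightarrow> a x \<noteq> 0 \<or> b x \<noteq> 0"
  shows "odd_cycle a b c V"
proof -
  define H where "H a b c \<longleftrightarrow> (\<forall>f\<in>{a, b, c}. \<bar>\<Sum>x\<in>V. sgn (f x)\<bar> \<le> (\<Sum>x\<in>V. of_bool (f x = 0)) - 1) \<and>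
    (\<forall>x. a x + b x + c x = 0) \<and> (\<forall>x\<in>V. a x \<noteq> 0 \<or> b x \<noteq> 0)" for a b c :: "'a \<Rightarrow> real"
  have H0: "H a b c" using assms by (simp add: H_def)
  have Hrot: "H (\<lambda>x. - b x) (\<lambda>x. - c x) (\<lambda>x. - a x)" if H: "H a b c" for a b c
  proof -
    have "- b x + - c x + - a x = 0" "b x \<noteq> 0 \<or> c x \<noteq> 0" if "x \<in> V" for x
    proof -
      have "a x + b x + c x = 0" "a x \<noteq> 0 \<or> b x \<noteq> 0" using H that by (auto simp: H_def)
      then show "- b x + - c x + - a x = 0" "b x \<noteq> 0 \<or> c x \<noteq> 0" by auto
    qed
    moreover have "- b x - c x - a x = 0" for x
    proof -
      have "a x + b x + c x = 0" using H by (simp add: H_def)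
      then show ?thesis by linarith
    qed
    ultimately show ?thesis using H by (simp add: H_def sum_negf sgn_minus)
  qed
  have cons: "odd_cycle a b c V"
    if h: "H a b c" "ray a b c V" "ray (\<lambda>x. - b x) (\<lambda>x. - c x) (\<lambda>x. - a x) V" "ray c a b V"
      "\<not> ray b c a V" "\<not> ray (\<lambda>x. - c x) (\<lambda>x. - a x) (\<lambda>x. - b x) V" for a b c
  proof -
    obtain p where p: "p \<in> V" "a p = 0" "0 < b p" "c p < 0" using h(2) by (auto simp: ray_def)
    obtain q where q: "q \<in> V" "0 < a q" "b q = 0" "c q < 0" using h(3) by (auto simp: ray_def)
    obtain r where r: "r \<in> V" "0 < a r" "b r < 0" "c r = 0" using h(4) by (auto simp: ray_def)
    show ?thesis
      by (rule odd_cycle_consecutive_rays[OF V _ _ _ p q r]) (use h in \<open>auto simp: H_def ray_def\<close>)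
  qed
  have tri: "odd_cycle a b c V" if h: "H a b c" "ray a b c V" "ray c a b V" "ray b c a V" for a b c
  proof -
    obtain p where p: "p \<in> V" "a p = 0" "0 < b p" "c p < 0" using h(2) by (auto simp: ray_def)
    obtain q where q: "q \<in> V" "0 < a q" "b q < 0" "c q = 0" using h(3) by (auto simp: ray_def)
    obtain r where r: "r \<in> V" "a r < 0" "b r = 0" "0 < c r" using h(4) by (auto simp: ray_def)
    show ?thesis
      by (rule odd_cycle_3[OF V _ p q r]) (use h in \<open>auto simp: H_def\<close>)
  qed
  have H1: "H (\<lambda>x. - b x) (\<lambda>x. - c x) (\<lambda>x. - a x)" using Hrot[OF H0] .
  have H2: "H c a b" using Hrot[OF H1] by simp
  have H3: "H (\<lambda>x. - a x) (\<lambda>x. - b x) (\<lambda>x. - c x)" using Hrot[OF H2] .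
  have H4: "H b c a" using Hrot[OF H3] by simp
  have H5: "H (\<lambda>x. - c x) (\<lambda>x. - a x) (\<lambda>x. - b x)" using Hrot[OF H4] .
  have c1: "odd_cycle a b c V" if "odd_cycle (\<lambda>x. - b x) (\<lambda>x. - c x) (\<lambda>x. - a x) V" using odd_cycle_rotate[OF that] .
  have c2: "odd_cycle a b c V" if "odd_cycle c a b V"
    by (rule c1, rule odd_cycle_rotate) (use that in simp)
  have c3: "odd_cycle a b c V" if "odd_cycle (\<lambda>x. - a x) (\<lambda>x. - b x) (\<lambda>x. - c x) V"
    by (rule c2, rule odd_cycle_rotate) (use that in simp)
  have c4: "odd_cycle a b c V" if "odd_cycle b c a V"
    by (rule c3, rule odd_cycle_rotate) (use that in simp)
  have c5: "odd_cycle a b c V" if "odd_cycle (\<lambda>x. - c x) (\<lambda>x. - a x) (\<lambda>x. - b x) V"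
    by (rule c4, rule odd_cycle_rotate) (use that in simp)
  have zero: "\<exists>x\<in>V. f x = 0" if "f \<in> {a, b, c}" for f
  proof (rule ccontr)
    assume "\<not> ?thesis"
    then have "(\<Sum>x\<in>V. of_bool (f x = 0)) = (0::real)" by simp
    moreover have "\<bar>\<Sum>x\<in>V. sgn (f x)\<bar> \<le> (\<Sum>x\<in>V. of_bool (f x = 0)) - 1" using line that by blast
    ultimately show False by simp
  qed
  let ?R0 = "ray a b c V" and ?R1 = "ray (\<lambda>x. - b x) (\<lambda>x. - c x) (\<lambda>x. - a x) V" and ?R2 = "ray c a b V"
  let ?R3 = "ray (\<lambda>x. - a x) (\<lambda>x. - b x) (\<lambda>x. - c x) V" and ?R4 = "ray b c a V"
    and ?R5 = "ray (\<lambda>x. - c x) (\<lambda>x. - a x) (\<lambda>x. - b x) V"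
  have "?R0 \<or> ?R3"
  proof -
    obtain x where "x \<in> V" "a x = 0" using zero[of a] by auto
    then show ?thesis using sum0[of x] nz[of x] by (cases "0 < b x") (auto simp: ray_def intro!: bexI[of _ x])
  qed
  moreover have "?R1 \<or> ?R4"
  proof -
    obtain x where "x \<in> V" "b x = 0" using zero[of b] by auto
    then show ?thesis using sum0[of x] nz[of x] by (cases "0 < a x") (auto simp: ray_def intro!: bexI[of _ x])
  qed
  moreover have "?R2 \<or> ?R5"
  proof -
    obtain x where "x \<in> V" "c x = 0" using zero[of c] by auto
    then show ?thesis using sum0[of x] nz[of x] by (cases "0 < a x") (auto simp: ray_def intro!: bexI[of _ x])
  qed
  ultimately consider "?R0 \<and> ?R2 \<and> ?R4" | "?R1 \<and> ?R3 \<and> ?R5"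
    | "?R0 \<and> ?R1 \<and> ?R2 \<and> \<not> ?R4 \<and> \<not> ?R5" | "?R1 \<and> ?R2 \<and> ?R3 \<and> \<not> ?R5 \<and> \<not> ?R0"
    | "?R2 \<and> ?R3 \<and> ?R4 \<and> \<not> ?R0 \<and> \<not> ?R1" | "?R3 \<and> ?R4 \<and> ?R5 \<and> \<not> ?R1 \<and> \<not> ?R2"
    | "?R4 \<and> ?R5 \<and> ?R0 \<and> \<not> ?R2 \<and> \<not> ?R3" | "?R5 \<and> ?R0 \<and> ?R1 \<and> \<not> ?R3 \<and> \<not> ?R4"
    by argo
  then show ?thesis
  proof cases
    case 1 then show ?thesis using tri[OF H0] by simp
  next
    case 2 then show ?thesis using c1 tri[OF H1] by simp
  next
    case 3 then show ?thesis using cons[OF H0] by simp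
  next
    case 4 then show ?thesis using c1 cons[OF H1] by simp
  next
    case 5 then show ?thesis using c2 cons[OF H2] by simp
  next
    case 6 then show ?thesis using c3 cons[OF H3] by simp
  next
    case 7 then show ?thesis using c4 cons[OF H4] by simp
  next
    case 8 then show ?thesis using c5 cons[OF H5] by simp
  qed
qed

section \<open>From cycles and sector partitions to maps\<close>

lemma cyclic_permutation:
  assumes "distinct xs"
  shows "\<exists>T. bij_betw T (set xs) (set xs) \<and> (\<forall>i<length xs. T (xs ! i) = xs ! (Suc i mod length xs)) \<and>
    (\<forall>x\<in>set xs. (T ^^ length xs) x = x)"
proof -
  define m where "m = length xs"
  define T where "T x = xs ! (Suc (the_inv_into {..<m} ((!) xs) x) mod m)" for x
  have inj: "inj_on ((!) xs) {..<m}" using assms by (simp add: inj_on_nth m_def)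
  have T: "T (xs ! i) = xs ! (Suc i mod m)" if "i < m" for i
    using that inj by (simp add: T_def the_inv_into_f_f)
  have Tk: "(T ^^ k) (xs ! i) = xs ! ((i + k) mod m)" if "i < m" for i k
  proof (induction k)
    case 0
    then show ?case using that by simp
  next
    case (Suc k)
    have "(i + k) mod m < m" using that by (intro mod_less_divisor) simp
    then show ?case using Suc T by (simp add: mod_Suc_eq)
  qed
  have ex: "\<exists>i<m. x = xs ! i" if "x \<in> set xs" for x using that by (auto simp: in_set_conv_nth m_def)
  have per: "(T ^^ m) x = x" if "x \<in> set xs" for x
    using ex[OF that] Tk by fastforce
  have into: "T x \<in> set xs" if "x \<in> set xs" for x
    using ex[OF that] T by (auto simp: m_def intro!: nth_mem mod_less_divisor)
  have "T ` set xs = set xs"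
  proof (intro equalityI subsetI)
    fix x assume x: "x \<in> set xs"
    then have m0: "0 < m" by (auto simp: m_def)
    have in2: "(T ^^ k) x \<in> set xs" for k using x into by (induction k) auto
    have "x = T ((T ^^ (m - 1)) x)" using per[OF x] m0 by (cases m) auto
    then show "x \<in> T ` set xs" using in2 by blast
  qed (use into in auto)
  then have "bij_betw T (set xs) (set xs)"
    by (simp add: bij_betw_def finite_surj_inj)
  then show ?thesis using T per by (auto simp: m_def)
qed

text \<open>The common interface of Lebesgue and counting measure. The domain \<open>N\<close> may
  miss a null part of the two sets, because in the Lebesgue case the exhaustion matches them only
  almost everywhere.\<close>

definition swappable :: "'a measure \<Rightarrow> bool" where
  "swappable M \<longleftrightarrow> (\<forall>A\<in>sets M. \<forall>B\<in>sets M. A \<inter> B = {} \<longrightarrow> measure M A = measure M B \<longrightarrow>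
     (\<exists>N T. paut M N T \<and> N \<subseteq> A \<union> B \<and> emeasure M (A \<union> B - N) = 0 \<and>
       (\<forall>x\<in>N. T (T x) = x \<and> (x \<in> A \<longrightarrow> T x \<in> B) \<and> (x \<in> B \<longrightarrow> T x \<in> A))))"

lemma swappable_unit_lebesgue: "swappable unit_lebesgue"
  unfolding swappable_def using swap_lebesgue by blast

lemma swappable_count_space:
  assumes V: "finite V"
  shows "swappable (count_space V)"
  unfolding swappable_def
proof (intro ballI impI)
  fix A B assume "A \<in> sets (count_space V)" "B \<in> sets (count_space V)" and dis: "A \<inter> B = {}"
    and "measure (count_space V) A = measure (count_space V) B"
  then have AB: "A \<subseteq> V" "B \<subseteq> V" "card A = card B" using V by (auto simp: measure_count_space finite_subset split: if_splits)
  then obtain f where f: "bij_betw f A B" using V finite_subset finite_same_card_bij by metis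
  define T where "T x = (if x \<in> A then f x else the_inv_into A f x)" for x
  have fA: "f x \<in> B" if "x \<in> A" for x using f that by (auto simp: bij_betw_def)
  have gB: "the_inv_into A f x \<in> A" if "x \<in> B" for x
    using f that by (metis bij_betw_def order_refl the_inv_into_into)
  have T1: "T x \<in> B" "T (T x) = x" if "x \<in> A" for x
    using that fA[OF that] dis f by (auto simp: T_def bij_betw_def the_inv_into_f_f)
  have T2: "T x \<in> A" "T (T x) = x" if "x \<in> B" for x
    using that gB[OF that] dis f by (auto simp: T_def bij_betw_def f_the_inv_into_f)
  have inj: "inj_on T (A \<union> B)" by (rule inj_on_inverseI[of _ T]) (use T1 T2 in auto)
  have "paut (count_space V) (A \<union> B) T"
  proof (rule paut_involution)
    fix S assume S: "S \<in> sets (count_space V)" "S \<subseteq> A \<union> B"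
    then have "T ` S \<subseteq> V" using T1 T2 AB by blast
    moreover have "card (T ` S) = card S" using S inj by (intro card_image) (auto intro: inj_on_subset)
    ultimately show "T ` S \<in> sets (count_space V) \<and> emeasure (count_space V) (T ` S) = emeasure (count_space V) S"
      using V S by (auto simp: emeasure_count_space finite_subset)
  qed (use AB T1 T2 in auto)
  then show "\<exists>N T. paut (count_space V) N T \<and> N \<subseteq> A \<union> B \<and> emeasure (count_space V) (A \<union> B - N) = 0 \<and>
       (\<forall>x\<in>N. T (T x) = x \<and> (x \<in> A \<longrightarrow> T x \<in> B) \<and> (x \<in> B \<longrightarrow> T x \<in> A))"
    using T1 T2 dis by (intro exI[of _ "A \<union> B"] exI[of _ T]) auto
qed

text \<open>The exchanges of the three pairs and the identity on \<open>X\<close> have disjoint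
  domains; padded with empty sets they form a family to which \<open>paut_UN\<close>
  applies.\<close>

lemma sector_partition_paut:
  assumes sp: "sector_partition M a X Yp Ym" and sw: "swappable M"
  shows "\<exists>N T. paut M N T \<and> emeasure M (space M - N) = 0 \<and> X \<subseteq> N \<and> (\<forall>x\<in>N. T (T x) = x \<and> (x \<in> X \<longrightarrow> T x = x) \<and>
    (\<forall>k<3. (x \<in> Yp k \<longrightarrow> T x \<in> Ym k) \<and> (x \<in> Ym k \<longrightarrow> T x \<in> Yp k)))"
proof -
  have Xm: "X \<in> sets M" and Ym: "\<And>k. k < 3 \<Longrightarrow> Yp k \<in> sets M" "\<And>k. k < 3 \<Longrightarrow> Ym k \<in> sets M"
    and cov: "X \<union> (\<Union>k<3. Yp k \<union> Ym k) = space M"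
    and XY: "\<And>k. k < 3 \<Longrightarrow> X \<inter> (Yp k \<union> Ym k) = {}" and YY: "\<And>k. k < 3 \<Longrightarrow> Yp k \<inter> Ym k = {}"
    and Yd: "\<And>k l. k < 3 \<Longrightarrow> l < 3 \<Longrightarrow> k \<noteq> l \<Longrightarrow> (Yp k \<union> Ym k) \<inter> (Yp l \<union> Ym l) = {}"
    and Ye: "\<And>k. k < 3 \<Longrightarrow> measure M (Yp k) = measure M (Ym k)"
    using sp by (simp_all add: sector_partition_def)
  have "\<exists>N T. paut M N T \<and> N \<subseteq> Yp k \<union> Ym k \<and> emeasure M (Yp k \<union> Ym k - N) = 0 \<and>
       (\<forall>x\<in>N. T (T x) = x \<and> (x \<in> Yp k \<longrightarrow> T x \<in> Ym k) \<and> (x \<in> Ym k \<longrightarrow> T x \<in> Yp k))" if "k < 3" for k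
    using sw[unfolded swappable_def, rule_format, OF Ym(1)[OF that] Ym(2)[OF that] YY[OF that] Ye[OF that]] .
  then obtain N0 T0 where NT: "\<And>k. k < 3 \<Longrightarrow> paut M (N0 k) (T0 k) \<and> N0 k \<subseteq> Yp k \<union> Ym k \<and> emeasure M (Yp k \<union> Ym k - N0 k) = 0 \<and>
       (\<forall>x\<in>N0 k. T0 k (T0 k x) = x \<and> (x \<in> Yp k \<longrightarrow> T0 k x \<in> Ym k) \<and> (x \<in> Ym k \<longrightarrow> T0 k x \<in> Yp k))"
    by metis
  define N where "N k = (if k < 3 then N0 k else if k = 3 then X else {})" for k :: nat
  define S where "S k = (if k < 3 then T0 k else id)" for k :: nat
  have XN: "X \<inter> N0 k = {}" if "k < 3" for k using NT[OF that] XY[OF that] by blast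
  have NN: "N0 k \<inter> N0 l = {}" if "k < 3" "l < 3" "k \<noteq> l" for k l
    using Yd[OF that] NT[OF that(1)] NT[OF that(2)] by blast
  have dis: "disjoint_family N"
    unfolding disjoint_family_on_def N_def using XN NN by auto
  have pid: "paut M Z id" if "Z \<in> sets M" for Z
    using that by (auto simp: paut_def Int_absorb2)
  have pa: "paut M (N k) (S k)" for k
    using NT[of k] pid[OF Xm] pid[of "{}"] by (auto simp: N_def S_def)
  define T where "T x = S (THE k. x \<in> N k) x" for x
  have T: "T x = S k x" if "x \<in> N k" for k x
  proof -
    have "(THE k. x \<in> N k) = k" using that dis by (intro the_equality) (auto simp: disjoint_family_on_def)
    then show ?thesis by (simp add: T_def)
  qed
  have pT: "paut M (\<Union>k. N k) T" by (rule paut_UN[OF pa dis T])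
  have UN: "(\<Union>k. N k) = N0 0 \<union> N0 1 \<union> N0 2 \<union> X"
  proof (intro equalityI subsetI)
    fix x assume "x \<in> (\<Union>k. N k)"
    then show "x \<in> N0 0 \<union> N0 1 \<union> N0 2 \<union> X" by (auto simp: N_def split: if_splits dest: less_3_cases)
  next
    fix x assume "x \<in> N0 0 \<union> N0 1 \<union> N0 2 \<union> X"
    then have "x \<in> N 0 \<union> N 1 \<union> N 2 \<union> N 3" by (simp add: N_def)
    then show "x \<in> (\<Union>k. N k)" by blast
  qed
  have Nm: "N0 k \<in> sets M" if "k < 3" for k using NT[OF that] by (simp add: paut_def)
  have null: "emeasure M (space M - (\<Union>k. N k)) = 0"
  proof -
    have nk: "Yp k \<union> Ym k - N0 k \<in> null_sets M" if "k < 3" for k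
      using NT[OF that] Nm[OF that] Ym[OF that] by (auto simp: null_sets_def)
    have "(\<Union>k\<in>{..<3::nat}. Yp k \<union> Ym k - N0 k) \<in> null_sets M"
      using nk by (intro null_sets_UN') auto
    moreover have "space M - (\<Union>k. N k) \<subseteq> (\<Union>k\<in>{..<3::nat}. Yp k \<union> Ym k - N0 k)"
    proof
      fix x assume x: "x \<in> space M - (\<Union>k. N k)"
      then have "x \<notin> N 3" by blast
      then have "x \<notin> X" by (simp add: N_def)
      then obtain k where k: "k < 3" "x \<in> Yp k \<union> Ym k" using cov x by blast
      moreover have "x \<notin> N k" using x by blast
      ultimately show "x \<in> (\<Union>k\<in>{..<3::nat}. Yp k \<union> Ym k - N0 k)" by (auto simp: N_def)
    qed
    moreover have "space M - (\<Union>k. N k) \<in> sets M" using pT by (auto simp: paut_def)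
    ultimately show ?thesis by (metis null_sets_subset null_setsD1)
  qed
  have swaps: "T (T x) = x \<and> (x \<in> X \<longrightarrow> T x = x) \<and>
    (\<forall>k<3. (x \<in> Yp k \<longrightarrow> T x \<in> Ym k) \<and> (x \<in> Ym k \<longrightarrow> T x \<in> Yp k))" if mem: "x \<in> (\<Union>k. N k)" for x
  proof -
    obtain k where k: "x \<in> N k" using mem by blast
    then consider "k < 3" "x \<in> N0 k" | "k = 3" "x \<in> X" by (auto simp: N_def split: if_splits)
    then show ?thesis
    proof cases
      case 1
      have Tx: "T x = T0 k x" using T[OF k] 1 by (simp add: S_def)
      have "T0 k x \<in> N0 k" using NT[OF 1(1)] 1 by (auto simp: paut_def bij_betw_def)
      then have "T0 k x \<in> N k" using 1 by (simp add: N_def)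
      then have "T (T x) = x" using T[of "T0 k x" k] Tx NT[OF 1(1)] 1 by (simp add: S_def)
      moreover have "x \<notin> X" using XN[OF 1(1)] 1 by blast
      moreover have "(x \<in> Yp l \<longrightarrow> T x \<in> Ym l) \<and> (x \<in> Ym l \<longrightarrow> T x \<in> Yp l)" if "l < 3" for l
      proof (cases "l = k")
        case True
        then show ?thesis using NT[OF 1(1)] 1 Tx by auto
      next
        case False
        then show ?thesis using Yd[OF 1(1) that] NT[OF 1(1)] 1 by blast
      qed
      ultimately show ?thesis by blast
    next
      case 2
      have "x \<notin> Yp l" "x \<notin> Ym l" if "l < 3" for l using XY[OF that] 2 by blast+
      then show ?thesis using T[OF k] 2 by (auto simp: S_def)
    qed
  qed
  show ?thesis using pT null swaps UN by (intro exI[of _ "\<Union>k. N k"] exI[of _ T]) blast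
qed

section \<open>Pairings and permutations from halving lines\<close>

text \<open>Of three numbers with sum 0 either none, exactly one or all vanish. If none does, one
  sign differs from the other two; if exactly one does, the other signs cancel. Integrated, these
  identities express the sums over the three lines by the alternating triples of sectors.\<close>

lemma sign_identities:
  fixes a b c :: real
  assumes "a + b + c = 0"
  shows "(of_bool (0 < a) - of_bool (a < 0)) + (of_bool (0 < b) - of_bool (b < 0)) + (of_bool (0 < c) - of_bool (c < 0))
      = (of_bool (a * b * c < 0) - of_bool (0 < a * b * c) :: real)"
    and "of_bool (a = 0) + of_bool (b = 0) + of_bool (c = 0) - 2 * of_bool (a = 0 \<and> b = 0 \<and> c = 0)
      = (of_bool (a * b * c = 0) :: real)"
  using assms
  by (cases a "0::real" rule: linorder_cases; cases b "0::real" rule: linorder_cases;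
      cases c "0::real" rule: linorder_cases; simp add: mult_less_0_iff zero_less_mult_iff; fail)+

context finite_measure
begin

lemma measure_eq_integral:
  assumes [measurable]: "Measurable.pred M Q"
  shows "measure M {x \<in> space M. Q x} = (\<integral>x. of_bool (Q x) \<partial>M)" "integrable M (\<lambda>x. of_bool (Q x) :: real)"
proof -
  have "(\<integral>x. of_bool (Q x) \<partial>M) = (\<integral>x. indicator {x \<in> space M. Q x} x \<partial>M :: real)"
    by (intro Bochner_Integration.integral_cong) (auto simp: indicator_def)
  then show "measure M {x \<in> space M. Q x} = (\<integral>x. of_bool (Q x) \<partial>M)" by simp
  show "integrable M (\<lambda>x. of_bool (Q x) :: real)"
    by (rule integrable_const_bound[where B=1]) auto
qed

text \<open>The two half bounds for a function f say that the masses of f > 0 and f < 0 differ by at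
  most the mass of f = 0. For the product of the three \<open>a j\<close>, combined with the
  integrated \<open>sign_identities\<close>, this is the bound on the sum over the lines required by
  \<open>sector_partition_exists\<close>.\<close>

lemma sector_partition_halves:
  fixes a :: "nat \<Rightarrow> 'a \<Rightarrow> real" and Q :: "real set"
  assumes a_meas [measurable]: "\<And>j. a j \<in> borel_measurable M"
    and a_sum: "\<And>x. a 0 x + a 1 x + a 2 x = 0"
    and Q0: "0 \<in> Q" and Qd: "\<And>x y. x \<in> Q \<Longrightarrow> y \<in> Q \<Longrightarrow> x - y \<in> Q"
    and Qm: "\<And>A. A \<in> sets M \<Longrightarrow> measure M A \<in> Q"
    and half: "measure M (space M) / 2 \<in> Q"
    and split: "\<And>A x. A \<in> sets M \<Longrightarrow> x \<in> Q \<Longrightarrow> 0 \<le> x \<Longrightarrow> x \<le> measure M A \<Longrightarrow>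
                  \<exists>B\<in>sets M. B \<subseteq> A \<and> measure M B = x"
    and le: "\<And>j. j < 3 \<Longrightarrow> 2 * measure M {x \<in> space M. 0 < a j x} \<le> measure M (space M)"
      "\<And>j. j < 3 \<Longrightarrow> 2 * measure M {x \<in> space M. a j x < 0} \<le> measure M (space M)"
      "2 * measure M {x \<in> space M. a 0 x * a 1 x * a 2 x < 0} \<le> measure M (space M)"
      "2 * measure M {x \<in> space M. 0 < a 0 x * a 1 x * a 2 x} \<le> measure M (space M)"
  shows "\<exists>X Yp Ym. sector_partition M a X Yp Ym"
proof (rule sector_partition_exists[OF a_meas a_sum Q0 Qd Qm half split])
  have tri: "measure M (space M) = measure M {x \<in> space M. 0 < f x} + measure M {x \<in> space M. f x < 0} + measure M {x \<in> space M. f x = 0}"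
    if [measurable]: "f \<in> borel_measurable M" for f :: "'a \<Rightarrow> real"
  proof -
    have "space M = {x \<in> space M. 0 < f x} \<union> ({x \<in> space M. f x < 0} \<union> {x \<in> space M. f x = 0})" by auto
    then have "measure M (space M) = measure M ({x \<in> space M. 0 < f x} \<union> ({x \<in> space M. f x < 0} \<union> {x \<in> space M. f x = 0}))" by simp
    also have "\<dots> = measure M {x \<in> space M. 0 < f x} + (measure M {x \<in> space M. f x < 0} + measure M {x \<in> space M. f x = 0})"
      by (subst finite_measure_Union; (subst finite_measure_Union)?) auto
    finally show ?thesis by simp
  qed
  show "\<bar>measure M {x \<in> space M. 0 < a j x} - measure M {x \<in> space M. a j x < 0}\<bar>
                  \<le> measure M {x \<in> space M. a j x = 0}" if "j < 3" for j
    using le(1,2)[OF that] tri[of "a j"] by (simp add: abs_le_iff)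
  have s3: "(\<Sum>j<3. f j) = f 0 + f 1 + f (2::nat)" for f :: "nat \<Rightarrow> real"
    by (simp add: numeral_3_eq_3 numeral_2_eq_2)
  have "(\<Sum>j<3. measure M {x \<in> space M. 0 < a j x} - measure M {x \<in> space M. a j x < 0})
      = (\<integral>x. (of_bool (0 < a 0 x) - of_bool (a 0 x < 0)) + (of_bool (0 < a 1 x) - of_bool (a 1 x < 0)) + (of_bool (0 < a 2 x) - of_bool (a 2 x < 0)) \<partial>M)"
    unfolding s3 by (simp add: measure_eq_integral)
  also have "\<dots> = (\<integral>x. of_bool (a 0 x * a 1 x * a 2 x < 0) - of_bool (0 < a 0 x * a 1 x * a 2 x) \<partial>M)"
    by (simp only: sign_identities(1)[OF a_sum])
  also have "\<dots> = measure M {x \<in> space M. a 0 x * a 1 x * a 2 x < 0} - measure M {x \<in> space M. 0 < a 0 x * a 1 x * a 2 x}"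
    by (simp add: measure_eq_integral)
  finally have D: "(\<Sum>j<3. measure M {x \<in> space M. 0 < a j x} - measure M {x \<in> space M. a j x < 0}) = \<dots>" .
  have "(\<Sum>j<3. measure M {x \<in> space M. a j x = 0}) - 2 * measure M {x \<in> space M. \<forall>j<3. a j x = 0}
      = (\<integral>x. of_bool (a 0 x = 0) + of_bool (a 1 x = 0) + of_bool (a 2 x = 0) - 2 * of_bool (a 0 x = 0 \<and> a 1 x = 0 \<and> a 2 x = 0) \<partial>M)"
    unfolding s3 all_less_3 by (simp add: measure_eq_integral)
  also have "\<dots> = (\<integral>x. of_bool (a 0 x * a 1 x * a 2 x = 0) \<partial>M)"
    by (simp only: sign_identities(2)[OF a_sum])
  also have "\<dots> = measure M {x \<in> space M. a 0 x * a 1 x * a 2 x = 0}"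
    by (subst measure_eq_integral) auto
  finally have Z: "(\<Sum>j<3. measure M {x \<in> space M. a j x = 0}) - 2 * measure M {x \<in> space M. \<forall>j<3. a j x = 0} = \<dots>" .
  show "\<bar>(\<Sum>j<3. measure M {x \<in> space M. 0 < a j x} - measure M {x \<in> space M. a j x < 0})\<bar>
                  \<le> (\<Sum>j<3. measure M {x \<in> space M. a j x = 0}) - 2 * measure M {x \<in> space M. \<forall>j<3. a j x = 0}"
    unfolding D Z using le(3,4) tri[of "\<lambda>x. a 0 x * a 1 x * a 2 x"] by (simp add: abs_le_iff)
qed

end

lemma swap_adj3:
  assumes sp: "sector_partition M a X Yp Ym" and x: "x \<in> space M"
    and T: "x \<in> X \<longrightarrow> T x = x" "\<forall>k<3. (x \<in> Yp k \<longrightarrow> T x \<in> Ym k) \<and> (x \<in> Ym k \<longrightarrow> T x \<in> Yp k)"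
  shows "adj3 (a 0) (a 1) (a 2) x (T x)"
proof -
  have X: "a j v = 0" if "j < 3" "v \<in> X" for j v using sp that by (simp add: sector_partition_def)
  have P: "a j v \<le> 0" if "k < 3" "j < 3" "j \<noteq> k" "v \<in> Yp k" for j k v using sp that by (simp add: sector_partition_def)
  have N: "0 \<le> a j v" if "k < 3" "j < 3" "j \<noteq> k" "v \<in> Ym k" for j k v using sp that by (simp add: sector_partition_def)
  have "x \<in> X \<union> (\<Union>k<3. Yp k \<union> Ym k)" using sp x by (simp add: sector_partition_def)
  then consider "x \<in> X" | k where "k < 3" "x \<in> Yp k" "T x \<in> Ym k" | k where "k < 3" "x \<in> Ym k" "T x \<in> Yp k"
    using T by blast
  then show ?thesis
  proof cases
    case 1
    then show ?thesis using X[of 0 x] X[of 1 x] T by (intro adj3I(1)) auto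
  next
    case 2
    then consider "k = 0" | "k = 1" | "k = 2" by linarith
    then show ?thesis
    proof cases
      case 1 then show ?thesis using P[of 0 1 x] P[of 0 2 x] N[of 0 1 "T x"] N[of 0 2 "T x"] 2 by (intro adj3I(3)) auto
    next
      case c: 2 then show ?thesis using P[of 1 2 x] P[of 1 0 x] N[of 1 2 "T x"] N[of 1 0 "T x"] 2 by (intro adj3I(5)) auto
    next
      case 3 then show ?thesis using P[of 2 0 x] P[of 2 1 x] N[of 2 0 "T x"] N[of 2 1 "T x"] 2 by (intro adj3I(1)) auto
    qed
  next
    case 3
    then consider "k = 0" | "k = 1" | "k = 2" by linarith
    then show ?thesis
    proof cases
      case 1 then show ?thesis using N[of 0 1 x] N[of 0 2 x] P[of 0 1 "T x"] P[of 0 2 "T x"] 3 by (intro adj3I(4)) auto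
    next
      case 2 then show ?thesis using N[of 1 2 x] N[of 1 0 x] P[of 1 2 "T x"] P[of 1 0 "T x"] 3 by (intro adj3I(6)) auto
    next
      case c: 3 then show ?thesis using N[of 2 0 x] N[of 2 1 x] P[of 2 0 "T x"] P[of 2 1 "T x"] 3 by (intro adj3I(2)) auto
    qed
  qed
qed

section \<open>Permutations of finitely many points\<close>

lemma count_space_split:
  assumes "finite V" "A \<in> sets (count_space V)" "x \<in> \<int>" "0 \<le> x" "x \<le> measure (count_space V) A"
  shows "\<exists>B\<in>sets (count_space V). B \<subseteq> A \<and> measure (count_space V) B = x"
proof -
  have A: "A \<subseteq> V" "finite A" using assms finite_subset by auto
  obtain n where n: "x = real n" using assms(3,4) by (metis Ints_cases of_nat_0_le_iff of_int_0_le_iff nonneg_int_cases of_int_of_nat_eq)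
  have "n \<le> card A" using assms(5) n A assms(1) by (simp add: measure_count_space)
  then obtain B where "B \<subseteq> A" "card B = n" using obtain_subset_with_card_n by metis
  then show ?thesis using n A assms(1) by (intro bexI[of _ B]) (auto simp: measure_count_space finite_subset)
qed

lemma finite_pairing:
  fixes a :: "nat \<Rightarrow> 'a \<Rightarrow> real"
  assumes V: "finite V" and sp: "\<exists>X Yp Ym. sector_partition (count_space V) a X Yp Ym"
  obtains X Yp Ym T where "sector_partition (count_space V) a X Yp Ym" "bij_betw T V V" "\<And>x. x \<in> V \<Longrightarrow> T (T x) = x"
    "\<And>x. x \<in> X \<Longrightarrow> T x = x" "\<And>x. x \<in> V \<Longrightarrow> adj3 (a 0) (a 1) (a 2) x (T x)"
proof -
  let ?C = "count_space V"
  obtain X Yp Ym where spp: "sector_partition ?C a X Yp Ym" using sp by blast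
  obtain N T where NT: "paut ?C N T" "emeasure ?C (space ?C - N) = 0"
    "\<forall>x\<in>N. T (T x) = x \<and> (x \<in> X \<longrightarrow> T x = x) \<and>
    (\<forall>k<3. (x \<in> Yp k \<longrightarrow> T x \<in> Ym k) \<and> (x \<in> Ym k \<longrightarrow> T x \<in> Yp k))"
    using sector_partition_paut[OF spp swappable_count_space[OF V]] by blast
  have "N \<subseteq> V" using NT(1) by (simp add: paut_def)
  \<comment> \<open>Counting measure has no nonempty null set, so the exchange is defined on all of
    \<open>V\<close>.\<close>
  moreover have "V - N = {}" using NT(2) V by (simp add: emeasure_count_space)
  ultimately have NV: "N = V" by auto
  have XV: "X \<subseteq> V" using spp by (simp add: sector_partition_def)
  show thesis
  proof (rule that[OF spp])
    show "bij_betw T V V" using NT(1) by (simp add: paut_def NV)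
    show "T (T x) = x" if "x \<in> V" for x using NT(3) that NV by blast
    show "T x = x" if "x \<in> X" for x using NT(3) that NV XV by blast
    show "adj3 (a 0) (a 1) (a 2) x (T x)" if "x \<in> V" for x
      by (rule swap_adj3[OF spp]) (use NT(3) that NV in auto)
  qed
qed

lemma finite_even_partition:
  fixes a :: "nat \<Rightarrow> 'a \<Rightarrow> real"
  assumes V: "finite V" "even (card V)" and a_sum: "\<And>x. a 0 x + a 1 x + a 2 x = 0"
    and le: "\<And>j. j < 3 \<Longrightarrow> 2 * card {x \<in> V. 0 < a j x} \<le> card V"
      "\<And>j. j < 3 \<Longrightarrow> 2 * card {x \<in> V. a j x < 0} \<le> card V"
      "2 * card {x \<in> V. a 0 x * a 1 x * a 2 x < 0} \<le> card V"
      "2 * card {x \<in> V. 0 < a 0 x * a 1 x * a 2 x} \<le> card V"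
  shows "\<exists>X Yp Ym. sector_partition (count_space V) a X Yp Ym"
proof -
  let ?C = "count_space V"
  interpret finite_measure "count_space V" using V(1) by (rule finite_measure_count_space)
  have m: "measure ?C A = real (card A)" if "A \<subseteq> V" for A
    using that V by (simp add: measure_count_space finite_subset)
  have half: "real (card V) / 2 \<in> \<int>"
  proof -
    obtain k where "card V = 2 * k" using V by blast
    then show ?thesis by simp
  qed
  show ?thesis
  proof (rule sector_partition_halves[where Q="\<int>"])
    show "measure ?C A \<in> \<int>" if "A \<in> sets ?C" for A using that m by simp
    show "measure ?C (space ?C) / 2 \<in> \<int>" using half m[of V] by simp
    show "\<exists>B\<in>sets ?C. B \<subseteq> A \<and> measure ?C B = x"
      if "A \<in> sets ?C" "x \<in> \<int>" "0 \<le> x" "x \<le> measure ?C A" for A x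
      using count_space_split[OF V(1) that] .
    have r: "2 * measure ?C {x \<in> space ?C. Q x} \<le> measure ?C (space ?C)"
      if "2 * card {x \<in> V. Q x} \<le> card V" for Q
      using that by (subst m, simp)+ simp
    show "2 * measure ?C {x \<in> space ?C. 0 < a j x} \<le> measure ?C (space ?C)"
      "2 * measure ?C {x \<in> space ?C. a j x < 0} \<le> measure ?C (space ?C)" if "j < 3" for j
      by (rule r, rule le(1)[OF that]) (rule r, rule le(2)[OF that])
    show "2 * measure ?C {x \<in> space ?C. a 0 x * a 1 x * a 2 x < 0} \<le> measure ?C (space ?C)"
      "2 * measure ?C {x \<in> space ?C. 0 < a 0 x * a 1 x * a 2 x} \<le> measure ?C (space ?C)"
      by (rule r, rule le(3)) (rule r, rule le(4))
  qed (use a_sum in auto)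
qed

text \<open>Without central points the bound for the sum over the three lines follows from the line
  bounds by the triangle inequality. This is needed after the removal of an odd cycle, when only the
  balance of the lines is known.\<close>

lemma finite_balanced_partition:
  fixes a :: "nat \<Rightarrow> 'a \<Rightarrow> real"
  assumes V: "finite V" "even (card V)" and a_sum: "\<And>x. a 0 x + a 1 x + a 2 x = 0"
    and nz: "\<And>x. x \<in> V \<Longrightarrow> a 0 x \<noteq> 0 \<or> a 1 x \<noteq> 0"
    and le: "\<And>j. j < 3 \<Longrightarrow> \<bar>\<Sum>x\<in>V. sgn (a j x)\<bar> \<le> (\<Sum>x\<in>V. of_bool (a j x = 0))"
  shows "\<exists>X Yp Ym. sector_partition (count_space V) a X Yp Ym"
proof -
  let ?C = "count_space V"
  interpret finite_measure "count_space V" using V(1) by (rule finite_measure_count_space)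
  have m: "measure ?C A = real (card A)" if "A \<subseteq> V" for A
    using that V by (simp add: measure_count_space finite_subset)
  have half: "real (card V) / 2 \<in> \<int>"
  proof -
    obtain k where "card V = 2 * k" using V by blast
    then show ?thesis by simp
  qed
  have cs: "measure ?C {x \<in> space ?C. Q x} = (\<Sum>x\<in>V. of_bool (Q x))" for Q
    using V by (subst m) (auto simp: of_bool_def sum.If_cases Int_def)
  have D: "measure ?C {x \<in> space ?C. 0 < a j x} - measure ?C {x \<in> space ?C. a j x < 0} = (\<Sum>x\<in>V. sgn (a j x))" for j
    unfolding cs sum_subtractf[symmetric] by (intro sum.cong) (auto simp: sgn_if)
  show ?thesis
  proof (rule sector_partition_exists[where Q="\<int>"])
    show "measure ?C A \<in> \<int>" if "A \<in> sets ?C" for A using that m by simp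
    show "measure ?C (space ?C) / 2 \<in> \<int>" using half m[of V] by simp
    show "\<exists>B\<in>sets ?C. B \<subseteq> A \<and> measure ?C B = x"
      if "A \<in> sets ?C" "x \<in> \<int>" "0 \<le> x" "x \<le> measure ?C A" for A x
      using count_space_split[OF V(1) that] .
    show "\<bar>measure ?C {x \<in> space ?C. 0 < a j x} - measure ?C {x \<in> space ?C. a j x < 0}\<bar>
      \<le> measure ?C {x \<in> space ?C. a j x = 0}" if "j < 3" for j
      unfolding D unfolding cs using le[OF that] .
    have "{x \<in> space ?C. \<forall>j<3. a j x = 0} = {}" using nz by (auto simp: all_less_3)
    moreover have "\<bar>\<Sum>j<3. \<Sum>x\<in>V. sgn (a j x)\<bar> \<le> (\<Sum>j<3. \<Sum>x\<in>V. of_bool (a j x = 0))"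
      by (rule order_trans[OF sum_abs], rule sum_mono, rule le) simp
    ultimately show "\<bar>\<Sum>j<3. measure ?C {x \<in> space ?C. 0 < a j x} - measure ?C {x \<in> space ?C. a j x < 0}\<bar>
      \<le> (\<Sum>j<3. measure ?C {x \<in> space ?C. a j x = 0}) - 2 * measure ?C {x \<in> space ?C. \<forall>j<3. a j x = 0}"
      unfolding D by (simp only: measure_empty) (simp only: cs)
  qed (use a_sum in auto)
qed

lemma glue_bij:
  assumes "bij_betw T A A" "bij_betw S B B" "A \<inter> B = {}"
  shows "bij_betw (\<lambda>x. if x \<in> A then T x else S x) (A \<union> B) (A \<union> B)"
    and "x \<in> A \<Longrightarrow> ((\<lambda>x. if x \<in> A then T x else S x) ^^ n) x = (T ^^ n) x"
    and "x \<in> B \<Longrightarrow> ((\<lambda>x. if x \<in> A then T x else S x) ^^ n) x = (S ^^ n) x"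
proof -
  let ?U = "\<lambda>x. if x \<in> A then T x else S x"
  have TA: "T x \<in> A" if "x \<in> A" for x using assms(1) that by (auto simp: bij_betw_def)
  have SB: "S x \<in> B" if "x \<in> B" for x using assms(2) that by (auto simp: bij_betw_def)
  have "bij_betw ?U A A" using assms(1) by (subst bij_betw_cong[of A _ T]) auto
  moreover have "bij_betw ?U B B" using assms(2,3) by (subst bij_betw_cong[of B _ S]) auto
  ultimately show "bij_betw ?U (A \<union> B) (A \<union> B)" using assms(3) by (rule bij_betw_combine)
  show "(?U ^^ n) x = (T ^^ n) x" if "x \<in> A"
  proof -
    have "(T ^^ n) x \<in> A \<and> (?U ^^ n) x = (T ^^ n) x" by (induction n) (auto simp: that TA)
    then show ?thesis by blast
  qed
  show "(?U ^^ n) x = (S ^^ n) x" if "x \<in> B"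
  proof -
    have "(S ^^ n) x \<in> B \<and> (?U ^^ n) x = (S ^^ n) x"
    proof (induction n)
      case (Suc n)
      then have "(S ^^ n) x \<notin> A" using assms(3) by auto
      with Suc show ?case by (simp add: SB)
    qed (simp add: that)
    then show ?thesis by blast
  qed
qed

text \<open>An involution of an odd set has a fixed point, and only a point where all
  \<open>a j\<close> vanish may be fixed. If there is one, the rest is paired; otherwise an odd
  cycle is split off first.\<close>

lemma finite_odd_permutation:
  fixes a :: "nat \<Rightarrow> 'a \<Rightarrow> real"
  assumes V: "finite V" "odd (card V)" and a_sum: "\<And>x. a 0 x + a 1 x + a 2 x = 0"
    and le: "\<And>j. j < 3 \<Longrightarrow> 2 * card {x \<in> V. 0 < a j x} \<le> card V"
      "\<And>j. j < 3 \<Longrightarrow> 2 * card {x \<in> V. a j x < 0} \<le> card V"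
      "2 * card {x \<in> V. a 0 x * a 1 x * a 2 x < 0} \<le> card V"
      "2 * card {x \<in> V. 0 < a 0 x * a 1 x * a 2 x} \<le> card V"
  shows "\<exists>T X1 X2 X3 X5. bij_betw T V V \<and> (\<forall>x\<in>V. adj3 (a 0) (a 1) (a 2) x (T x)) \<and>
    X1 \<inter> X2 = {} \<and> X1 \<inter> X3 = {} \<and> X1 \<inter> X5 = {} \<and> X2 \<inter> X3 = {} \<and> X2 \<inter> X5 = {} \<and> X3 \<inter> X5 = {} \<and>
    X1 \<union> X2 \<union> X3 \<union> X5 = V \<and> (\<forall>x\<in>X1. T x = x) \<and> (\<forall>x\<in>X2. (T ^^ 2) x = x) \<and>
    (\<forall>x\<in>X3. (T ^^ 3) x = x) \<and> (\<forall>x\<in>X5. (T ^^ 5) x = x)"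
proof (cases "\<exists>p\<in>V. a 0 p = 0 \<and> a 1 p = 0")
  case True
  then obtain p where p: "p \<in> V" "a 0 p = 0" "a 1 p = 0" by blast
  then have p2: "a 2 p = 0" using a_sum[of p] by simp
  have c: "card (V - {p}) = card V - 1" using p V by simp
  \<comment> \<open>Twice a cardinality is even, so being at most the odd \<open>card V\<close> it
    is at most \<open>card V - 1\<close>.\<close>
  have red: "2 * card {x \<in> V - {p}. Q x} \<le> card (V - {p})" if "2 * card {x \<in> V. Q x} \<le> card V" for Q
  proof -
    have "card {x \<in> V - {p}. Q x} \<le> card {x \<in> V. Q x}" using V by (intro card_mono) auto
    moreover have "2 * card {x \<in> V. Q x} \<noteq> card V" using V(2) by (metis dvd_triv_left)
    ultimately show ?thesis using that unfolding c by linarith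
  qed
  have "\<exists>X Yp Ym. sector_partition (count_space (V - {p})) a X Yp Ym"
    by (rule finite_even_partition) (use V a_sum red le c in auto)
  then obtain X Yp Ym T where T: "bij_betw T (V - {p}) (V - {p})" "\<And>x. x \<in> V - {p} \<Longrightarrow> T (T x) = x"
    "\<And>x. x \<in> V - {p} \<Longrightarrow> adj3 (a 0) (a 1) (a 2) x (T x)"
    using finite_pairing[of "V - {p}" a] V by (metis finite_Diff)
  let ?U = "\<lambda>x. if x \<in> V - {p} then T x else id x"
  have b: "bij_betw ?U (V - {p} \<union> {p}) (V - {p} \<union> {p})" by (rule glue_bij(1)) (use T in auto)
  have it: "(?U ^^ n) x = (T ^^ n) x" if "x \<in> V - {p}" for n x
    by (rule glue_bij(2)[of T "V - {p}" id "{p}"]) (use T that in auto)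
  have Vp: "V - {p} \<union> {p} = V" using p by auto
  have "adj3 (a 0) (a 1) (a 2) p p" using p by (intro adj3I(1)) auto
  then have "\<forall>x\<in>V. adj3 (a 0) (a 1) (a 2) x (?U x)" using T(3) by auto
  moreover have "\<forall>x\<in>V - {p}. (?U ^^ 2) x = x"
    using it[of _ 2] T(2) by (simp add: numeral_2_eq_2)
  moreover note b[unfolded Vp]
  ultimately have "bij_betw ?U V V \<and> (\<forall>x\<in>V. adj3 (a 0) (a 1) (a 2) x (?U x)) \<and> (\<forall>x\<in>V - {p}. (?U ^^ 2) x = x)" by blast
  note U = this
  show ?thesis
    by (rule exI[of _ ?U], rule exI[of _ "{p}"], rule exI[of _ "V - {p}"], rule exI[of _ "{}"], rule exI[of _ "{}"])
      (use U p in auto)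
next
  case False
  then have nz: "a 0 x \<noteq> 0 \<or> a 1 x \<noteq> 0" if "x \<in> V" for x using that by blast
  have cs: "real (card {x \<in> V. Q x}) = (\<Sum>x\<in>V. of_bool (Q x))" for Q
    using V by (auto simp: of_bool_def sum.If_cases Int_def)
  \<comment> \<open>Oddness excludes equality in the half bounds; this yields the -1 that the
    removal of the cycle consumes.\<close>
  have line: "\<bar>\<Sum>x\<in>V. sgn (a j x)\<bar> \<le> (\<Sum>x\<in>V. of_bool (a j x = 0)) - 1" if "j < 3" for j
  proof -
    have "(\<Sum>x\<in>V. sgn (a j x)) = real (card {x \<in> V. 0 < a j x}) - real (card {x \<in> V. a j x < 0})"
      unfolding cs sum_subtractf[symmetric] by (intro sum.cong) (auto simp: sgn_if)
    moreover have "real (card V) = real (card {x \<in> V. 0 < a j x}) + real (card {x \<in> V. a j x < 0}) + (\<Sum>x\<in>V. of_bool (a j x = 0))"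
    proof -
      have "real (card V) = (\<Sum>x\<in>V. 1)" by simp
      also have "\<dots> = (\<Sum>x\<in>V. of_bool (0 < a j x) + of_bool (a j x < 0) + of_bool (a j x = 0))"
        by (intro sum.cong) auto
      finally show ?thesis unfolding cs sum.distrib .
    qed
    moreover have "2 * card {x \<in> V. 0 < a j x} \<noteq> card V" "2 * card {x \<in> V. a j x < 0} \<noteq> card V" using V(2) by (metis dvd_triv_left)+
    then have "2 * real (card {x \<in> V. 0 < a j x}) + 1 \<le> real (card V)" "2 * real (card {x \<in> V. a j x < 0}) + 1 \<le> real (card V)"
      using le(1,2)[OF that] by linarith+
    ultimately show ?thesis by linarith
  qed
  have "odd_cycle (a 0) (a 1) (a 2) V"
    by (rule odd_cycle_exists[OF V(1) _ a_sum nz]) (use line in auto)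
  then obtain xs where xs: "distinct xs" "set xs \<subseteq> V" "length xs \<in> {3, 5}"
     "\<forall>i<length xs. adj3 (a 0) (a 1) (a 2) (xs ! i) (xs ! (Suc i mod length xs))"
     and bal: "\<forall>f\<in>{a 0, a 1, a 2}. \<bar>\<Sum>x\<in>V - set xs. sgn (f x)\<bar> \<le> (\<Sum>x\<in>V - set xs. of_bool (f x = 0))"
    unfolding odd_cycle_def by blast
  obtain S where S: "bij_betw S (set xs) (set xs)" "\<forall>i<length xs. S (xs ! i) = xs ! (Suc i mod length xs)"
    "\<forall>x\<in>set xs. (S ^^ length xs) x = x"
    using cyclic_permutation[OF xs(1)] by blast
  have "card (V - set xs) = card V - length xs" using xs V by (simp add: card_Diff_subset distinct_card)
  moreover have "length xs \<le> card V" using xs V by (metis card_mono distinct_card)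
  ultimately have ev: "even (card (V - set xs))" using V(2) xs(3) by auto
  have "\<exists>X Yp Ym. sector_partition (count_space (V - set xs)) a X Yp Ym"
  proof (rule finite_balanced_partition[OF _ ev a_sum])
    fix j :: nat assume "j < 3"
    then have "a j \<in> {a 0, a 1, a 2}" using less_3_cases[of j] by auto
    then show "\<bar>\<Sum>x\<in>V - set xs. sgn (a j x)\<bar> \<le> (\<Sum>x\<in>V - set xs. of_bool (a j x = 0))" using bal by blast
  qed (use V nz in auto)
  then obtain X Yp Ym T where T: "bij_betw T (V - set xs) (V - set xs)" "\<And>x. x \<in> V - set xs \<Longrightarrow> T (T x) = x"
    "\<And>x. x \<in> V - set xs \<Longrightarrow> adj3 (a 0) (a 1) (a 2) x (T x)"
    using finite_pairing[of "V - set xs" a] V by (metis finite_Diff)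
  let ?U = "\<lambda>x. if x \<in> V - set xs then T x else S x"
  have dis: "(V - set xs) \<inter> set xs = {}" by auto
  have Vx: "V - set xs \<union> set xs = V" using xs by auto
  note U = glue_bij[OF T(1) S(1) dis, unfolded Vx]
  have adj: "\<forall>x\<in>V. adj3 (a 0) (a 1) (a 2) x (?U x)"
  proof
    fix x assume x: "x \<in> V"
    show "adj3 (a 0) (a 1) (a 2) x (?U x)"
    proof (cases "x \<in> set xs")
      case True
      then obtain i where "i < length xs" "x = xs ! i" by (metis in_set_conv_nth)
      then show ?thesis using True S(2) xs(4) by simp
    qed (use x T(3) in simp)
  qed
  have p2: "\<forall>x\<in>V - set xs. (?U ^^ 2) x = x"
    using U(2)[of _ 2] T(2) by (simp add: numeral_2_eq_2)
  have pm: "\<forall>x\<in>set xs. (?U ^^ length xs) x = x"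
    using U(3)[of _ "length xs"] S(3) by simp
  show ?thesis
  proof (cases "length xs = 3")
    case True
    show ?thesis
      by (rule exI[of _ ?U], rule exI[of _ "{}"], rule exI[of _ "V - set xs"], rule exI[of _ "set xs"], rule exI[of _ "{}"])
        (use U(1) adj p2 pm True Vx in auto)
  next
    case False
    then have l5: "length xs = 5" using xs by auto
    show ?thesis
      by (rule exI[of _ ?U], rule exI[of _ "{}"], rule exI[of _ "V - set xs"], rule exI[of _ "{}"], rule exI[of _ "set xs"])
        (use U(1) adj p2 pm l5 Vx in auto)
  qed
qed

section \<open>Essential infima\<close>

lemma prob_space_unit_lebesgue: "prob_space unit_lebesgue"
  by (rule prob_spaceI) (simp add: emeasure_restrict_space)

text \<open>The measure of A \<inter> [0, t] is 1-Lipschitz in t, so the intermediate value theorem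
  applies.\<close>

lemma unit_lebesgue_split:
  assumes A: "A \<in> sets unit_lebesgue" and x: "0 \<le> x" "x \<le> measure unit_lebesgue A"
  shows "\<exists>B\<in>sets unit_lebesgue. B \<subseteq> A \<and> measure unit_lebesgue B = x"
proof -
  interpret prob_space unit_lebesgue by (rule prob_space_unit_lebesgue)
  let ?m = "measure unit_lebesgue"
  define f where "f t = ?m (A \<inter> {0..t})" for t :: real
  have Am: "A \<in> sets lebesgue" "A \<subseteq> {0..1}" using A by (auto simp: sets_unit_lebesgue)
  have ms: "A \<inter> {s..t} \<in> sets unit_lebesgue" "A \<inter> {s<..t} \<in> sets unit_lebesgue" for s t
    using Am by (auto simp: sets_unit_lebesgue)
  have lip: "\<bar>f t - f s\<bar> \<le> t - s" if "0 \<le> s" "s \<le> t" for s t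
  proof -
    have "A \<inter> {0..t} = A \<inter> {0..s} \<union> A \<inter> {s<..t}" using that by auto
    then have "f t = f s + ?m (A \<inter> {s<..t})"
      unfolding f_def using ms by (simp only:) (rule finite_measure_Union, auto)
    moreover have "?m (A \<inter> {s<..t}) = measure lebesgue (A \<inter> {s<..t})"
      using Am(2) unfolding measure_def by (subst emeasure_unit_lebesgue) auto
    moreover have "measure lebesgue (A \<inter> {s<..t}) \<le> measure lebesgue {s..t}"
      using Am that by (intro measure_mono_fmeasurable) (auto simp: fmeasurable_def)
    moreover have "measure lebesgue {s..t} = t - s" using that by simp
    ultimately show ?thesis using measure_nonneg[of unit_lebesgue "A \<inter> {s<..t}"] by linarith
  qed
  have "continuous_on {0..1} f"
  proof (rule continuous_on_iff[THEN iffD2], intro ballI allI impI)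
    fix s e :: real assume "s \<in> {0..1}" "0 < e"
    moreover have "dist (f t) (f s) < e" if "t \<in> {0..1}" "dist t s < e" for t
      using lip[of s t] lip[of t s] that \<open>s \<in> {0..1}\<close> by (cases "s \<le> t") (auto simp: dist_real_def abs_if split: if_splits)
    ultimately show "\<exists>d>0. \<forall>t\<in>{0..1}. dist t s < d \<longrightarrow> dist (f t) (f s) < e" by blast
  qed
  moreover have "f 0 = 0"
  proof -
    have "A \<inter> {0..0} \<subseteq> {0}" by auto
    then have "emeasure lebesgue (A \<inter> {0..0}) \<le> emeasure lebesgue {0::real}" by (intro emeasure_mono) auto
    then have "emeasure lebesgue (A \<inter> {0..0}) = 0" by simp
    moreover have "A \<inter> {0..0} \<subseteq> {0..1}" by auto
    ultimately have "emeasure unit_lebesgue (A \<inter> {0..0}) = 0" by (simp only: emeasure_unit_lebesgue)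
    then show ?thesis unfolding f_def measure_def by simp
  qed
  moreover have "f 1 = ?m A" using Am by (simp add: f_def Int_absorb2)
  ultimately obtain t where "f t = x" using IVT'[of f 0 x 1] x by auto
  then show ?thesis using ms(1)[of 0 t] by (intro bexI[of _ "A \<inter> {0..t}"]) (auto simp: f_def)
qed

lemma Lam3_ge:
  assumes aut: "is_aut M T N1 N2"
    and ae: "AE x in M. x \<in> N1 \<longrightarrow> sqrt 3 / 2 * (cmod (g x - z) + cmod (g (T x) - z)) \<le> cmod (g (T x) - g x)"
  shows "ereal (sqrt 3 / 2) \<le> Lam3 M g T N1 z"
  unfolding Lam3_def
proof (rule Liminf_bounded)
  have N1: "N1 \<in> sets M" using aut by (simp add: is_aut_def)
  \<comment> \<open>The value 1 assigned to 0/0 must not fall below the bound either.\<close>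
  have "sqrt 3 \<le> 2" by (rule real_le_lsqrt) auto
  have r: "sqrt 3 / 2 \<le> lam_ratio g T z x"
    if "sqrt 3 / 2 * (cmod (g x - z) + cmod (g (T x) - z)) \<le> cmod (g (T x) - g x)" for x
  proof (cases "cmod (g x - z) + cmod (g (T x) - z) = 0")
    case True
    then show ?thesis using \<open>sqrt 3 \<le> 2\<close> by (simp add: lam_ratio_def)
  next
    case False
    then have "0 < cmod (g x - z) + cmod (g (T x) - z)"
      using norm_ge_zero[of "g x - z"] norm_ge_zero[of "g (T x) - z"] by linarith
    then show ?thesis using that False by (simp add: lam_ratio_def pos_le_divide_eq norm_minus_commute)
  qed
  have "AE x in restrict_space M N1. ereal (sqrt 3 / 2) \<le> ereal (lam_ratio g T z x)"
  proof (subst AE_restrict_space_iff)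
    show "AE x in M. x \<in> N1 \<longrightarrow> ereal (sqrt 3 / 2) \<le> ereal (lam_ratio g T z x)"
      using ae by eventually_elim (use r in simp)
  qed (use N1 in simp)
  then show "\<forall>\<^sub>F x in ae_filter (restrict_space M N1). ereal (sqrt 3 / 2) \<le> ereal (lam_ratio g T z x)" .
qed

lemma Lam_ge:
  assumes "is_aut M T N1 N2"
    and "AE x in M. x \<in> N1 \<longrightarrow> sqrt 3 / 2 * (cmod (g x - z) + cmod (g (T x) - z)) \<le> cmod (g (T x) - g x)"
  shows "ereal (sqrt 3 / 2) \<le> Lam M g"
  unfolding Lam_def by (rule Sup_upper2[OF _ Lam3_ge[OF assms]]) (use assms in blast)

section \<open>Attainment of the supremum for finitely many points\<close>

context
  fixes V :: "'a set"
  assumes V: "finite V" "V \<noteq> {}"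
begin

lemma AE_uniform: "(AE x in uniform_count_measure V. P x) \<longleftrightarrow> (\<forall>x\<in>V. P x)"
  unfolding uniform_count_measure_def using V by (subst AE_point_measure) (auto simp: card_gt_0_iff)

lemma uniform_null: "A \<subseteq> V \<Longrightarrow> emeasure (uniform_count_measure V) A = 0 \<longleftrightarrow> A = {}"
  using V finite_subset[of A V] by (simp add: emeasure_uniform_count_measure card_gt_0_iff ennreal_eq_0_iff divide_le_0_iff)

text \<open>Every point has positive measure, so sets of full measure are everything, and on a
  finite set every bijection preserves the counting measure.\<close>

lemma is_aut_uniform: "is_aut (uniform_count_measure V) T N1 N2 \<longleftrightarrow> N1 = V \<and> N2 = V \<and> bij_betw T V V"
proof
  assume aut: "is_aut (uniform_count_measure V) T N1 N2"
  then have "N1 \<subseteq> V" "N2 \<subseteq> V" by (auto simp: is_aut_def sets_uniform_count_measure)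
  moreover have "V - N1 = {}" "V - N2 = {}"
    using aut uniform_null[of "V - N1"] uniform_null[of "V - N2"] by (auto simp: is_aut_def space_uniform_count_measure)
  ultimately have "N1 = V" "N2 = V" by auto
  then show "N1 = V \<and> N2 = V \<and> bij_betw T V V" using aut by (simp add: is_aut_def)
next
  assume a: "N1 = V \<and> N2 = V \<and> bij_betw T V V"
  have "paut (uniform_count_measure V) V T"
    unfolding paut_def
  proof (intro conjI ballI impI)
    fix S assume "S \<in> sets (uniform_count_measure V)" "S \<subseteq> V"
    then have S: "S \<subseteq> V" by simp
    show "T ` S \<in> sets (uniform_count_measure V)"
      using a S by (auto simp: sets_uniform_count_measure bij_betw_def)
    show "T -` S \<inter> V \<in> sets (uniform_count_measure V)" by (simp add: sets_uniform_count_measure)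
    have "T ` (T -` S \<inter> V) = S" using a S by (force simp: bij_betw_def)
    moreover have "inj_on T (T -` S \<inter> V)" using a by (auto simp: bij_betw_def intro: inj_on_subset)
    ultimately have "card (T -` S \<inter> V) = card S" using card_image by fastforce
    then show "emeasure (uniform_count_measure V) (T -` S \<inter> V) = emeasure (uniform_count_measure V) S"
      using V S by (simp add: emeasure_uniform_count_measure)
  qed (use a in \<open>auto simp: sets_uniform_count_measure\<close>)
  then show "is_aut (uniform_count_measure V) T N1 N2"
    using a paut_is_aut[of "uniform_count_measure V" V T] by (simp add: space_uniform_count_measure)
qed

lemma Lam3_uniform: "Lam3 (uniform_count_measure V) g T V z = (INF x\<in>V. ereal (lam_ratio g T z x))"
proof -
  let ?R = "restrict_space (uniform_count_measure V) V"
  have ae: "(AE x in restrict_space (uniform_count_measure V) V. P x) \<longleftrightarrow> (\<forall>x\<in>V. P x)" for P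
    by (subst AE_restrict_space_iff) (auto simp: AE_uniform space_uniform_count_measure sets_uniform_count_measure)
  show ?thesis
    unfolding Lam3_def
  proof (rule antisym)
    show "Liminf (ae_filter ?R) (\<lambda>x. ereal (lam_ratio g T z x)) \<le> (INF x\<in>V. ereal (lam_ratio g T z x))"
      unfolding Liminf_def
    proof (rule SUP_least, rule INF_greatest)
      fix P x assume "P \<in> {P. \<forall>\<^sub>F x in ae_filter ?R. P x}" "x \<in> V"
      then have "P x" using ae[of P] by simp
      then show "(INF y\<in>Collect P. ereal (lam_ratio g T z y)) \<le> ereal (lam_ratio g T z x)" by (intro INF_lower) simp
    qed
    show "(INF x\<in>V. ereal (lam_ratio g T z x)) \<le> Liminf (ae_filter ?R) (\<lambda>x. ereal (lam_ratio g T z x))"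
      by (rule Liminf_bounded) (simp add: ae, intro ballI INF_lower)
  qed
qed

text \<open>There are finitely many permutations, so along a subsequence of a maximising sequence
  the map is constant on \<open>V\<close>. By \<open>pos\<close> the quotients eventually exceed
  1/2, which keeps the centres in a ball; with quotients near 0 they could escape to infinity. A
  limit of the centres is then optimal.\<close>

lemma Lam_attained:
  fixes g :: "'a \<Rightarrow> complex"
  assumes pos: "ereal (sqrt 3 / 2) \<le> Lam (uniform_count_measure V) g"
  shows "\<exists>z T N1 N2. is_aut (uniform_count_measure V) T N1 N2 \<and>
    Lam3 (uniform_count_measure V) g T N1 z = Lam (uniform_count_measure V) g"
proof -
  let ?M = "uniform_count_measure V"
  define A where "A = {Lam3 ?M g T N1 z | T N1 N2 z. is_aut ?M T N1 N2}"
  have S: "A = {Lam3 ?M g T V z | T z. bij_betw T V V}" by (auto simp: A_def is_aut_uniform)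
  have "Lam3 ?M g id V 0 \<in> A" unfolding S using bij_betw_id by blast
  then have "A \<noteq> {}" by auto
  from Sup_countable_SUP[OF this] obtain f where f: "incseq f" "range f \<subseteq> A" "Sup A = (SUP i. f i)"
    by auto
  have flim: "f \<longlonglongrightarrow> Lam ?M g"
    using LIMSEQ_SUP[OF f(1)] f(3) by (simp add: Lam_def A_def)
  have "\<forall>i. \<exists>T z. bij_betw T V V \<and> f i = Lam3 ?M g T V z" using f(2) unfolding S by blast
  then obtain T z where Tz: "\<And>i. bij_betw (T i) V V" "\<And>i. f i = Lam3 ?M g (T i) V (z i)" by metis
  have "finite (V \<rightarrow>\<^sub>E V)" using V by (intro finite_PiE) auto
  then have "finite (range (\<lambda>i. restrict (T i) V))"
    by (rule finite_subset[rotated]) (use bij_betwE[OF Tz(1)] in \<open>auto\<close>)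
  then obtain i0 where "infinite ((\<lambda>i. restrict (T i) V) -` {restrict (T i0) V} \<inter> UNIV)"
    using inf_img_fin_dom[of "\<lambda>i. restrict (T i) V" UNIV] by auto
  then obtain r :: "nat \<Rightarrow> nat" where r: "strict_mono r" "\<And>i. restrict (T (r i)) V = restrict (T i0) V"
    using infinite_enumerate[of "(\<lambda>i. restrict (T i) V) -` {restrict (T i0) V}"] by auto
  define U where "U = T i0"
  have Ur: "T (r i) x = U x" if "x \<in> V" for i x
    using fun_cong[OF r(2)[of i], of x] that by (simp add: U_def)
  have rat: "lam_ratio g (T (r i)) w x = lam_ratio g U w x" if "x \<in> V" for i w x
    using Ur[OF that] by (simp add: lam_ratio_def)
  define h where "h i = f (r i)" for i
  have hlim: "h \<longlonglongrightarrow> Lam ?M g" unfolding h_def using LIMSEQ_subseq_LIMSEQ[OF flim r(1)] by (simp add: comp_def)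
  have hle: "h i \<le> ereal (lam_ratio g U (z (r i)) x)" if "x \<in> V" for i x
    unfolding h_def Tz(2) Lam3_uniform rat[OF that, of i, symmetric] by (rule INF_lower[OF that])
  have "(1::real) < sqrt 3" by simp
  then have "ereal (1 / 2) < Lam ?M g" by (intro less_le_trans[OF _ pos]) simp
  then have "\<forall>\<^sub>F i in sequentially. ereal (1 / 2) < h i" using order_tendstoD(1)[OF hlim] by blast
  then obtain K where K: "\<And>i. K \<le> i \<Longrightarrow> ereal (1 / 2) < h i" by (auto simp: eventually_sequentially)
  define w where "w i = z (r (i + K))" for i
  have wr: "1 / 2 < lam_ratio g U (w i) x" if "x \<in> V" for i x
    using less_le_trans[OF K[of "i + K"] hle[OF that, of "i + K"]] by (simp add: w_def)
  have near: "cmod (w i - g x) \<le> 2 * cmod (g x - g (U x))" if "x \<in> V" for i x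
  proof (cases "cmod (g x - w i) + cmod (g (U x) - w i) = 0")
    case True
    then have "cmod (g x - w i) = 0" using norm_ge_zero[of "g x - w i"] norm_ge_zero[of "g (U x) - w i"] by linarith
    then show ?thesis by simp
  next
    case False
    then have p: "0 < cmod (g x - w i) + cmod (g (U x) - w i)"
      using norm_ge_zero[of "g x - w i"] norm_ge_zero[of "g (U x) - w i"] by linarith
    have "1 / 2 < cmod (g x - g (U x)) / (cmod (g x - w i) + cmod (g (U x) - w i))"
      using wr[OF that, of i] False by (simp add: lam_ratio_def)
    then have "cmod (g x - w i) + cmod (g (U x) - w i) < 2 * cmod (g x - g (U x))"
      using p by (simp add: field_simps)
    then show ?thesis using norm_ge_zero[of "g (U x) - w i"] norm_minus_commute[of "w i" "g x"] by linarith
  qed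
  obtain x0 where x0: "x0 \<in> V" using V by blast
  have "\<forall>i. w i \<in> cball (g x0) (2 * cmod (g x0 - g (U x0)))"
    using near[OF x0] by (simp add: dist_norm norm_minus_commute)
  from seq_compactE[OF compact_imp_seq_compact[OF compact_cball] this]
  obtain l q where q: "strict_mono q" and wl: "(w \<circ> q) \<longlonglongrightarrow> l" .
  have hq: "(\<lambda>i. h (q i + K)) \<longlonglongrightarrow> Lam ?M g"
    using LIMSEQ_subseq_LIMSEQ[OF LIMSEQ_ignore_initial_segment[OF hlim, of K] q] by (simp add: comp_def)
  \<comment> \<open>The quotient is discontinuous only at 0/0. If g x = g (U x), it would be 0 for
    any centre other than g x, so by \<open>near\<close> all centres equal g x and the sequence is
    constant; otherwise the denominator never vanishes.\<close>
  have lim: "(\<lambda>i. lam_ratio g U (w (q i)) x) \<longlonglongrightarrow> lam_ratio g U l x" if x: "x \<in> V" for x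
  proof (cases "g x = g (U x)")
    case True
    then have "w i = g x" for i using near[OF x, of i] by simp
    moreover have "l = g x" using wl calculation LIMSEQ_unique[OF wl, of "g x"] by (simp add: comp_def)
    ultimately show ?thesis by simp
  next
    case False
    have nz: "cmod (g x - v) + cmod (g (U x) - v) \<noteq> 0" for v
    proof
      assume "cmod (g x - v) + cmod (g (U x) - v) = 0"
      then have "cmod (g x - v) = 0" "cmod (g (U x) - v) = 0"
        using norm_ge_zero[of "g x - v"] norm_ge_zero[of "g (U x) - v"] by linarith+
      then show False using False by simp
    qed
    have "(\<lambda>i. cmod (g x - g (U x)) / (cmod (g x - w (q i)) + cmod (g (U x) - w (q i))))
      \<longlonglongrightarrow> cmod (g x - g (U x)) / (cmod (g x - l) + cmod (g (U x) - l))"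
      using wl nz by (intro tendsto_intros) (auto simp: comp_def)
    then show ?thesis using nz by (simp add: lam_ratio_def)
  qed
  have "Lam ?M g \<le> ereal (lam_ratio g U l x)" if x: "x \<in> V" for x
  proof (rule LIMSEQ_le[OF hq])
    show "(\<lambda>i. ereal (lam_ratio g U (w (q i)) x)) \<longlonglongrightarrow> ereal (lam_ratio g U l x)"
      using lim[OF x] by simp
    show "\<exists>N. \<forall>n\<ge>N. h (q n + K) \<le> ereal (lam_ratio g U (w (q n)) x)"
      using hle[OF x] by (auto simp: w_def)
  qed
  then have "Lam ?M g \<le> Lam3 ?M g U V l" unfolding Lam3_uniform by (rule INF_greatest)
  moreover have aut: "is_aut ?M U V V" using Tz(1) by (simp add: is_aut_uniform U_def)
  moreover have "Lam3 ?M g U V l \<le> Lam ?M g" unfolding Lam_def by (rule Sup_upper) (use aut in blast)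
  ultimately show ?thesis by (metis antisym)
qed

end

section \<open>Conclusion\<close>

lemma adj3_proj3_dist:
  assumes "adj3 (\<lambda>x. proj3 \<theta> 0 (g x - z)) (\<lambda>x. proj3 \<theta> 1 (g x - z)) (\<lambda>x. proj3 \<theta> 2 (g x - z)) x y"
  shows "sqrt 3 / 2 * (cmod (g x - z) + cmod (g y - z)) \<le> cmod (g y - g x)"
proof -
  have "adj3 (proj3 \<theta> 0) (proj3 \<theta> 1) (proj3 \<theta> 2) (g x - z) (g y - z)"
    using assms by (simp only: adj3_def)
  from adj3_wide[OF this] show ?thesis by (simp add: wide_def norm_minus_commute)
qed

lemma conjugate_partition:
  assumes fm: "finite_measure M"
    and sp: "sector_partition M (\<lambda>j x. proj3 \<theta> j (g x - z)) X Yp Ym"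
    and T1: "AE x in M. x \<in> X \<longrightarrow> T x = x" and T2: "AE x in M. x \<in> space M - X \<longrightarrow> (T ^^ 2) x = x"
  shows "\<exists>X1 (X2 :: nat \<Rightarrow> nat \<Rightarrow> 'a set).
     X1 \<in> sets M \<and>
     (\<forall>m\<ge>1. \<forall>i\<in>{1,2}. X2 m i \<in> sets M) \<and>
     (\<forall>m\<ge>1. \<forall>i\<in>{1,2}. X1 \<inter> X2 m i = {}) \<and>
     (\<forall>m\<ge>1. \<forall>i\<in>{1,2}. \<forall>m'\<ge>1. \<forall>i'\<in>{1,2}. (m, i) \<noteq> (m', i') \<longrightarrow> X2 m i \<inter> X2 m' i' = {}) \<and>
     X1 \<union> (\<Union>m\<in>{1..}. \<Union>i\<in>{1,2}. X2 m i) = space M \<and>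
     g ` X1 \<subseteq> {z} \<and>
     (\<forall>m\<ge>1. emeasure M (X2 m 1) = emeasure M (X2 m 2)) \<and>
     (\<forall>m\<ge>1. conjugate z (pi / 3) (g ` X2 m 1) (g ` X2 m 2)) \<and>
     (AE x in M. x \<in> X1 \<longrightarrow> T x = x) \<and>
     (AE x in M. x \<in> space M - X1 \<longrightarrow> (T ^^ 2) x = x)"
proof -
  interpret finite_measure M by fact
  have Xm: "X \<in> sets M" and Ym: "\<And>k. k < 3 \<Longrightarrow> Yp k \<in> sets M" "\<And>k. k < 3 \<Longrightarrow> Ym k \<in> sets M"
    and cov: "X \<union> (\<Union>k<3. Yp k \<union> Ym k) = space M"
    and XY: "\<And>k. k < 3 \<Longrightarrow> X \<inter> (Yp k \<union> Ym k) = {}" and YY: "\<And>k. k < 3 \<Longrightarrow> Yp k \<inter> Ym k = {}"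
    and Yd: "\<And>k l. k < 3 \<Longrightarrow> l < 3 \<Longrightarrow> k \<noteq> l \<Longrightarrow> (Yp k \<union> Ym k) \<inter> (Yp l \<union> Ym l) = {}"
    and Ye: "\<And>k. k < 3 \<Longrightarrow> measure M (Yp k) = measure M (Ym k)"
    and X0: "\<And>j x. j < 3 \<Longrightarrow> x \<in> X \<Longrightarrow> proj3 \<theta> j (g x - z) = 0"
    and Yp: "\<And>k j x. k < 3 \<Longrightarrow> j < 3 \<Longrightarrow> j \<noteq> k \<Longrightarrow> x \<in> Yp k \<Longrightarrow> proj3 \<theta> j (g x - z) \<le> 0"
    and Yn: "\<And>k j x. k < 3 \<Longrightarrow> j < 3 \<Longrightarrow> j \<noteq> k \<Longrightarrow> x \<in> Ym k \<Longrightarrow> 0 \<le> proj3 \<theta> j (g x - z)"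
    using sp by (simp_all add: sector_partition_def)
  \<comment> \<open>Three pairs of sectors suffice, the index m corresponding to sector m - 1. All
    further sets are empty, and empty sets are conjugate.\<close>
  define X2 where "X2 m i = (if m \<in> {1..3} then if i = 1 then Yp (m - 1) else Ym (m - 1) else {})" for m i :: nat
  have conj: "conjugate z (pi / 3) (g ` Yp k) (g ` Ym k)" if k: "k < 3" for k
  proof -
    obtain i j where ij: "perm3 i j k" "i < 3" "j < 3" "i \<noteq> k" "j \<noteq> k"
    proof -
      have "k = 0 \<or> k = 1 \<or> k = 2" using k by linarith
      then show thesis using that[of 1 2] that[of 2 0] that[of 0 1] by (elim disjE) (simp_all add: perm3_def)
    qed
    show ?thesis
    proof (rule conjugate_opposite_sectors[OF ij(1)])
      fix w assume "w \<in> g ` Yp k"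
      then show "proj3 \<theta> i (w - z) \<le> 0 \<and> proj3 \<theta> j (w - z) \<le> 0" using Yp[OF k] ij by blast
    next
      fix w assume "w \<in> g ` Ym k"
      then show "0 \<le> proj3 \<theta> i (w - z) \<and> 0 \<le> proj3 \<theta> j (w - z)" using Yn[OF k] ij by blast
    qed
  qed
  have conj0: "conjugate z (pi / 3) {} {}" by (simp add: conjugate_def)
  have X2sub: "X2 m i \<subseteq> Yp (m - 1) \<union> Ym (m - 1)" for m i by (auto simp: X2_def)
  have X2e: "X2 m i = {}" if "m \<notin> {1..3}" for m i using that unfolding X2_def by (rule if_not_P)
  have UNX: "(\<Union>m\<in>{1..}. \<Union>i\<in>{1,2}. X2 m i) = (\<Union>k<3. Yp k \<union> Ym k)"
  proof (intro equalityI subsetI)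
    fix x assume "x \<in> (\<Union>m\<in>{1..}. \<Union>i\<in>{1,2}. X2 m i)"
    then obtain m i where mi: "x \<in> X2 m i" by blast
    then have "m \<in> {1..3}" using X2e by blast
    then have "m - 1 < 3" by auto
    then show "x \<in> (\<Union>k<3. Yp k \<union> Ym k)" using mi X2sub by blast
  next
    fix x assume "x \<in> (\<Union>k<3. Yp k \<union> Ym k)"
    then obtain k where k: "k < 3" "x \<in> Yp k \<union> Ym k" by blast
    then have "x \<in> X2 (Suc k) 1 \<union> X2 (Suc k) 2" by (auto simp: X2_def)
    then show "x \<in> (\<Union>m\<in>{1..}. \<Union>i\<in>{1,2}. X2 m i)" by fastforce
  qed
  show ?thesis
  proof (rule exI[of _ X], rule exI[of _ X2], intro conjI allI impI ballI)
    show "X \<in> sets M" by (rule Xm)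
    show "X2 m i \<in> sets M" if "1 \<le> m" "i \<in> {1, 2}" for m i
      using Ym[of "m - 1"] by (auto simp: X2_def)
    show "X \<inter> X2 m i = {}" if "1 \<le> m" "i \<in> {1, 2}" for m i
    proof (cases "m \<in> {1..3}")
      case True
      then have "m - 1 < 3" by auto
      then show ?thesis using XY[of "m - 1"] X2sub[of m i] by blast
    qed (simp add: X2e)
    show "X2 m i \<inter> X2 m' i' = {}" if "1 \<le> m" "i \<in> {1, 2}" "1 \<le> m'" "i' \<in> {1, 2}" "(m, i) \<noteq> (m', i')" for m i m' i'
    proof (cases "m \<in> {1..3} \<and> m' \<in> {1..3}")
      case True
      show ?thesis
      proof (cases "m = m'")
        case eq: True
        have "Yp (m - 1) \<inter> Ym (m - 1) = {}" by (rule YY) (use True in auto)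
        then show ?thesis using eq that by (auto simp: X2_def)
      next
        case False
        then have "m - 1 < 3" "m' - 1 < 3" "m - 1 \<noteq> m' - 1" using True that by auto
        from Yd[OF this] show ?thesis using X2sub[of m i] X2sub[of m' i'] by blast
      qed
    qed (use X2e in auto)
    show "X \<union> (\<Union>m\<in>{1..}. \<Union>i\<in>{1,2}. X2 m i) = space M" unfolding UNX by (rule cov)
    show "g ` X \<subseteq> {z}"
    proof (rule image_subsetI)
      fix x assume "x \<in> X"
      then have "g x - z = 0" using X0[of 0 x] X0[of 1 x] X0[of 2 x] proj3_eq_0_iff[of \<theta> "g x - z"] by simp
      then show "g x \<in> {z}" by simp
    qed
    show "emeasure M (X2 m 1) = emeasure M (X2 m 2)" if "1 \<le> m" for m
      using Ye[of "m - 1"] by (auto simp: X2_def emeasure_eq_measure)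
    show "conjugate z (pi / 3) (g ` X2 m 1) (g ` X2 m 2)" if "1 \<le> m" for m
      using conj[of "m - 1"] conj0 by (auto simp: X2_def)
  qed (use T1 T2 in auto)
qed

text \<open>The combinatorics uses counting measure because its values are integers; normalisation
  divides all of them by the same number.\<close>

lemma sector_partition_uniform:
  assumes V: "finite V" and sp: "sector_partition (count_space V) a X Yp Ym"
  shows "sector_partition (uniform_count_measure V) a X Yp Ym"
proof -
  have "measure (uniform_count_measure V) (Yp k) = measure (uniform_count_measure V) (Ym k)" if "k < 3" for k
  proof -
    have "Yp k \<subseteq> V" "Ym k \<subseteq> V" "measure (count_space V) (Yp k) = measure (count_space V) (Ym k)"
      using sp that by (auto simp: sector_partition_def)
    then show ?thesis using V by (simp add: measure_uniform_count_measure measure_count_space finite_subset)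
  qed
  then show ?thesis
    using sp by (simp add: sector_partition_def space_uniform_count_measure sets_uniform_count_measure)
qed

theorem theorem4p3:
  fixes n :: enat and g :: "real \<Rightarrow> complex"
  assumes n_pos: "n \<noteq> 0"
    and g_meas: "g \<in> borel_measurable (Omega n)"
  shows "(\<exists>z0 T N1 N2.
           is_aut (Omega n) T N1 N2 \<and>
           (AE x in Omega n. x \<in> N1 \<longrightarrow>
              cmod (g (T x) - g x) \<ge> sqrt 3 / 2 * (cmod (g x - z0) + cmod (g (T x) - z0))) \<and>
           Lam (Omega n) g \<ge> ereal (sqrt 3 / 2) \<and>
           ((n = \<infinity> \<or> (\<exists>k. n = enat k \<and> even k)) \<longrightarrow>
              (\<exists>X1 (X2 :: nat \<Rightarrow> nat \<Rightarrow> real set).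
                 X1 \<in> sets (Omega n) \<and>
                 (\<forall>m\<ge>1. \<forall>i\<in>{1,2}. X2 m i \<in> sets (Omega n)) \<and>
                 (\<forall>m\<ge>1. \<forall>i\<in>{1,2}. X1 \<inter> X2 m i = {}) \<and>
                 (\<forall>m\<ge>1. \<forall>i\<in>{1,2}. \<forall>m'\<ge>1. \<forall>i'\<in>{1,2}. (m, i) \<noteq> (m', i') \<longrightarrow> X2 m i \<inter> X2 m' i' = {}) \<and>
                 X1 \<union> (\<Union>m\<in>{1..}. \<Union>i\<in>{1,2}. X2 m i) = space (Omega n) \<and>
                 g ` X1 \<subseteq> {z0} \<and>
                 (\<forall>m\<ge>1. emeasure (Omega n) (X2 m 1) = emeasure (Omega n) (X2 m 2)) \<and>
                 (\<forall>m\<ge>1. conjugate z0 (pi / 3) (g ` X2 m 1) (g ` X2 m 2)) \<and>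
                 (AE x in Omega n. x \<in> X1 \<longrightarrow> T x = x) \<and>
                 (AE x in Omega n. x \<in> space (Omega n) - X1 \<longrightarrow> (T ^^ 2) x = x))) \<and>
           ((\<exists>k. n = enat k \<and> odd k) \<longrightarrow>
              (\<exists>X1 X2 X3 X5.
                 X1 \<in> sets (Omega n) \<and> X2 \<in> sets (Omega n) \<and>
                 X3 \<in> sets (Omega n) \<and> X5 \<in> sets (Omega n) \<and>
                 X1 \<inter> X2 = {} \<and> X1 \<inter> X3 = {} \<and> X1 \<inter> X5 = {} \<and>
                 X2 \<inter> X3 = {} \<and> X2 \<inter> X5 = {} \<and> X3 \<inter> X5 = {} \<and>
                 X1 \<union> X2 \<union> X3 \<union> X5 = space (Omega n) \<and>
                 (AE x in Omega n. x \<in> X1 \<longrightarrow> T x = x) \<and>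
                 (AE x in Omega n. x \<in> X2 \<longrightarrow> (T ^^ 2) x = x) \<and>
                 (AE x in Omega n. x \<in> X3 \<longrightarrow> (T ^^ 3) x = x) \<and>
                 (AE x in Omega n. x \<in> X5 \<longrightarrow> (T ^^ 5) x = x))))
         \<and> (n < \<infinity> \<longrightarrow>
              (\<exists>z0 T N1 N2. is_aut (Omega n) T N1 N2 \<and> Lam3 (Omega n) g T N1 z0 = Lam (Omega n) g))"
proof (cases n)
  case (enat k)
  define V where "V = real ` {1..k}"
  have M: "Omega n = uniform_count_measure V" by (simp add: Omega_def enat V_def)
  have k: "0 < k" using n_pos by (simp add: enat zero_enat_def)
  have V: "finite V" "V \<noteq> {}" "card V = k" using k by (auto simp: V_def card_image)
  interpret prob_space "uniform_count_measure V" using V by (intro prob_space_uniform_count_measure) auto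
  let ?M = "uniform_count_measure V"
  obtain z \<theta> where
    bal: "\<And>j. j < 3 \<Longrightarrow> prob {x \<in> space ?M. 0 < proj3 \<theta> j (g x - z)} \<le> 1 / 2"
    "\<And>j. j < 3 \<Longrightarrow> prob {x \<in> space ?M. proj3 \<theta> j (g x - z) < 0} \<le> 1 / 2"
    "prob {x \<in> space ?M. proj3 \<theta> 0 (g x - z) * proj3 \<theta> 1 (g x - z) * proj3 \<theta> 2 (g x - z) < 0} \<le> 1 / 2"
    "prob {x \<in> space ?M. 0 < proj3 \<theta> 0 (g x - z) * proj3 \<theta> 1 (g x - z) * proj3 \<theta> 2 (g x - z)} \<le> 1 / 2"
    using balanced_point[OF g_meas[unfolded M]] by blast
  have half: "2 * card {x \<in> V. Q x} \<le> card V" if "prob {x \<in> space ?M. Q x} \<le> 1 / 2" for Q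
  proof -
    have "real (card {x \<in> V. Q x}) / real (card V) \<le> 1 / 2"
      using that V by (simp add: space_uniform_count_measure measure_uniform_count_measure)
    then have "2 * real (card {x \<in> V. Q x}) \<le> real (card V)" using V k by (simp add: divide_simps)
    then show ?thesis by linarith
  qed
  define a where "a j x = proj3 \<theta> j (g x - z)" for j x
  have a_sum: "a 0 x + a 1 x + a 2 x = 0" for x unfolding a_def by (rule proj3_sum)
  have le: "\<And>j. j < 3 \<Longrightarrow> 2 * card {x \<in> V. 0 < a j x} \<le> card V"
      "\<And>j. j < 3 \<Longrightarrow> 2 * card {x \<in> V. a j x < 0} \<le> card V"
      "2 * card {x \<in> V. a 0 x * a 1 x * a 2 x < 0} \<le> card V"
      "2 * card {x \<in> V. 0 < a 0 x * a 1 x * a 2 x} \<le> card V"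
    unfolding a_def by (rule half, rule bal, assumption)+ (rule half, rule bal)+
  have dist: "sqrt 3 / 2 * (cmod (g x - z) + cmod (g y - z)) \<le> cmod (g y - g x)" if "adj3 (a 0) (a 1) (a 2) x y" for x y
    using that unfolding a_def by (rule adj3_proj3_dist)
  note AE = AE_uniform[OF V(1,2)] and aut = is_aut_uniform[OF V(1,2)]
  have Lge: "ereal (sqrt 3 / 2) \<le> Lam (Omega n) g"
    if "bij_betw T V V" "\<forall>x\<in>V. adj3 (a 0) (a 1) (a 2) x (T x)" for T
    unfolding M by (rule Lam_ge[of _ T V V]) (use that dist in \<open>auto simp: AE aut\<close>)
  show ?thesis
  proof (cases "even k")
    case True
    have ex: "\<exists>X Yp Ym. sector_partition (count_space V) a X Yp Ym"
      by (rule finite_even_partition[OF V(1) _ a_sum le]) (use V True in simp)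
    obtain X Yp Ym T where sp: "sector_partition (count_space V) a X Yp Ym" and T: "bij_betw T V V"
      "\<And>x. x \<in> V \<Longrightarrow> T (T x) = x" "\<And>x. x \<in> X \<Longrightarrow> T x = x" "\<And>x. x \<in> V \<Longrightarrow> adj3 (a 0) (a 1) (a 2) x (T x)"
      using finite_pairing[OF V(1) ex] by blast
    have sp': "sector_partition (Omega n) (\<lambda>j x. proj3 \<theta> j (g x - z)) X Yp Ym"
      using sector_partition_uniform[OF V(1) sp] unfolding M a_def .
    have L: "ereal (sqrt 3 / 2) \<le> Lam (Omega n) g" using T by (intro Lge[of T]) auto
    have autT: "is_aut (Omega n) T V V" unfolding M aut using T by blast
    have distT: "AE x in Omega n. x \<in> V \<longrightarrow> sqrt 3 / 2 * (cmod (g x - z) + cmod (g (T x) - z)) \<le> cmod (g (T x) - g x)"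
      unfolding M AE using T dist by blast
    have fm: "finite_measure (Omega n)" unfolding M by unfold_locales
    have T1: "AE x in Omega n. x \<in> X \<longrightarrow> T x = x" unfolding M AE using T by blast
    have T2: "AE x in Omega n. x \<in> space (Omega n) - X \<longrightarrow> (T ^^ 2) x = x"
      unfolding M AE using T by (simp add: numeral_2_eq_2)
    show ?thesis
    proof (intro conjI impI)
      show "\<exists>z0 T N1 N2. is_aut (Omega n) T N1 N2 \<and> Lam3 (Omega n) g T N1 z0 = Lam (Omega n) g"
        using Lam_attained[OF V(1,2)] L unfolding M by blast
    qed (rule exI[of _ z], rule exI[of _ T], rule exI[of _ V], rule exI[of _ V],
        intro conjI impI conjugate_partition[OF fm sp' T1 T2] L autT distT,
        use enat True in auto)
  next
    case False
    obtain T X1 X2 X3 X5 where T: "bij_betw T V V" "\<forall>x\<in>V. adj3 (a 0) (a 1) (a 2) x (T x)"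
      and X: "X1 \<inter> X2 = {}" "X1 \<inter> X3 = {}" "X1 \<inter> X5 = {}" "X2 \<inter> X3 = {}" "X2 \<inter> X5 = {}" "X3 \<inter> X5 = {}"
        "X1 \<union> X2 \<union> X3 \<union> X5 = V"
      and TX: "\<forall>x\<in>X1. T x = x" "\<forall>x\<in>X2. (T ^^ 2) x = x" "\<forall>x\<in>X3. (T ^^ 3) x = x" "\<forall>x\<in>X5. (T ^^ 5) x = x"
    proof -
      have "odd (card V)" using V(3) False by simp
      note perm = finite_odd_permutation[OF V(1) this a_sum le]
      show thesis by (rule exE[OF perm], assumption, assumption, elim exE conjE, rule that)
    qed
    have L: "ereal (sqrt 3 / 2) \<le> Lam (Omega n) g" using T by (intro Lge[of T]) auto
    have autT: "is_aut (Omega n) T V V" unfolding M aut using T by blast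
    have distT: "AE x in Omega n. x \<in> V \<longrightarrow> sqrt 3 / 2 * (cmod (g x - z) + cmod (g (T x) - z)) \<le> cmod (g (T x) - g x)"
      unfolding M AE using T dist by blast
    have Xs: "\<exists>X1 X2 X3 X5.
                 X1 \<in> sets (Omega n) \<and> X2 \<in> sets (Omega n) \<and>
                 X3 \<in> sets (Omega n) \<and> X5 \<in> sets (Omega n) \<and>
                 X1 \<inter> X2 = {} \<and> X1 \<inter> X3 = {} \<and> X1 \<inter> X5 = {} \<and>
                 X2 \<inter> X3 = {} \<and> X2 \<inter> X5 = {} \<and> X3 \<inter> X5 = {} \<and>
                 X1 \<union> X2 \<union> X3 \<union> X5 = space (Omega n) \<and>
                 (AE x in Omega n. x \<in> X1 \<longrightarrow> T x = x) \<and>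
                 (AE x in Omega n. x \<in> X2 \<longrightarrow> (T ^^ 2) x = x) \<and>
                 (AE x in Omega n. x \<in> X3 \<longrightarrow> (T ^^ 3) x = x) \<and>
                 (AE x in Omega n. x \<in> X5 \<longrightarrow> (T ^^ 5) x = x)"
      by (rule exI[of _ X1], rule exI[of _ X2], rule exI[of _ X3], rule exI[of _ X5])
        (use X TX in \<open>auto simp: M AE space_uniform_count_measure sets_uniform_count_measure\<close>)
    show ?thesis
    proof (intro conjI impI)
      show "\<exists>z0 T N1 N2. is_aut (Omega n) T N1 N2 \<and> Lam3 (Omega n) g T N1 z0 = Lam (Omega n) g"
        using Lam_attained[OF V(1,2)] L unfolding M by blast
    qed (rule exI[of _ z], rule exI[of _ T], rule exI[of _ V], rule exI[of _ V],
        intro conjI impI Xs L autT distT, use enat False in auto)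
  qed
next
  case infinity
  have M: "Omega n = unit_lebesgue" by (simp add: Omega_def infinity)
  interpret prob_space unit_lebesgue by (rule prob_space_unit_lebesgue)
  have gm [measurable]: "g \<in> borel_measurable unit_lebesgue" using g_meas by (simp add: M)
  let ?M = unit_lebesgue
  obtain z \<theta> where
    bal: "\<And>j. j < 3 \<Longrightarrow> prob {x \<in> space ?M. 0 < proj3 \<theta> j (g x - z)} \<le> 1 / 2"
    "\<And>j. j < 3 \<Longrightarrow> prob {x \<in> space ?M. proj3 \<theta> j (g x - z) < 0} \<le> 1 / 2"
    "prob {x \<in> space ?M. proj3 \<theta> 0 (g x - z) * proj3 \<theta> 1 (g x - z) * proj3 \<theta> 2 (g x - z) < 0} \<le> 1 / 2"
    "prob {x \<in> space ?M. 0 < proj3 \<theta> 0 (g x - z) * proj3 \<theta> 1 (g x - z) * proj3 \<theta> 2 (g x - z)} \<le> 1 / 2"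
    using balanced_point[OF gm] by blast
  define a where "a j x = proj3 \<theta> j (g x - z)" for j x
  note bal' = bal[folded a_def]
  \<comment> \<open>Without atoms every smaller measure can be split off, so \<open>Q = UNIV\<close>
    and no parity condition arises.\<close>
  have "\<exists>X Yp Ym. sector_partition unit_lebesgue a X Yp Ym"
  proof (rule sector_partition_halves[where Q=UNIV])
    show "a j \<in> borel_measurable unit_lebesgue" for j unfolding a_def proj3_def by measurable
    show "a 0 x + a 1 x + a 2 x = 0" for x unfolding a_def by (rule proj3_sum)
    show "\<exists>B\<in>sets unit_lebesgue. B \<subseteq> A \<and> prob B = x" if "A \<in> sets unit_lebesgue" "x \<in> UNIV" "0 \<le> x" "x \<le> prob A" for A x
      using unit_lebesgue_split that by blast
    show "2 * prob {x \<in> space ?M. 0 < a j x} \<le> prob (space ?M)"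
      "2 * prob {x \<in> space ?M. a j x < 0} \<le> prob (space ?M)" if "j < 3" for j
      unfolding prob_space using bal'(1,2)[OF that] by linarith+
    show "2 * prob {x \<in> space ?M. a 0 x * a 1 x * a 2 x < 0} \<le> prob (space ?M)"
      "2 * prob {x \<in> space ?M. 0 < a 0 x * a 1 x * a 2 x} \<le> prob (space ?M)"
      unfolding prob_space using bal'(3,4) by linarith+
  qed simp_all
  then obtain X Yp Ym where sp: "sector_partition unit_lebesgue a X Yp Ym" by blast
  obtain N T where NT: "paut unit_lebesgue N T" "emeasure unit_lebesgue (space unit_lebesgue - N) = 0"
    "\<forall>x\<in>N. T (T x) = x \<and> (x \<in> X \<longrightarrow> T x = x) \<and>
    (\<forall>k<3. (x \<in> Yp k \<longrightarrow> T x \<in> Ym k) \<and> (x \<in> Ym k \<longrightarrow> T x \<in> Yp k))"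
    using sector_partition_paut[OF sp swappable_unit_lebesgue] by blast
  have N: "N \<in> sets unit_lebesgue" using NT(1) by (simp add: paut_def)
  have aut: "is_aut (Omega n) T N N" unfolding M by (rule paut_is_aut[OF NT(1,2)])
  \<comment> \<open>Nothing is known about \<open>T\<close> outside \<open>N\<close>, so the
    periodicity on \<open>X\<close> and its complement is obtained almost everywhere.\<close>
  have AN: "AE x in unit_lebesgue. x \<in> N"
    using NT(2) N by (intro AE_I[of _ _ "space unit_lebesgue - N"]) auto
  have adj: "adj3 (a 0) (a 1) (a 2) x (T x)" if "x \<in> N" for x
    by (rule swap_adj3[OF sp]) (use NT(3) that sets.sets_into_space[OF N] in auto)
  have dist: "AE x in Omega n. x \<in> N \<longrightarrow> sqrt 3 / 2 * (cmod (g x - z) + cmod (g (T x) - z)) \<le> cmod (g (T x) - g x)"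
    using adj unfolding a_def by (intro AE_I2) (blast intro: adj3_proj3_dist)
  have L: "ereal (sqrt 3 / 2) \<le> Lam (Omega n) g" by (rule Lam_ge[OF aut dist])
  have sp': "sector_partition (Omega n) (\<lambda>j x. proj3 \<theta> j (g x - z)) X Yp Ym"
    using sp unfolding M a_def .
  have fm: "finite_measure (Omega n)" unfolding M by unfold_locales
  have T1: "AE x in Omega n. x \<in> X \<longrightarrow> T x = x"
    unfolding M using AN by eventually_elim (use NT(3) in blast)
  have T2: "AE x in Omega n. x \<in> space (Omega n) - X \<longrightarrow> (T ^^ 2) x = x"
    unfolding M using AN by eventually_elim (use NT(3) in \<open>simp add: numeral_2_eq_2\<close>)
  show ?thesis
    by (intro conjI impI, rule exI[of _ z], rule exI[of _ T], rule exI[of _ N], rule exI[of _ N],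
        intro conjI impI conjugate_partition[OF fm sp' T1 T2] L aut dist) (use infinity in auto)
qed

end
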